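(* Let $q\ge 1$ and $n\geq 2$ be integers. For every $\alpha=1,\dots,n$ and $r=0,\dots,q$, $\mathcal{W}_{\alpha,r}$ is an irreducible variety of dimension $$\dim\mathcal{W}_{\alpha,r}=q^2+rq-r^2.$$ In particular $\mathcal{W}$ has $nq$ irreducible components. The dimension of $\mathcal{W}$ is given by the maximal dimension of the $\mathcal{W}_{\alpha,r}$'s; it is attained at $r=\lfloor q/2\rfloor$ or equivalently $r=\lceil q/2\rceil$: $$\dim\mathcal{W}=\begin{cases}\frac54q^2&\text{if $q$ is even},\\[2pt]\frac54q^2-\frac14&\text{if $q$ is odd}.\end{cases}$$
   Context: $V^*=Mat_q(\mathbb{C})^{\oplus n}$ is the space of $n$-tuples $(X_1,\dots,X_n)$ of complex $q\times q$ matrices (indices modulo $n$), and $IMM_q^n(X_1,\dots,X_n)=\mathrm{trace}(X_n\cdots X_1)$, a homogeneous polynomial of degree $n$ on $V^*$. $\mathcal{W}\subseteq V^*$ is the $(n-2)$-nd Jacobian locus of the affine hypersurface $IMM_q^n=0$, namely the common zero locus in $V^*$ of all partial derivatives of order $n-2$ of $IMM_q^n$. For $\alpha\in\{1,\dots,n\}$ and $0\leq r\leq q$, $$\mathcal{W}_{\alpha,r}=\{(0,\dots,0,X_{\alpha-1},X_\alpha,0,\dots,0)\in V^*:\ \mathrm{rk}\,X_{\alpha-1}\leq r,\ \mathrm{rk}\,X_\alpha\leq q-r,\ X_\alpha X_{\alpha-1}=0\},$$ where $X_{\alpha-1},X_\alpha$ are in positions $\alpha-1,\alpha$.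
   Formalization: The claims about W itself (nq components, dim W as the maximum, the closed formula) are stated only for n ≥ 4 or q = 1; they fail for n = 2, 3 with q ≥ 2 (e.g. n = 2: W is the irreducible quadric tr(X_2X_1) = 0 of dimension 2q²−1). *)

theory Defs
  imports "HOL-Analysis.Analysis"
begin

section \<open>Irreducibility and dimension of topological spaces\<close>

definition irreducible_space :: "'a topology \<Rightarrow> bool" where
  "irreducible_space T \<longleftrightarrow>
     topspace T \<noteq> {} \<and>
     (\<forall>A B. closedin T A \<and> closedin T B \<and> topspace T = A \<union> B \<longrightarrow>
        A = topspace T \<or> B = topspace T)"

definition irreducible_in :: "'a topology \<Rightarrow> 'a set \<Rightarrow> bool" where
  "irreducible_in T S \<longleftrightarrow> S \<subseteq> topspace T \<and> irreducible_space (subtopology T S)"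

definition irreducible_components :: "'a topology \<Rightarrow> 'a set set" where
  "irreducible_components T =
     {C. irreducible_in T C \<and> (\<forall>D. irreducible_in T D \<and> C \<subseteq> D \<longrightarrow> D = C)}"

text \<open>The Krull dimension: the supremum of the lengths \<open>m\<close> of chains
  \<open>Z 0 \<subset> Z 1 \<subset> \<dots> \<subset> Z m\<close> of irreducible closed subsets.  As a value of type
  \<^typ>\<open>enat\<close> it is \<open>0\<close> for the empty space.\<close>

definition krull_dim :: "'a topology \<Rightarrow> enat" where
  "krull_dim T =
     Sup {enat m | m. \<exists>Z :: nat \<Rightarrow> 'a set.
        (\<forall>i\<le>m. closedin T (Z i) \<and> irreducible_in T (Z i)) \<and>
        (\<forall>i<m. Z i \<subset> Z (Suc i))}"

section \<open>The Zariski topology on tuples of matrices\<close>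

text \<open>The tuples \<open>(X\<^sub>1, \<dots>, X\<^sub>n)\<close> of complex square matrices of size \<open>q = CARD('q)\<close>.\<close>

definition tuples :: "nat \<Rightarrow> (nat \<Rightarrow> complex^'q^'q) set" where
  "tuples n = ({1..n} \<rightarrow>\<^sub>E UNIV)"

text \<open>Polynomials in the \<open>n q\<^sup>2\<close> matrix entries, as functions; over the infinite field of
  complex numbers a polynomial is determined by its function on \<^term>\<open>tuples n\<close>.\<close>

inductive_set poly_funs :: "nat \<Rightarrow> ((nat \<Rightarrow> complex^'q^'q) \<Rightarrow> complex) set" for n :: nat where
  const: "(\<lambda>X. c) \<in> poly_funs n"
| entry: "k \<in> {1..n} \<Longrightarrow> (\<lambda>X. X k $ i $ j) \<in> poly_funs n"
| add: "f \<in> poly_funs n \<Longrightarrow> g \<in> poly_funs n \<Longrightarrow> (\<lambda>X. f X + g X) \<in> poly_funs n"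
| mult: "f \<in> poly_funs n \<Longrightarrow> g \<in> poly_funs n \<Longrightarrow> (\<lambda>X. f X * g X) \<in> poly_funs n"

definition zero_locus ::
    "nat \<Rightarrow> ((nat \<Rightarrow> complex^'q^'q) \<Rightarrow> complex) set \<Rightarrow> (nat \<Rightarrow> complex^'q^'q) set" where
  "zero_locus n F = {X \<in> tuples n. \<forall>f\<in>F. f X = 0}"

definition zariski :: "nat \<Rightarrow> (nat \<Rightarrow> complex^'q^'q) topology" where
  "zariski n = topology (\<lambda>U. U \<subseteq> tuples n \<and>
     (\<exists>F \<subseteq> poly_funs n. tuples n - U = zero_locus n F))"

lemma zero_locus_Un:
  "zero_locus n F \<union> zero_locus n G = zero_locus n {(\<lambda>X. f X * g X) | f g. f \<in> F \<and> g \<in> G}"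
  (is "_ = zero_locus n ?H")
proof (intro equalityI subsetI)
  fix X assume X: "X \<in> zero_locus n ?H"
  have H: "f X * g X = 0" if "f \<in> F" "g \<in> G" for f g
  proof -
    have "(\<lambda>X. f X * g X) \<in> ?H"
      using that by (intro CollectI exI[of _ f] exI[of _ g]) simp
    moreover have "\<forall>h\<in>?H. h X = 0"
      using X unfolding zero_locus_def by (elim CollectE conjE)
    ultimately show ?thesis
      by (rule bspec[rotated])
  qed
  show "X \<in> zero_locus n F \<union> zero_locus n G"
  proof (cases "\<forall>f\<in>F. f X = 0")
    case True
    then show ?thesis
      using X by (simp add: zero_locus_def)
  next
    case False
    then obtain f where f: "f \<in> F" "f X \<noteq> 0"
      by (auto simp only: ball_simps)
    have "g X = 0" if "g \<in> G" for g
      using H[OF f(1) that] f(2) by simp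
    then show ?thesis
      using X by (simp add: zero_locus_def)
  qed
qed (auto simp: zero_locus_def)

lemma istopology_zariski:
  "istopology (\<lambda>U :: (nat \<Rightarrow> complex^'q^'q) set. U \<subseteq> tuples n \<and>
     (\<exists>F \<subseteq> poly_funs n. tuples n - U = zero_locus n F))"
  (is "istopology ?L")
  unfolding istopology_def
proof (intro conjI allI impI)
  fix S T :: "(nat \<Rightarrow> complex^'q^'q) set"
  assume S: "?L S" and T: "?L T"
  from S show "S \<inter> T \<subseteq> tuples n"
    by (simp add: le_infI1)
  from S obtain F where F: "F \<subseteq> poly_funs n" "tuples n - S = zero_locus n F"
    by (elim conjE exE)
  from T obtain G where G: "G \<subseteq> poly_funs n" "tuples n - T = zero_locus n G"
    by (elim conjE exE)
  let ?H = "{(\<lambda>X. f X * g X) | f g. f \<in> F \<and> g \<in> G}"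
  show "\<exists>F\<subseteq>poly_funs n. tuples n - (S \<inter> T) = zero_locus n F"
  proof (intro exI[of _ ?H] conjI)
    show "?H \<subseteq> poly_funs n"
      using subsetD[OF F(1)] subsetD[OF G(1)] by (auto intro: poly_funs.mult)
    show "tuples n - (S \<inter> T) = zero_locus n ?H"
      by (simp only: Diff_Int F(2) G(2) zero_locus_Un)
  qed
next
  fix K :: "(nat \<Rightarrow> complex^'q^'q) set set"
  assume K: "\<forall>U\<in>K. ?L U"
  then show "\<Union>K \<subseteq> tuples n"
    by (simp add: Union_least)
  from K have "\<forall>U\<in>K. \<exists>F\<subseteq>poly_funs n. tuples n - U = zero_locus n F"
    by simp
  then obtain F where F: "\<And>U. U \<in> K \<Longrightarrow> F U \<subseteq> poly_funs n"
    "\<And>U. U \<in> K \<Longrightarrow> tuples n - U = zero_locus n (F U)"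
    by metis
  show "\<exists>F\<subseteq>poly_funs n. tuples n - \<Union>K = zero_locus n F"
  proof (intro exI[of _ "\<Union>U\<in>K. F U"] conjI)
    show "(\<Union>U\<in>K. F U) \<subseteq> poly_funs n"
      using F(1) by (simp add: UN_least)
    have "tuples n - \<Union>K = tuples n \<inter> (\<Inter>U\<in>K. tuples n - U)"
      by auto
    also have "\<dots> = tuples n \<inter> (\<Inter>U\<in>K. zero_locus n (F U))"
      using F(2) by simp
    also have "\<dots> = zero_locus n (\<Union>U\<in>K. F U)"
      by (auto simp: zero_locus_def)
    finally show "tuples n - \<Union>K = zero_locus n (\<Union>U\<in>K. F U)" .
  qed
qed

lemma openin_zariski:
  "openin (zariski n) U \<longleftrightarrow>
     U \<subseteq> tuples n \<and> (\<exists>F \<subseteq> poly_funs n. tuples n - U = zero_locus n F)"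
  unfolding zariski_def by (simp add: topology_inverse'[OF istopology_zariski])

lemma topspace_zariski: "topspace (zariski n) = tuples n"
proof
  show "topspace (zariski n) \<subseteq> tuples n"
    using openin_zariski openin_topspace by blast
  have "tuples n - tuples n = zero_locus n {\<lambda>X. 1}"
    by (simp add: zero_locus_def)
  moreover have "{\<lambda>X. 1} \<subseteq> poly_funs n"
    by (simp add: poly_funs.const)
  ultimately have "openin (zariski n) (tuples n)"
    unfolding openin_zariski by blast
  then show "tuples n \<subseteq> topspace (zariski n)"
    by (rule openin_subset)
qed

lemma closedin_zariski:
  "closedin (zariski n) Z \<longleftrightarrow> (\<exists>F \<subseteq> poly_funs n. Z = zero_locus n F)"
proof -
  have "zero_locus n F \<subseteq> tuples n" for F :: "((nat \<Rightarrow> complex^'a^'a) \<Rightarrow> complex) set"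
    by (auto simp: zero_locus_def)
  moreover have "tuples n - (tuples n - Z) = Z" if "Z \<subseteq> tuples n"
    using that by blast
  ultimately show ?thesis
    unfolding closedin_def openin_zariski topspace_zariski by auto
qed

section \<open>Iterated matrix multiplication and its Jacobian locus\<close>

text \<open>\<open>matprod X k\<close> is \<open>X\<^sub>k \<cdots> X\<^sub>1\<close>.\<close>

fun matprod :: "(nat \<Rightarrow> complex^'q^'q) \<Rightarrow> nat \<Rightarrow> complex^'q^'q" where
  "matprod X 0 = mat 1"
| "matprod X (Suc k) = X (Suc k) ** matprod X k"

definition IMM :: "nat \<Rightarrow> (nat \<Rightarrow> complex^'q^'q) \<Rightarrow> complex" where
  "IMM n X = trace (matprod X n)"

definition set_entry :: "'q \<Rightarrow> 'q \<Rightarrow> complex \<Rightarrow> complex^'q^'q \<Rightarrow> complex^'q^'q" where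
  "set_entry i j t A = (\<chi> a b. if a = i \<and> b = j then t else A $ a $ b)"

text \<open>The partial derivative with respect to the entry \<open>(i, j)\<close> of the \<open>k\<close>-th matrix.\<close>

fun partial_deriv :: "nat \<times> 'q \<times> 'q \<Rightarrow>
    ((nat \<Rightarrow> complex^'q^'q) \<Rightarrow> complex) \<Rightarrow> (nat \<Rightarrow> complex^'q^'q) \<Rightarrow> complex" where
  "partial_deriv (k, i, j) f X =
     deriv (\<lambda>t. f (X(k := set_entry i j t (X k)))) (X k $ i $ j)"

definition jacobian_locus ::
    "nat \<Rightarrow> nat \<Rightarrow> ((nat \<Rightarrow> complex^'q^'q) \<Rightarrow> complex) \<Rightarrow> (nat \<Rightarrow> complex^'q^'q) set" where
  "jacobian_locus n m f =
     {X \<in> tuples n. \<forall>vs. length vs = m \<and> set vs \<subseteq> {1..n} \<times> UNIV \<longrightarrow>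
        foldr partial_deriv vs f X = 0}"

definition W_locus :: "nat \<Rightarrow> (nat \<Rightarrow> complex^'q^'q) set" where
  "W_locus n = jacobian_locus n (n - 2) (IMM n)"

text \<open>The index \<open>\<alpha> - 1\<close> modulo \<open>n\<close>, with representatives \<open>1, \<dots>, n\<close>.\<close>

definition cpred :: "nat \<Rightarrow> nat \<Rightarrow> nat" where
  "cpred n \<alpha> = (if \<alpha> = 1 then n else \<alpha> - 1)"

definition W_piece :: "nat \<Rightarrow> nat \<Rightarrow> nat \<Rightarrow> (nat \<Rightarrow> complex^'q^'q) set" where
  "W_piece n \<alpha> r =
     {X \<in> tuples n.
        (\<forall>k \<in> {1..n} - {cpred n \<alpha>, \<alpha>}. X k = 0) \<and>
        rank (X (cpred n \<alpha>)) \<le> r \<and> rank (X \<alpha>) \<le> CARD('q) - r \<and>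
        X \<alpha> ** X (cpred n \<alpha>) = 0}"

definition zdim :: "nat \<Rightarrow> (nat \<Rightarrow> complex^'q^'q) set \<Rightarrow> enat" where
  "zdim n S = krull_dim (subtopology (zariski n) S)"

end

theory Submission
  imports Defs "HOL-Computational_Algebra.Polynomial"
begin

text \<open>For \<open>K\<close> of cardinality \<open>r\<close>, the piece \<open>W\<^bsub>\<alpha>,r\<^esub>\<close> is the Zariski closure of a polynomial chart with
  \<open>q\<^sup>2 + r q - r\<^sup>2\<close> parameters, namely \<open>A = (Q; M Q)\<close>, \<open>B = (- R M, R)\<close> in block form; hence it is
  irreducible. A flag of coordinate subspaces of the parameter space gives a chain of that length.
  Conversely, a chain of length \<open>k\<close> yields functions \<open>f\<^sub>1, \<dots>, f\<^sub>k\<close>, with \<open>f\<^sub>i\<close> vanishing on one member of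
  the chain but not on the next, and these are algebraically independent: the \<open>m\<^sup>k\<close> monomials with
  exponents below \<open>m\<close> are linearly independent. Pulled back along the chart they live in a space of
  dimension \<open>O(m\<^sup>d)\<close>, where \<open>d\<close> is the number of parameters, so \<open>k \<le> d\<close>.

  As \<open>IMM\<close> is multilinear, its derivatives of order \<open>n - 2\<close> arise by substituting elementary matrices
  at \<open>n - 2\<close> positions. For \<open>n \<ge> 4\<close> they all vanish iff at most two cyclically adjacent matrices are nonzero and
  their product is \<open>0\<close>; so the Jacobian locus is the union of the pieces, of which those with
  \<open>r < q\<close> are pairwise incomparable.\<close>

section \<open>Separately polynomial functions\<close>

text \<open>The restriction to n \<ge> 4 or q = 1 in the claims on the whole locus comes from small
  cycles. For n = 3 and q \<ge> 2, three copies of a nilpotent elementary matrix have all cyclic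
  products zero, so they lie in the locus without being supported on two positions; for n = 2 the
  locus is the hypersurface trace(X_2 X_1) = 0 itself. For q = 1 a product of two scalars vanishes
  only if one of them does.

  The chart misses points of a piece for which the relevant subspace is not a graph over the
  coordinates in K, so its density needs proof. The curves used for this must be polynomial, which
  is why inverses are replaced by adjugates.

  The lower bound for the dimension has its own obstacle: M enters A only through M Q and cannot be
  read off an entry of A unless Q is fixed. This dictates the order of the parameters in the flag.

  Polynomials in the parameters are treated as functions with a degree bound in each variable, since
  such a function is determined by its values on a grid, and m^k monomials outgrow a grid of order
  m^d as soon as k > d.\<close>

definition poly_fun_upto :: "nat \<Rightarrow> (complex \<Rightarrow> complex) \<Rightarrow> bool" where
  "poly_fun_upto m h \<longleftrightarrow> (\<exists>p. degree p \<le> m \<and> (\<forall>t. h t = poly p t))"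

lemma poly_fun_upto_const [intro]: "poly_fun_upto m (\<lambda>t. c)"
  unfolding poly_fun_upto_def by (rule exI[of _ "[:c:]"]) simp

lemma poly_fun_upto_ident [intro]: "poly_fun_upto (Suc m) (\<lambda>t. t)"
  unfolding poly_fun_upto_def by (rule exI[of _ "[:0, 1:]"]) simp

lemma poly_fun_upto_mono: "poly_fun_upto m h \<Longrightarrow> m \<le> m' \<Longrightarrow> poly_fun_upto m' h"
  unfolding poly_fun_upto_def by force

lemma poly_fun_upto_add:
  assumes "poly_fun_upto m h" "poly_fun_upto m g"
  shows "poly_fun_upto m (\<lambda>t. h t + g t)"
proof -
  obtain p r where "degree p \<le> m" "\<forall>t. h t = poly p t" "degree r \<le> m" "\<forall>t. g t = poly r t"
    using assms unfolding poly_fun_upto_def by blast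
  then show ?thesis
    unfolding poly_fun_upto_def by (intro exI[of _ "p + r"]) (simp add: degree_add_le)
qed

lemma poly_fun_upto_mult:
  assumes "poly_fun_upto m h" "poly_fun_upto m' g"
  shows "poly_fun_upto (m + m') (\<lambda>t. h t * g t)"
proof -
  obtain p r where "degree p \<le> m" "\<forall>t. h t = poly p t" "degree r \<le> m'" "\<forall>t. g t = poly r t"
    using assms unfolding poly_fun_upto_def by blast
  then show ?thesis
    unfolding poly_fun_upto_def
    by (intro exI[of _ "p * r"]) (use degree_mult_le[of p r] in simp)
qed

lemma poly_fun_upto_finite_zeros:
  assumes "poly_fun_upto m h" "h s \<noteq> 0"
  shows "finite {t. h t = 0}"
proof -
  obtain p where p: "\<forall>t. h t = poly p t"
    using assms unfolding poly_fun_upto_def by blast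
  then have "p \<noteq> 0"
    using assms(2) by auto
  then show ?thesis
    using poly_roots_finite[of p] p by simp
qed

lemma poly_fun_upto_eq_0:
  assumes "poly_fun_upto m h" "finite A" "card A > m" "\<And>t. t \<in> A \<Longrightarrow> h t = 0"
  shows "h s = 0"
proof -
  obtain p where p: "degree p \<le> m" "\<forall>t. h t = poly p t"
    using assms unfolding poly_fun_upto_def by blast
  have "p = 0"
  proof (rule ccontr)
    assume "p \<noteq> 0"
    then have "card A \<le> card {t. poly p t = 0}"
      using assms p by (intro card_mono poly_roots_finite) auto
    also have "\<dots> \<le> degree p"
      using \<open>p \<noteq> 0\<close> by (rule card_poly_roots_bound)
    finally show False
      using assms(3) p(1) by simp
  qed
  then show ?thesis
    using p by simp
qed

text \<open>Stands in for polynomials in many variables: only the degree along each coordinate line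
  is bounded. Both uses, avoiding roots and testing for zero on a grid, change one coordinate at a
  time and need nothing more.\<close>

definition sep_poly :: "nat \<Rightarrow> (('v \<Rightarrow> complex) \<Rightarrow> complex) \<Rightarrow> bool" where
  "sep_poly m f \<longleftrightarrow> (\<forall>v x. poly_fun_upto m (\<lambda>t. f (x(v := t))))"

lemma sep_poly_const [intro]: "sep_poly m (\<lambda>x. c)"
  unfolding sep_poly_def by auto

lemma sep_poly_var [intro]: "sep_poly (Suc m) (\<lambda>x. x v)"
  unfolding sep_poly_def
proof (intro allI)
  fix w and x :: "'a \<Rightarrow> complex"
  show "poly_fun_upto (Suc m) (\<lambda>t. (x(w := t)) v)"
    by (cases "v = w") auto
qed

lemma sep_poly_mono: "sep_poly m f \<Longrightarrow> m \<le> m' \<Longrightarrow> sep_poly m' f"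
  unfolding sep_poly_def using poly_fun_upto_mono by blast

lemma sep_poly_add: "sep_poly m f \<Longrightarrow> sep_poly m g \<Longrightarrow> sep_poly m (\<lambda>x. f x + g x)"
  unfolding sep_poly_def using poly_fun_upto_add by blast

lemma sep_poly_mult: "sep_poly m f \<Longrightarrow> sep_poly m' g \<Longrightarrow> sep_poly (m + m') (\<lambda>x. f x * g x)"
  unfolding sep_poly_def using poly_fun_upto_mult by blast

lemma sep_poly_sum:
  "finite A \<Longrightarrow> (\<And>a. a \<in> A \<Longrightarrow> sep_poly m (f a)) \<Longrightarrow> sep_poly m (\<lambda>x. \<Sum>a\<in>A. f a x)"
  by (induction A rule: finite_induct) (auto intro: sep_poly_add)

lemma sep_poly_power: "sep_poly m f \<Longrightarrow> sep_poly (k * m) (\<lambda>x. f x ^ k)"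
  by (induction k) (auto intro: sep_poly_mult)

text \<open>The coordinates in which the two points differ are set, one by one, to a common value
  outside the finite root sets of both one-variable polynomials, so the points merge. Common
  coordinates are never touched, so the result stays in every coordinate subspace containing both
  points.\<close>

lemma sep_poly_common_nonzero:
  assumes "sep_poly m f" "sep_poly m' g" "f x \<noteq> 0" "g y \<noteq> 0" "finite {v. x v \<noteq> y v}"
  shows "\<exists>z. (\<forall>v. x v = y v \<longrightarrow> z v = x v) \<and> f z \<noteq> 0 \<and> g z \<noteq> 0"
  using assms(3-5)
proof (induction "card {v. x v \<noteq> y v}" arbitrary: x y)
  case 0
  then have "x = y"
    by auto
  then show ?case
    using 0 by auto
next
  case (Suc c)
  have "{v. x v \<noteq> y v} \<noteq> {}"
    using Suc.hyps(2) by (intro notI) simp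
  then obtain v where v: "x v \<noteq> y v"
    by blast
  have "poly_fun_upto m (\<lambda>t. f (x(v := t)))" "poly_fun_upto m' (\<lambda>t. g (y(v := t)))"
    using assms unfolding sep_poly_def by blast+
  then have "finite {t. f (x(v := t)) = 0}" "finite {t. g (y(v := t)) = 0}"
    using Suc.prems poly_fun_upto_finite_zeros[where s = "x v"]
      poly_fun_upto_finite_zeros[where s = "y v"] by auto
  then have "finite ({t. f (x(v := t)) = 0} \<union> {t. g (y(v := t)) = 0})"
    by simp
  then obtain t where t: "f (x(v := t)) \<noteq> 0" "g (y(v := t)) \<noteq> 0"
    using ex_new_if_finite[OF infinite_UNIV_char_0] by blast
  have eq: "{w. (x(v := t)) w \<noteq> (y(v := t)) w} = {w. x w \<noteq> y w} - {v}"
    by auto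
  have "\<exists>z. (\<forall>w. (x(v := t)) w = (y(v := t)) w \<longrightarrow> z w = (x(v := t)) w) \<and> f z \<noteq> 0 \<and> g z \<noteq> 0"
  proof (rule Suc.hyps(1)[OF _ t])
    show "c = card {w. (x(v := t)) w \<noteq> (y(v := t)) w}"
      unfolding eq using Suc.hyps(2) Suc.prems(3) v by (subst card_Diff_singleton) auto
    show "finite {w. (x(v := t)) w \<noteq> (y(v := t)) w}"
      unfolding eq using Suc.prems(3) by simp
  qed
  then show ?case
    using v by (metis fun_upd_other)
qed

text \<open>Induction frees one coordinate of \<open>I\<close> at a time: with the others fixed, a
  polynomial of degree at most \<open>m\<close> has more than \<open>m\<close> zeros. Coordinates
  outside \<open>I\<close> stay at those of \<open>y\<close>.\<close>

lemma sep_poly_eq_0_if_grid: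
  assumes "finite I" "sep_poly m f" "finite A" "card A > m"
    and "\<And>x. (\<And>v. v \<in> I \<Longrightarrow> x v \<in> A) \<Longrightarrow> (\<And>v. v \<notin> I \<Longrightarrow> x v = y v) \<Longrightarrow> f x = 0"
  shows "f y = 0"
  using assms(1,5)
proof (induction I arbitrary: y rule: finite_induct)
  case empty
  then show ?case
    by auto
next
  case (insert v I)
  have "f (y(v := s)) = 0" for s
  proof (rule poly_fun_upto_eq_0[where h = "\<lambda>t. f (y(v := t))", OF _ assms(3,4)])
    show "poly_fun_upto m (\<lambda>t. f (y(v := t)))"
      using assms(2) unfolding sep_poly_def by blast
    fix t assume t: "t \<in> A"
    show "f (y(v := t)) = 0"
    proof (rule insert.IH)
      fix x assume x: "\<And>w. w \<in> I \<Longrightarrow> x w \<in> A" "\<And>w. w \<notin> I \<Longrightarrow> x w = (y(v := t)) w"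
      show "f x = 0"
      proof (rule insert.prems)
        fix w show "w \<in> insert v I \<Longrightarrow> x w \<in> A" "w \<notin> insert v I \<Longrightarrow> x w = y w"
          using x[of w] t insert.hyps by (cases "w = v"; auto)+
      qed
    qed
  qed
  from this[of "y v"] show ?case
    by simp
qed

text \<open>Gaussian elimination, one equation per step. Removing a nontrivial equation costs one
  unknown, so there remain more unknowns than equations.\<close>

lemma homogeneous_system_nontrivial:
  fixes a :: "'e \<Rightarrow> 'u \<Rightarrow> 'a::field"
  assumes "finite E" "finite U" "card E < card U"
  shows "\<exists>c. (\<exists>u\<in>U. c u \<noteq> 0) \<and> (\<forall>e\<in>E. (\<Sum>u\<in>U. a e u * c u) = 0)"
  using assms
proof (induction E arbitrary: U a rule: finite_induct)
  case empty
  then obtain u where "u \<in> U"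
    by (metis card.empty card_gt_0_iff ex_in_conv)
  then show ?case
    by (intro exI[of _ "\<lambda>_. 1"]) auto
next
  case (insert e E)
  show ?case
  proof (cases "\<forall>u\<in>U. a e u = 0")
    case True
    have "card E < card U"
      using insert by simp
    from insert.IH[OF \<open>finite U\<close> this, of a] obtain c where
      "\<exists>u\<in>U. c u \<noteq> 0" "\<forall>e\<in>E. (\<Sum>u\<in>U. a e u * c u) = 0"
      by blast
    then show ?thesis
      using True by (intro exI[of _ c]) auto
  next
    case False
    then obtain w where w: "w \<in> U" "a e w \<noteq> 0"
      by blast
    let ?U = "U - {w}"
    \<comment> \<open>Row \<open>e'\<close> minus the multiple of row \<open>e\<close> that cancels
      the pivot column \<open>w\<close>.\<close>
    define b where "b e' u = a e' u - a e' w * a e u / a e w" for e' u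
    have "card E < card ?U"
      using insert w by simp
    from insert.IH[OF _ this, of b] obtain c where
      c: "\<exists>u\<in>?U. c u \<noteq> 0" "\<forall>e\<in>E. (\<Sum>u\<in>?U. b e u * c u) = 0"
      using \<open>finite U\<close> by blast
    define s where "s = (\<Sum>u\<in>?U. a e u * c u)"
    define c' where "c' = c(w := - s / a e w)"
    have split: "(\<Sum>u\<in>U. a e' u * c' u) = - a e' w * s / a e w + (\<Sum>u\<in>?U. a e' u * c u)" for e'
      using \<open>finite U\<close> w(1) by (subst sum.remove[of U w]) (auto simp: c'_def intro!: sum.cong)
    have "(\<Sum>u\<in>U. a e' u * c' u) = 0" if "e' \<in> insert e E" for e'
    proof (cases "e' = e")
      case True
      then show ?thesis
        using w(2) by (simp add: split s_def)
    next
      case False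
      then have "0 = (\<Sum>u\<in>?U. b e' u * c u)"
        using c(2) that by auto
      also have "\<dots> = (\<Sum>u\<in>?U. a e' u * c u) - a e' w / a e w * s"
        unfolding b_def s_def sum_distrib_left sum_subtractf[symmetric]
        by (intro sum.cong) (auto simp: algebra_simps)
      finally show ?thesis
        by (simp add: split)
    qed
    moreover have "\<exists>u\<in>U. c' u \<noteq> 0"
      using c(1) by (auto simp: c'_def)
    ultimately show ?thesis
      by blast
  qed
qed

text \<open>A function of degree at most \<open>m\<close> in each of the variables from \<open>I\<close> is determined by its
  values on a grid with \<open>(m + 1)\<^bsup>card I\<^esup>\<close> points.\<close>

lemma sep_poly_dependent:
  fixes g :: "nat \<Rightarrow> ('v \<Rightarrow> complex) \<Rightarrow> complex"
  assumes I: "finite I" and g: "\<And>j. j < N \<Longrightarrow> sep_poly m (g j)"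
    and dep: "\<And>j x y. j < N \<Longrightarrow> (\<And>v. v \<in> I \<Longrightarrow> x v = y v) \<Longrightarrow> g j x = g j y"
    and N: "(m + 1) ^ card I < N"
  shows "\<exists>c. (\<exists>j<N. c j \<noteq> 0) \<and> (\<forall>x. (\<Sum>j<N. c j * g j x) = 0)"
proof -
  define A where "A = (of_nat ` {..m} :: complex set)"
  have A: "finite A" "card A = m + 1"
    unfolding A_def by (simp_all add: card_image inj_on_def)
  define E where "E = (I \<rightarrow>\<^sub>E A)"
  have "finite E" "card E = (m + 1) ^ card I"
    unfolding E_def using I A by (auto simp: finite_PiE card_PiE)
  then obtain c where c: "\<exists>j\<in>{..<N}. c j \<noteq> 0" "\<forall>x\<in>E. (\<Sum>j<N. g j x * c j) = 0"
    using homogeneous_system_nontrivial[of E "{..<N}" "\<lambda>x j. g j x"] N by auto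
  have "(\<Sum>j<N. c j * g j y) = 0" for y
  proof (rule sep_poly_eq_0_if_grid[where f = "\<lambda>x. \<Sum>j<N. c j * g j x" and m = m, OF I _ A(1)])
    have "sep_poly (0 + m) (\<lambda>x. c j * g j x)" if "j < N" for j
      using that by (intro sep_poly_mult) (auto intro: g)
    then show "sep_poly m (\<lambda>x. \<Sum>j<N. c j * g j x)"
      by (intro sep_poly_sum) auto
    fix x assume x: "\<And>v. v \<in> I \<Longrightarrow> x v \<in> A"
    \<comment> \<open>Grid points in \<open>E\<close> are extensional, so that \<open>E\<close> is
      finite; \<open>dep\<close> makes the values at \<open>x\<close> and at its restriction
      agree.\<close>
    have "restrict x I \<in> E"
      using x by (auto simp: E_def)
    then have "(\<Sum>j<N. g j (restrict x I) * c j) = 0"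
      using c by blast
    also have "(\<Sum>j<N. g j (restrict x I) * c j) = (\<Sum>j<N. c j * g j x)"
      by (intro sum.cong refl) (simp add: dep[of _ "restrict x I" x])
    finally show "(\<Sum>j<N. c j * g j x) = 0" .
  qed (use A in simp)
  then show ?thesis
    using c(1) by auto
qed

section \<open>Irreducible sets and dimension in the Zariski topology\<close>

lemma irreducible_in_subtopology:
  "irreducible_in (subtopology T S) Z \<longleftrightarrow> irreducible_in T Z \<and> Z \<subseteq> S"
  unfolding irreducible_in_def subtopology_subtopology topspace_subtopology
  by (metis inf.absorb2 le_inf_iff)

lemma irreducible_in_nonempty: "irreducible_in T S \<Longrightarrow> S \<noteq> {}"
  unfolding irreducible_in_def irreducible_space_def topspace_subtopology by blast

lemma irreducible_in_subset_Union:
  assumes "finite F" "irreducible_in T D" "D \<subseteq> \<Union>F" "\<And>C. C \<in> F \<Longrightarrow> closedin T C"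
  shows "\<exists>C\<in>F. D \<subseteq> C"
  using assms(1,3,4)
proof (induction F rule: finite_induct)
  case empty
  then show ?case
    using assms(2) by (auto simp: irreducible_in_def irreducible_space_def)
next
  case (insert C F)
  have D: "D \<subseteq> topspace T" "irreducible_space (subtopology T D)"
    using assms(2) by (auto simp: irreducible_in_def)
  then have top: "topspace (subtopology T D) = D"
    by auto
  have "closedin T (\<Union>F)"
    using insert by (intro closedin_Union) auto
  then have "closedin (subtopology T D) (\<Union>F \<inter> D)" "closedin (subtopology T D) (C \<inter> D)"
    using insert.prems by (auto simp: closedin_subtopology)
  moreover have "D = (C \<inter> D) \<union> (\<Union>F \<inter> D)"
    using insert.prems by auto
  ultimately have "C \<inter> D = D \<or> \<Union>F \<inter> D = D"
    using D(2) unfolding irreducible_space_def top by blast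
  then consider "D \<subseteq> C" | "D \<subseteq> \<Union>F"
    by blast
  then show ?case
  proof cases
    case 2
    then show ?thesis
      using insert.IH insert.prems(2) by simp
  qed simp
qed

text \<open>An irreducible subset of the union lies in a single member. Hence every maximal one is a
  member, and incomparability makes every member maximal.\<close>

lemma irreducible_components_Union:
  assumes "finite F" "\<And>C. C \<in> F \<Longrightarrow> closedin T C" "\<And>C. C \<in> F \<Longrightarrow> irreducible_in T C"
    and "\<And>C D. C \<in> F \<Longrightarrow> D \<in> F \<Longrightarrow> C \<subseteq> D \<Longrightarrow> C = D"
  shows "irreducible_components (subtopology T (\<Union>F)) = F"
proof
  show "irreducible_components (subtopology T (\<Union>F)) \<subseteq> F"
  proof
    fix C assume "C \<in> irreducible_components (subtopology T (\<Union>F))"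
    then have C: "irreducible_in T C" "C \<subseteq> \<Union>F"
      "\<And>D. irreducible_in T D \<Longrightarrow> D \<subseteq> \<Union>F \<Longrightarrow> C \<subseteq> D \<Longrightarrow> D = C"
      by (auto simp: irreducible_components_def irreducible_in_subtopology)
    obtain D where "D \<in> F" "C \<subseteq> D"
      using irreducible_in_subset_Union[OF assms(1) C(1,2) assms(2)] by blast
    then show "C \<in> F"
      using C(3)[of D] assms(3) by auto
  qed
  show "F \<subseteq> irreducible_components (subtopology T (\<Union>F))"
  proof
    fix C assume C: "C \<in> F"
    have "D = C" if D: "irreducible_in T D" "D \<subseteq> \<Union>F" "C \<subseteq> D" for D
    proof -
      obtain C' where "C' \<in> F" "D \<subseteq> C'"
        using irreducible_in_subset_Union[OF assms(1) D(1,2) assms(2)] by blast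
      then show ?thesis
        using assms(4)[OF C, of C'] D(3) by auto
    qed
    then show "C \<in> irreducible_components (subtopology T (\<Union>F))"
      using C assms(3) by (auto simp: irreducible_components_def irreducible_in_subtopology)
  qed
qed

section \<open>Chains of irreducible closed sets and Krull dimension\<close>

definition irreducible_chain :: "'a topology \<Rightarrow> nat \<Rightarrow> (nat \<Rightarrow> 'a set) \<Rightarrow> bool" where
  "irreducible_chain T m Z \<longleftrightarrow>
     (\<forall>i\<le>m. closedin T (Z i) \<and> irreducible_in T (Z i)) \<and> (\<forall>i<m. Z i \<subset> Z (Suc i))"

lemma irreducible_chain_subset:
  assumes "irreducible_chain T m Z" "i \<le> m"
  shows "Z i \<subseteq> Z m"
proof -
  have "Z i \<subseteq> Z j" if "i \<le> j" "j \<le> m" for j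
    using that
  proof (induction j rule: dec_induct)
    case (step j)
    then have "Z j \<subset> Z (Suc j)"
      using assms(1) by (auto simp: irreducible_chain_def)
    then show ?case
      using step by auto
  qed simp
  then show ?thesis
    using assms(2) by simp
qed

text \<open>Closed subsets of a closed \<open>S\<close> are closed in the ambient space. So all
  chains can be taken in \<open>T\<close> with only the top constrained, which makes the dimensions
  of different subspaces comparable.\<close>

lemma krull_dim_subtopology_closed:
  assumes "closedin T S"
  shows "krull_dim (subtopology T S) = Sup {enat m |m. \<exists>Z. irreducible_chain T m Z \<and> Z m \<subseteq> S}"
proof -
  have "(\<forall>i\<le>m. closedin (subtopology T S) (Z i) \<and> irreducible_in (subtopology T S) (Z i)) \<and>
      (\<forall>i<m. Z i \<subset> Z (Suc i)) \<longleftrightarrow> irreducible_chain T m Z \<and> Z m \<subseteq> S" for m Z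
  proof
    assume "irreducible_chain T m Z \<and> Z m \<subseteq> S"
    then show "(\<forall>i\<le>m. closedin (subtopology T S) (Z i) \<and> irreducible_in (subtopology T S) (Z i)) \<and>
        (\<forall>i<m. Z i \<subset> Z (Suc i))"
      using irreducible_chain_subset[of T m Z] closedin_closed_subtopology[OF assms]
      unfolding irreducible_chain_def irreducible_in_subtopology by (meson order_trans)
  next
    assume "(\<forall>i\<le>m. closedin (subtopology T S) (Z i) \<and> irreducible_in (subtopology T S) (Z i)) \<and>
        (\<forall>i<m. Z i \<subset> Z (Suc i))"
    then show "irreducible_chain T m Z \<and> Z m \<subseteq> S"
      using closedin_closed_subtopology[OF assms]
      unfolding irreducible_chain_def irreducible_in_subtopology by simp
  qed
  then show ?thesis
    unfolding krull_dim_def by simp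
qed

text \<open>The top of a chain is irreducible, so it lies in one member of \<open>F\<close> together
  with the whole chain.\<close>

lemma krull_dim_Union:
  assumes "finite F" "F \<noteq> {}" "\<And>C. C \<in> F \<Longrightarrow> closedin T C"
  shows "krull_dim (subtopology T (\<Union>F)) = Max ((\<lambda>C. krull_dim (subtopology T C)) ` F)"
proof (rule antisym)
  have clo: "closedin T (\<Union>F)"
    using assms by (intro closedin_Union) auto
  show "krull_dim (subtopology T (\<Union>F)) \<le> Max ((\<lambda>C. krull_dim (subtopology T C)) ` F)"
    unfolding krull_dim_subtopology_closed[OF clo]
  proof (rule Sup_least)
    fix e assume "e \<in> {enat m |m. \<exists>Z. irreducible_chain T m Z \<and> Z m \<subseteq> \<Union>F}"
    then obtain m Z where e: "e = enat m" and Z: "irreducible_chain T m Z" "Z m \<subseteq> \<Union>F"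
      by blast
    have "irreducible_in T (Z m)"
      using Z(1) by (auto simp: irreducible_chain_def)
    then obtain C where C: "C \<in> F" "Z m \<subseteq> C"
      using irreducible_in_subset_Union[OF assms(1) _ Z(2) assms(3)] by blast
    have "e \<le> krull_dim (subtopology T C)"
      unfolding krull_dim_subtopology_closed[OF assms(3)[OF C(1)]]
      using C(2) Z(1) e by (intro Sup_upper) auto
    also have "\<dots> \<le> Max ((\<lambda>C. krull_dim (subtopology T C)) ` F)"
      using assms C by (intro Max_ge) auto
    finally show "e \<le> Max ((\<lambda>C. krull_dim (subtopology T C)) ` F)" .
  qed
  have "krull_dim (subtopology T C) \<le> krull_dim (subtopology T (\<Union>F))" if "C \<in> F" for C
    unfolding krull_dim_subtopology_closed[OF clo] krull_dim_subtopology_closed[OF assms(3)[OF that]]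
    using that by (intro Sup_subset_mono) blast
  then show "Max ((\<lambda>C. krull_dim (subtopology T C)) ` F) \<le> krull_dim (subtopology T (\<Union>F))"
    using assms by (intro Max.boundedI) auto
qed

section \<open>Polynomial functions, prime vanishing ideals and Zariski closures\<close>

lemma poly_funs_sum:
  "finite A \<Longrightarrow> (\<And>a. a \<in> A \<Longrightarrow> f a \<in> poly_funs n) \<Longrightarrow> (\<lambda>X. \<Sum>a\<in>A. f a X) \<in> poly_funs n"
  by (induction A rule: finite_induct) (simp_all add: poly_funs.intros)

lemma poly_funs_prod:
  "finite A \<Longrightarrow> (\<And>a. a \<in> A \<Longrightarrow> f a \<in> poly_funs n) \<Longrightarrow> (\<lambda>X. \<Prod>a\<in>A. f a X) \<in> poly_funs n"
  by (induction A rule: finite_induct) (simp_all add: poly_funs.intros)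

lemma poly_funs_power: "f \<in> poly_funs n \<Longrightarrow> (\<lambda>X. f X ^ k) \<in> poly_funs n"
  by (induction k) (simp_all add: poly_funs.intros)

text \<open>Translates irreducibility into primality of the vanishing ideal, the form in which it is
  checked for parametrized sets and used to cancel factors.\<close>

lemma irreducible_in_zariski_iff:
  assumes "S \<subseteq> tuples n"
  shows "irreducible_in (zariski n) S \<longleftrightarrow> S \<noteq> {} \<and>
    (\<forall>f\<in>poly_funs n. \<forall>g\<in>poly_funs n. (\<forall>X\<in>S. f X * g X = 0) \<longrightarrow>
      (\<forall>X\<in>S. f X = 0) \<or> (\<forall>X\<in>S. g X = 0))"
    (is "_ \<longleftrightarrow> _ \<and> ?prime")
proof -
  let ?T = "subtopology (zariski n) S"
  have top: "topspace ?T = S"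
    using assms by (auto simp: topspace_zariski)
  have clo: "closedin ?T A \<longleftrightarrow> (\<exists>F\<subseteq>poly_funs n. A = zero_locus n F \<inter> S)" for A
    by (auto simp: closedin_subtopology closedin_zariski)
  have "(\<forall>A B. closedin ?T A \<and> closedin ?T B \<and> S = A \<union> B \<longrightarrow> A = S \<or> B = S) \<longleftrightarrow> ?prime"
  proof
    assume L: "\<forall>A B. closedin ?T A \<and> closedin ?T B \<and> S = A \<union> B \<longrightarrow> A = S \<or> B = S"
    show ?prime
    proof (intro ballI impI)
      fix f g assume fg: "f \<in> poly_funs n" "g \<in> poly_funs n" "\<forall>X\<in>S. f X * g X = 0"
      let ?A = "zero_locus n {f} \<inter> S" and ?B = "zero_locus n {g} \<inter> S"
      have "closedin ?T ?A" "closedin ?T ?B"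
        unfolding clo using fg(1,2) by (metis empty_subsetI insert_subset)+
      moreover have "S = ?A \<union> ?B"
        using assms fg(3) by (auto simp: zero_locus_def)
      ultimately have "?A = S \<or> ?B = S"
        using L by blast
      then show "(\<forall>X\<in>S. f X = 0) \<or> (\<forall>X\<in>S. g X = 0)"
        by (auto simp: zero_locus_def)
    qed
  next
    assume R: ?prime
    show "\<forall>A B. closedin ?T A \<and> closedin ?T B \<and> S = A \<union> B \<longrightarrow> A = S \<or> B = S"
    proof (intro allI impI, elim conjE)
      fix A B assume AB: "closedin ?T A" "closedin ?T B" "S = A \<union> B"
      obtain F G where F: "F \<subseteq> poly_funs n" "A = zero_locus n F \<inter> S"
        and G: "G \<subseteq> poly_funs n" "B = zero_locus n G \<inter> S"
        using AB(1,2) unfolding clo by metis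
      show "A = S \<or> B = S"
      proof (rule ccontr)
        assume "\<not> (A = S \<or> B = S)"
        then obtain X Y where "X \<in> S" "X \<notin> A" "Y \<in> S" "Y \<notin> B"
          using AB(3) by blast
        \<comment> \<open>One function from each family, nonzero at a point outside the
          corresponding closed set; their product vanishes on all of \<open>S\<close>.\<close>
        then obtain f g where fg: "f \<in> F" "f X \<noteq> 0" "g \<in> G" "g Y \<noteq> 0"
          using F(2) G(2) assms by (auto simp: zero_locus_def)
        have "f X' * g X' = 0" if X': "X' \<in> S" for X'
        proof -
          have "X' \<in> A \<or> X' \<in> B"
            using X' AB(3) by blast
          then show ?thesis
            using fg(1,3) unfolding F(2) G(2) zero_locus_def by auto
        qed
        then show False
          using R fg F(1) G(1) \<open>X \<in> S\<close> \<open>Y \<in> S\<close> by (meson subsetD)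
      qed
    qed
  qed
  then show ?thesis
    using assms unfolding irreducible_in_def irreducible_space_def top topspace_zariski by simp
qed

lemma irreducible_in_zariskiD:
  assumes "irreducible_in (zariski n) S" "f \<in> poly_funs n" "g \<in> poly_funs n"
    and "\<And>X. X \<in> S \<Longrightarrow> f X * g X = 0" "Y \<in> S" "f Y \<noteq> 0" "X \<in> S"
  shows "g X = 0"
proof -
  have S: "S \<subseteq> tuples n"
    using assms(1) by (simp add: irreducible_in_def topspace_zariski)
  have "(\<forall>X\<in>S. f X = 0) \<or> (\<forall>X\<in>S. g X = 0)"
    using assms(1) assms(2,3,4) unfolding irreducible_in_zariski_iff[OF S] by simp
  then show ?thesis
    using assms(5-7) by blast
qed

definition zariski_closure :: "nat \<Rightarrow> (nat \<Rightarrow> complex^'q^'q) set \<Rightarrow> (nat \<Rightarrow> complex^'q^'q) set"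
  where "zariski_closure n S = zero_locus n {f \<in> poly_funs n. \<forall>X\<in>S. f X = 0}"

lemma closedin_zariski_closure: "closedin (zariski n) (zariski_closure n S)"
  unfolding closedin_zariski zariski_closure_def
  by (rule exI[of _ "{f \<in> poly_funs n. \<forall>X\<in>S. f X = 0}"]) auto

lemma zariski_closure_superset: "S \<subseteq> tuples n \<Longrightarrow> S \<subseteq> zariski_closure n S"
  by (auto simp: zariski_closure_def zero_locus_def)

lemma zariski_closure_mono: "S \<subseteq> S' \<Longrightarrow> zariski_closure n S \<subseteq> zariski_closure n S'"
  by (auto simp: zariski_closure_def zero_locus_def)

lemma zariski_closure_vanish:
  "f \<in> poly_funs n \<Longrightarrow> (\<And>X. X \<in> S \<Longrightarrow> f X = 0) \<Longrightarrow> X \<in> zariski_closure n S \<Longrightarrow> f X = 0"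
  by (auto simp: zariski_closure_def zero_locus_def)

lemma zariski_closure_minimal:
  assumes "closedin (zariski n) C" "S \<subseteq> C"
  shows "zariski_closure n S \<subseteq> C"
proof -
  obtain F where "F \<subseteq> poly_funs n" "C = zero_locus n F"
    using assms(1) unfolding closedin_zariski by blast
  then show ?thesis
    using assms(2) by (fastforce simp: zariski_closure_def zero_locus_def)
qed

text \<open>A set and its closure have the same vanishing functions, hence the same primality
  condition.\<close>

lemma irreducible_in_zariski_closure:
  assumes "irreducible_in (zariski n) S"
  shows "irreducible_in (zariski n) (zariski_closure n S)"
proof -
  have S: "S \<subseteq> tuples n"
    using assms by (simp add: irreducible_in_def topspace_zariski)
  have C: "zariski_closure n S \<subseteq> tuples n"
    by (auto simp: zariski_closure_def zero_locus_def)
  show ?thesis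
    using assms zariski_closure_superset[OF S] zariski_closure_vanish[of _ n S]
    unfolding irreducible_in_zariski_iff[OF S] irreducible_in_zariski_iff[OF C]
    by (smt (verit, best) subset_empty subset_iff)
qed

subsection \<open>Chains give algebraically independent functions\<close>

text \<open>The monomial in \<open>f 0, \<dots>, f (k - 1)\<close> whose exponents are the \<open>k\<close> digits of \<open>N\<close> in base
  \<open>M\<close>.\<close>

fun digit_monomial :: "nat \<Rightarrow> (nat \<Rightarrow> 'x \<Rightarrow> complex) \<Rightarrow> nat \<Rightarrow> nat \<Rightarrow> 'x \<Rightarrow> complex" where
  "digit_monomial M f 0 N X = 1"
| "digit_monomial M f (Suc k) N X =
     digit_monomial M f k (N mod M ^ k) X * f k X ^ (N div M ^ k)"

lemma digit_monomial_poly_funs: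
  "(\<And>i. i < k \<Longrightarrow> f i \<in> poly_funs n) \<Longrightarrow> digit_monomial M f k N \<in> poly_funs n"
proof (induction k arbitrary: N)
  case 0
  then show ?case
    using poly_funs.const[of 1 n] by (simp add: fun_eq_iff[symmetric])
next
  case (Suc k)
  have "(\<lambda>X. digit_monomial M f k (N mod M ^ k) X * f k X ^ (N div M ^ k)) \<in> poly_funs n"
    using Suc by (intro poly_funs.mult poly_funs_power) auto
  then show ?case
    by simp
qed

lemma digit_monomial_sep_poly:
  assumes "\<And>i. i < k \<Longrightarrow> sep_poly e (\<lambda>x. f i (\<phi> x))" "N < M ^ k"
  shows "sep_poly (k * (M * e)) (\<lambda>x. digit_monomial M f k N (\<phi> x))"
  using assms
proof (induction k arbitrary: N)
  case 0
  then show ?case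
    by auto
next
  case (Suc k)
  have M: "M ^ k > 0"
    using Suc.prems(2) by (metis gr0I mult_is_0 not_less0 power_Suc)
  have "N div M ^ k < M"
    using Suc.prems(2) by (simp add: less_mult_imp_div_less)
  then have "(N div M ^ k) * e \<le> M * e"
    by simp
  moreover have "sep_poly ((N div M ^ k) * e) (\<lambda>x. f k (\<phi> x) ^ (N div M ^ k))"
    using Suc.prems(1) by (intro sep_poly_power) auto
  ultimately have "sep_poly (M * e) (\<lambda>x. f k (\<phi> x) ^ (N div M ^ k))"
    by (rule sep_poly_mono[rotated])
  moreover have "sep_poly (k * (M * e)) (\<lambda>x. digit_monomial M f k (N mod M ^ k) (\<phi> x))"
    using Suc M by auto
  ultimately have "sep_poly (k * (M * e) + M * e)
      (\<lambda>x. digit_monomial M f k (N mod M ^ k) (\<phi> x) * f k (\<phi> x) ^ (N div M ^ k))"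
    by (rule sep_poly_mult[rotated])
  then show ?case
    by (simp add: add.commute)
qed

text \<open>Induction on the length of the chain. A relation on \<open>Z (Suc k)\<close> is a
  polynomial in \<open>f k\<close> whose coefficients are combinations of the monomials in the
  earlier functions. Since \<open>f k\<close> is not identically zero on the irreducible set
  \<open>Z (Suc k)\<close>, its powers can be cancelled; on \<open>Z k\<close>, where
  \<open>f k\<close> vanishes, only the lowest coefficient survives, and the induction hypothesis
  kills its scalars.\<close>

lemma chain_digit_monomials_independent:
  fixes Z :: "nat \<Rightarrow> (nat \<Rightarrow> complex^'q^'q) set"
  assumes "\<And>i. i \<le> k \<Longrightarrow> irreducible_in (zariski n) (Z i)"
    and "\<And>i. i < k \<Longrightarrow> Z i \<subseteq> Z (Suc i)" and "\<And>i. i < k \<Longrightarrow> f i \<in> poly_funs n"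
    and "\<And>i X. i < k \<Longrightarrow> X \<in> Z i \<Longrightarrow> f i X = 0"
    and "\<And>i. i < k \<Longrightarrow> \<exists>X\<in>Z (Suc i). f i X \<noteq> 0"
    and "\<And>X. X \<in> Z k \<Longrightarrow> (\<Sum>N<M ^ k. c N * digit_monomial M f k N X) = 0"
    and "N < M ^ k"
  shows "c N = 0"
  using assms
proof (induction k arbitrary: c N)
  case 0
  obtain X where X: "X \<in> Z 0"
    using irreducible_in_nonempty[OF 0(1)[of 0]] by blast
  show ?case
    using 0(6)[OF X] 0(7) by simp
next
  case (Suc k)
  define L where "L = M ^ k"
  have L: "L > 0"
    using Suc.prems(7) unfolding L_def by (metis gr0I mult_is_0 not_less0 power_Suc)
  \<comment> \<open>The coefficient of the \<open>j\<close>-th power of \<open>f k\<close> when the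
    relation is sorted by the leading digit.\<close>
  define G where "G j X = (\<Sum>l<L. c (j * L + l) * digit_monomial M f k l X)" for j X
  have G_poly: "G j \<in> poly_funs n" for j
    unfolding G_def using Suc.prems(3)
    by (intro poly_funs_sum poly_funs.mult poly_funs.const digit_monomial_poly_funs) auto
  have digits: "digit_monomial M f (Suc k) (j * L + l) X = digit_monomial M f k l X * f k X ^ j"
    if "l \<in> {..<L}" for j l X
    using L that by (simp add: L_def[symmetric])
  have split: "(\<Sum>N<M ^ Suc k. c N * digit_monomial M f (Suc k) N X) = (\<Sum>j<M. G j X * f k X ^ j)" for X
  proof -
    have "(\<Sum>N<M ^ Suc k. c N * digit_monomial M f (Suc k) N X) =
        (\<Sum>j<M. \<Sum>N=j * L..<j * L + L. c N * digit_monomial M f (Suc k) N X)"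
      by (subst sum.nat_group) (simp add: L_def)
    also have "\<dots> = (\<Sum>j<M. \<Sum>l<L. c (j * L + l) * digit_monomial M f (Suc k) (j * L + l) X)"
    proof (rule sum.cong[OF refl])
      fix j
      show "(\<Sum>N=j * L..<j * L + L. c N * digit_monomial M f (Suc k) N X) =
          (\<Sum>l<L. c (j * L + l) * digit_monomial M f (Suc k) (j * L + l) X)"
        by (rule sum.reindex_bij_witness[of _ "\<lambda>l. j * L + l" "\<lambda>N. N - j * L"]) auto
    qed
    also have "\<dots> = (\<Sum>j<M. G j X * f k X ^ j)"
      unfolding G_def sum_distrib_right by (intro sum.cong refl) (simp add: digits mult.assoc del: digit_monomial.simps)
    finally show ?thesis .
  qed
  have coeffs: "\<forall>l<L. c (j * L + l) = 0" if "j < M" for j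
    using that
  proof (induction j rule: less_induct)
    case (less j)
    have G0: "G i X = 0" if "i < j" for i X
      using less.IH[OF that] less.prems that unfolding G_def by auto
    \<comment> \<open>The relation divided by the \<open>j\<close>-th power of \<open>f k\<close>,
      once the coefficients below \<open>j\<close> are known to vanish.\<close>
    define H where "H X = (\<Sum>i<M - j. G (j + i) X * f k X ^ i)" for X
    have H_poly: "H \<in> poly_funs n"
      unfolding H_def using Suc.prems(3)[of k]
      by (intro poly_funs_sum poly_funs.mult poly_funs_power G_poly) auto
    have fH: "f k X ^ j * H X = 0" if X: "X \<in> Z (Suc k)" for X
    proof -
      have "0 = (\<Sum>i<M. G i X * f k X ^ i)"
        using Suc.prems(6)[OF X] split by simp
      also have "\<dots> = (\<Sum>i\<in>{j..<M}. G i X * f k X ^ i)"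
        using G0 by (intro sum.mono_neutral_right) auto
      also have "\<dots> = (\<Sum>i<M - j. G (j + i) X * f k X ^ (j + i))"
        using less.prems
        by (intro sum.reindex_bij_witness[of _ "\<lambda>i. j + i" "\<lambda>i. i - j"]) auto
      also have "\<dots> = f k X ^ j * H X"
        unfolding H_def sum_distrib_left by (intro sum.cong) (auto simp: power_add)
      finally show ?thesis
        by simp
    qed
    have fj: "(\<lambda>X. f k X ^ j) \<in> poly_funs n"
      using Suc.prems(3)[of k] by (intro poly_funs_power) auto
    obtain Y where Y: "Y \<in> Z (Suc k)" "f k Y \<noteq> 0"
      using Suc.prems(5)[of k] by auto
    have H0: "H X = 0" if "X \<in> Z (Suc k)" for X
      by (rule irreducible_in_zariskiD[OF _ fj H_poly fH Y(1) _ that])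
        (use Suc.prems(1) Y(2) in auto)
    have "G j X = 0" if X: "X \<in> Z k" for X
    proof -
      have "f k X = 0"
        using Suc.prems(4)[of k X] X by simp
      then have "H X = (\<Sum>i<M - j. if i = 0 then G j X else 0)"
        unfolding H_def by (intro sum.cong) auto
      also have "\<dots> = G j X"
        using less.prems by simp
      finally show ?thesis
        using H0 Suc.prems(2)[of k] X by auto
    qed
    then show ?case
      using Suc.IH[of "\<lambda>l. c (j * L + l)"] Suc.prems unfolding G_def L_def by auto
  qed
  have "N div L < M"
    using Suc.prems(7) by (simp add: L_def less_mult_imp_div_less)
  moreover have "N mod L < L"
    using L by simp
  ultimately have "c (N div L * L + N mod L) = 0"
    using coeffs by blast
  then show ?case
    by simp
qed

subsection \<open>Polynomially parametrized sets\<close>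

text \<open>Parameters are total functions on \<open>'v\<close>, but the last clause lets only the
  coordinates in \<open>I\<close> count, so the parameter space is in effect affine space of
  dimension \<open>card I\<close>.\<close>

definition poly_param ::
    "nat \<Rightarrow> 'v set \<Rightarrow> (('v \<Rightarrow> complex) \<Rightarrow> nat \<Rightarrow> complex^'q^'q) \<Rightarrow> bool" where
  "poly_param n I \<phi> \<longleftrightarrow> finite I \<and> (\<forall>x. \<phi> x \<in> tuples n) \<and>
     (\<forall>k\<in>{1..n}. \<forall>i j. \<exists>m. sep_poly m (\<lambda>x. \<phi> x k $ i $ j)) \<and>
     (\<forall>x y. (\<forall>v\<in>I. x v = y v) \<longrightarrow> \<phi> x = \<phi> y)"

lemma poly_param_comp:
  assumes "poly_param n I \<phi>" "f \<in> poly_funs n"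
  shows "\<exists>m. sep_poly m (\<lambda>x. f (\<phi> x))"
  using assms(2)
proof (induction rule: poly_funs.induct)
  case (const c)
  then show ?case
    by auto
next
  case (entry k i j)
  then show ?case
    using assms(1) by (auto simp: poly_param_def)
next
  case (add f g)
  then obtain m m' where "sep_poly m (\<lambda>x. f (\<phi> x))" "sep_poly m' (\<lambda>x. g (\<phi> x))"
    by blast
  then have "sep_poly (max m m') (\<lambda>x. f (\<phi> x) + g (\<phi> x))"
    by (intro sep_poly_add) (auto elim: sep_poly_mono)
  then show ?case
    by blast
next
  case (mult f g)
  then show ?case
    using sep_poly_mult by blast
qed

text \<open>If \<open>f\<close> and \<open>g\<close> are nonzero at two points of the coordinate
  subspace, \<open>sep_poly_common_nonzero\<close> merges these points. They differ only in
  \<open>J\<close>, so the merged point remains in the subspace, and the product is nonzero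
  there.\<close>

lemma irreducible_in_param_image:
  assumes "poly_param n I \<phi>" "finite J"
  shows "irreducible_in (zariski n) (\<phi> ` {x. \<forall>v. v \<notin> J \<longrightarrow> x v = x0 v})"
    (is "irreducible_in _ (\<phi> ` ?L)")
proof -
  have S: "\<phi> ` ?L \<subseteq> tuples n"
    using assms(1) by (auto simp: poly_param_def)
  have "(\<forall>x\<in>?L. f (\<phi> x) = 0) \<or> (\<forall>x\<in>?L. g (\<phi> x) = 0)"
    if fg: "f \<in> poly_funs n" "g \<in> poly_funs n" "\<forall>x\<in>?L. f (\<phi> x) * g (\<phi> x) = 0" for f g
  proof (rule ccontr)
    assume "\<not> ?thesis"
    then obtain x y where xy: "x \<in> ?L" "y \<in> ?L" "f (\<phi> x) \<noteq> 0" "g (\<phi> y) \<noteq> 0"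
      by blast
    obtain m m' where "sep_poly m (\<lambda>x. f (\<phi> x))" "sep_poly m' (\<lambda>x. g (\<phi> x))"
      using poly_param_comp[OF assms(1)] fg by blast
    moreover have "{v. x v \<noteq> y v} \<subseteq> J"
      using xy(1,2) by (metis (mono_tags, lifting) mem_Collect_eq subsetI)
    then have "finite {v. x v \<noteq> y v}"
      using assms(2) finite_subset by blast
    ultimately obtain z where z: "\<forall>v. x v = y v \<longrightarrow> z v = x v" "f (\<phi> z) \<noteq> 0" "g (\<phi> z) \<noteq> 0"
      using sep_poly_common_nonzero[of m "\<lambda>x. f (\<phi> x)" m' "\<lambda>x. g (\<phi> x)" x y] xy by blast
    then have "z \<in> ?L"
      using xy(1,2) by simp
    then show False
      using fg(3) z by auto
  qed
  moreover have "x0 \<in> ?L"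
    by simp
  ultimately show ?thesis
    unfolding irreducible_in_zariski_iff[OF S] by blast
qed

text \<open>More monomials than grid points make the pulled-back monomials linearly dependent. The
  relation passes from the image to its closure, hence to \<open>Z k\<close>, where the chain
  forbids it.\<close>

lemma irreducible_chain_length_le_param:
  fixes \<phi> :: "('v \<Rightarrow> complex) \<Rightarrow> nat \<Rightarrow> complex^'q^'q"
  assumes "poly_param n I \<phi>" "Z k \<subseteq> zariski_closure n (range \<phi>)"
    and "irreducible_chain (zariski n) k Z"
  shows "k \<le> card I"
proof (rule ccontr)
  assume "\<not> k \<le> card I"
  then have k: "k \<ge> Suc (card I)"
    by simp
  have "\<exists>f. f \<in> poly_funs n \<and> (\<forall>X\<in>Z i. f X = 0) \<and> (\<exists>X\<in>Z (Suc i). f X \<noteq> 0)" if i: "i < k" for i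
  proof -
    have Z: "closedin (zariski n) (Z i)" "Z i \<subset> Z (Suc i)" "closedin (zariski n) (Z (Suc i))"
      using assms(3) i by (auto simp: irreducible_chain_def)
    then obtain X where X: "X \<in> Z (Suc i)" "X \<notin> Z i"
      by blast
    obtain F where F: "F \<subseteq> poly_funs n" "Z i = zero_locus n F"
      using Z(1) unfolding closedin_zariski by blast
    have "X \<in> tuples n"
      using X(1) Z(3) closedin_subset[of "zariski n"] by (auto simp: topspace_zariski)
    then obtain f where "f \<in> F" "f X \<noteq> 0"
      using X(2) F(2) by (auto simp: zero_locus_def)
    then show ?thesis
      using F X(1) by (intro exI[of _ f]) (auto simp: zero_locus_def)
  qed
  then obtain f where f: "\<And>i. i < k \<Longrightarrow> f i \<in> poly_funs n"
    "\<And>i X. i < k \<Longrightarrow> X \<in> Z i \<Longrightarrow> f i X = 0" "\<And>i. i < k \<Longrightarrow> \<exists>X\<in>Z (Suc i). f i X \<noteq> 0"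
    by metis
  have "\<exists>m. sep_poly m (\<lambda>x. f i (\<phi> x))" if "i < k" for i
    using poly_param_comp[OF assms(1) f(1)[OF that]] .
  then obtain m where m: "\<And>i. i < k \<Longrightarrow> sep_poly (m i) (\<lambda>x. f i (\<phi> x))"
    by metis
  define e where "e = (\<Sum>i<k. m i)"
  have e: "sep_poly e (\<lambda>x. f i (\<phi> x))" if "i < k" for i
    using that unfolding e_def by (intro sep_poly_mono[OF m[OF that]] member_le_sum) auto
  \<comment> \<open>The degree of each monomial in a parameter is at most
    \<open>k * (M * e)\<close>, so the grid has at most \<open>M^d * (k * e + 1)^d\<close> points,
    where \<open>d = card I\<close>. As \<open>M\<close> exceeds the second factor, the count stays
    below \<open>M^(d + 1)\<close>, hence below \<open>M^k\<close>.\<close>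
  define M where "M = Suc ((k * e + 1) ^ card I)"
  let ?g = "digit_monomial M f k"
  have "(k * (M * e) + 1) ^ card I \<le> (M * (k * e + 1)) ^ card I"
    by (intro power_mono) (auto simp: M_def algebra_simps)
  also have "\<dots> < M ^ card I * M"
    unfolding power_mult_distrib by (simp add: M_def)
  also have "\<dots> \<le> M ^ k"
    using power_increasing[OF k, of M] by (simp add: M_def mult.commute)
  finally have M: "(k * (M * e) + 1) ^ card I < M ^ k" .
  have "\<exists>c. (\<exists>j<M ^ k. c j \<noteq> 0) \<and> (\<forall>x. (\<Sum>j<M ^ k. c j * ?g j (\<phi> x)) = 0)"
  proof (rule sep_poly_dependent[OF _ _ _ M])
    show "finite I"
      using assms(1) by (simp add: poly_param_def)
    show "sep_poly (k * (M * e)) (\<lambda>x. ?g j (\<phi> x))" if "j < M ^ k" for j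
      using digit_monomial_sep_poly[of k e f \<phi>, OF e that] .
    show "?g j (\<phi> x) = ?g j (\<phi> y)" if "\<And>v. v \<in> I \<Longrightarrow> x v = y v" for j x y
      using assms(1) that unfolding poly_param_def by metis
  qed
  then obtain c where c: "\<exists>j<M ^ k. c j \<noteq> 0" "\<forall>x. (\<Sum>j<M ^ k. c j * ?g j (\<phi> x)) = 0"
    by blast
  have "(\<lambda>X. \<Sum>j<M ^ k. c j * ?g j X) \<in> poly_funs n"
    using f(1) by (intro poly_funs_sum poly_funs.mult poly_funs.const digit_monomial_poly_funs) auto
  then have cZ: "(\<Sum>j<M ^ k. c j * ?g j X) = 0" if "X \<in> Z k" for X
    using zariski_closure_vanish[of "\<lambda>X. \<Sum>j<M ^ k. c j * ?g j X" n "range \<phi>" X] that assms(2) c(2)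
    by auto
  have "c j = 0" if "j < M ^ k" for j
  proof (rule chain_digit_monomials_independent[where Z = Z and k = k and n = n and f = f and M = M])
    fix i
    show "i \<le> k \<Longrightarrow> irreducible_in (zariski n) (Z i)" "i < k \<Longrightarrow> Z i \<subseteq> Z (Suc i)"
      using assms(3) by (auto simp: irreducible_chain_def)
  qed (use f that cZ in auto)
  then show False
    using c(1) by blast
qed

text \<open>The closures of the images of a flag of coordinate subspaces through \<open>x0\<close> form a chain, which
  the functions \<open>g k\<close> show to be strict.\<close>

lemma irreducible_and_zdim_param:
  fixes \<phi> :: "('v \<Rightarrow> complex) \<Rightarrow> nat \<Rightarrow> complex^'q^'q"
  assumes "poly_param n I \<phi>" "closedin (zariski n) S" "range \<phi> \<subseteq> S"
    and dense: "S \<subseteq> zariski_closure n (range \<phi>)"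
    and v: "bij_betw v {..<card I} I"
    and g: "\<And>k. k < card I \<Longrightarrow> g k \<in> poly_funs n"
    and gv: "\<And>k x. k < card I \<Longrightarrow> (\<And>w. w \<notin> v ` {..k} \<Longrightarrow> x w = x0 w) \<Longrightarrow> g k (\<phi> x) = x (v k)"
  shows "irreducible_in (zariski n) S" "zdim n S = enat (card I)"
proof -
  define L where "L k = {x. \<forall>w. w \<notin> v ` {..<k} \<longrightarrow> x w = x0 w}" for k
  define Z where "Z k = zariski_closure n (\<phi> ` L k)" for k
  have L_irr: "irreducible_in (zariski n) (\<phi> ` L k)" for k
    unfolding L_def by (intro irreducible_in_param_image[OF assms(1)]) simp
  have tup: "\<phi> ` L k \<subseteq> tuples n" for k
    using assms(1) by (auto simp: poly_param_def)
  have vI: "v ` {..<card I} = I" "inj_on v {..<card I}"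
    using v by (auto simp: bij_betw_def)
  have "\<phi> x \<in> \<phi> ` L (card I)" for x
  proof
    let ?y = "\<lambda>w. if w \<in> I then x w else x0 w"
    show "\<phi> x = \<phi> ?y"
      using assms(1) unfolding poly_param_def by simp
    show "?y \<in> L (card I)"
      using vI by (auto simp: L_def)
  qed
  then have range: "\<phi> ` L (card I) = range \<phi>"
    by auto
  have Z_top: "Z (card I) = S"
    using dense zariski_closure_minimal[OF assms(2,3)] by (auto simp: Z_def range)
  have chain: "irreducible_chain (zariski n) (card I) Z"
    unfolding irreducible_chain_def
  proof (intro conjI allI impI)
    fix k
    show "closedin (zariski n) (Z k)"
      by (simp add: Z_def closedin_zariski_closure)
    show "irreducible_in (zariski n) (Z k)"
      unfolding Z_def by (intro irreducible_in_zariski_closure L_irr)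
  next
    fix k assume k: "k < card I"
    have sub: "Z k \<subseteq> Z (Suc k)"
      unfolding Z_def by (intro zariski_closure_mono image_mono) (auto simp: L_def lessThan_Suc)
    have vk: "v k \<notin> v ` {..<k}"
      using inj_onD[OF vI(2)] k by fastforce
    have gx: "g k (\<phi> x) = x (v k)" if "x \<in> L (Suc k)" for x
      using that gv[OF k, of x] by (auto simp: L_def lessThan_Suc_atMost)
    \<comment> \<open>A coordinate minus its base value: parameter \<open>v k\<close> is frozen on
      \<open>L k\<close> and free on \<open>L (Suc k)\<close>. The identity \<open>gv\<close> is
      used only on these subspaces, which asks for less than a polynomial left inverse of
      \<open>\<phi>\<close>.\<close>
    let ?h = "\<lambda>X. g k X + (- x0 (v k))"
    have h: "?h \<in> poly_funs n"
      using g[OF k] by (intro poly_funs.add poly_funs.const)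
    have h0: "?h X = 0" if "X \<in> Z k" for X
    proof (rule zariski_closure_vanish[OF h _ that[unfolded Z_def]])
      fix Y assume "Y \<in> \<phi> ` L k"
      then obtain x where x: "x \<in> L k" "Y = \<phi> x"
        by blast
      then have "x \<in> L (Suc k)" "x (v k) = x0 (v k)"
        using vk by (auto simp: L_def lessThan_Suc)
      then show "?h Y = 0"
        using gx[of x] x(2) by simp
    qed
    define x1 where "x1 = x0(v k := x0 (v k) + 1)"
    have "x1 \<in> L (Suc k)"
      by (auto simp: L_def x1_def)
    then have "?h (\<phi> x1) \<noteq> 0" "\<phi> x1 \<in> Z (Suc k)"
      using gx[of x1] zariski_closure_superset[OF tup[of "Suc k"]] by (auto simp: x1_def Z_def)
    then show "Z k \<subset> Z (Suc k)"
      using sub h0 by blast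
  qed
  show "irreducible_in (zariski n) S"
    using chain Z_top by (auto simp: irreducible_chain_def)
  have "{enat m |m. \<exists>Z. irreducible_chain (zariski n) m Z \<and> Z m \<subseteq> S} \<subseteq> {..enat (card I)}"
  proof safe
    fix m Z assume "irreducible_chain (zariski n) m Z" "Z m \<subseteq> S"
    then show "enat m \<le> enat (card I)"
      using irreducible_chain_length_le_param[OF assms(1), of Z m] dense by auto
  qed
  moreover have "enat (card I) \<in> {enat m |m. \<exists>Z. irreducible_chain (zariski n) m Z \<and> Z m \<subseteq> S}"
    using chain Z_top by blast
  ultimately show "zdim n S = enat (card I)"
    unfolding zdim_def krull_dim_subtopology_closed[OF assms(2)]
    by (intro antisym Sup_least Sup_upper) auto
qed

section \<open>Ranks of complex matrices\<close>

lemma matrix_mult_nth: "(A ** B) $ i $ j = (\<Sum>k\<in>UNIV. A $ i $ k * B $ k $ j)"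
  by (simp add: matrix_matrix_mult_def)

lemma matrix_add_rdistrib: "(A + B) ** C = A ** C + B ** C"
  for A B C :: "complex^'q::finite^'q"
  by (simp add: vec_eq_iff matrix_mult_nth sum.distrib algebra_simps)

lemma matrix_diff_ldistrib: "A ** (B - C) = A ** B - A ** C"
  for A B C :: "complex^'q::finite^'q"
  by (simp add: vec_eq_iff matrix_mult_nth sum_subtractf algebra_simps)

lemma matrix_mult_zero_right: "A ** 0 = 0"
  for A :: "complex^'q::finite^'q"
  by (simp add: vec_eq_iff matrix_mult_nth)

lemma matrix_mult_axis: "A *v axis k 1 = column k A"
  for A :: "complex^'q::finite^'q"
proof -
  have "(\<Sum>j\<in>UNIV. A $ i $ j * axis k 1 $ j) = (\<Sum>j\<in>UNIV. if j = k then A $ i $ k else 0)" for i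
    by (intro sum.cong) (auto simp: axis_def)
  then show ?thesis
    by (simp add: vec_eq_iff matrix_vector_mult_def column_def)
qed

lemma card_Compl_finite: "card (- K) = CARD('q) - card K"
  for K :: "'q::finite set"
  by (simp add: Compl_eq_Diff_UNIV card_Diff_subset)

text \<open>Blocks for a set of indices and its complement are cut out by multiplying with these
  projections, so that all matrices keep the same type.\<close>

definition coord_proj :: "'q set \<Rightarrow> complex^'q^'q" where
  "coord_proj K = (\<chi> i j. if i = j \<and> i \<in> K then 1 else 0)"

lemma coord_proj_mult_left: "(coord_proj K ** A) $ i $ j = (if i \<in> K then A $ i $ j else 0)"
  for A :: "complex^'q^'q::finite"
proof -
  have "(coord_proj K ** A) $ i $ j = (\<Sum>k\<in>UNIV. (if i = k \<and> i \<in> K then 1 else 0) * A $ k $ j)"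
    by (simp add: coord_proj_def matrix_matrix_mult_def)
  also have "\<dots> = (\<Sum>k\<in>UNIV. if k = i then (if i \<in> K then A $ i $ j else 0) else 0)"
    by (intro sum.cong) auto
  finally show ?thesis
    by simp
qed

lemma coord_proj_mult_right: "(A ** coord_proj K) $ i $ j = (if j \<in> K then A $ i $ j else 0)"
  for A :: "complex^'q^'q::finite"
proof -
  have "(A ** coord_proj K) $ i $ j = (\<Sum>k\<in>UNIV. A $ i $ k * (if k = j \<and> k \<in> K then 1 else 0))"
    by (simp add: coord_proj_def matrix_matrix_mult_def)
  also have "\<dots> = (\<Sum>k\<in>UNIV. if k = j then (if j \<in> K then A $ i $ j else 0) else 0)"
    by (intro sum.cong) auto
  finally show ?thesis
    by simp
qed

lemma coord_proj_simps:
  fixes K :: "'q::finite set"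
  shows "coord_proj K ** coord_proj K = coord_proj K"
    and "coord_proj K ** coord_proj (- K) = 0" and "coord_proj (- K) ** coord_proj K = 0"
    and "coord_proj K + coord_proj (- K) = mat 1"
  by (auto simp: vec_eq_iff coord_proj_mult_left) (auto simp: coord_proj_def mat_def)

lemma coord_proj_mult_vec: "(coord_proj K *v x) $ i = (if i \<in> K then x $ i else 0)"
  for x :: "complex^'q::finite"
proof -
  have "(coord_proj K *v x) $ i = (\<Sum>k\<in>UNIV. (if i = k \<and> i \<in> K then 1 else 0) * x $ k)"
    by (simp add: coord_proj_def matrix_vector_mult_def)
  also have "\<dots> = (\<Sum>k\<in>UNIV. if k = i then (if i \<in> K then x $ i else 0) else 0)"
    by (intro sum.cong) auto
  finally show ?thesis
    by simp
qed

lemma mat_mult_left: "(mat c ** A) $ i $ j = c * A $ i $ j"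
  for A :: "complex^'q^'q::finite"
proof -
  have "(mat c ** A) $ i $ j = (\<Sum>k\<in>UNIV. (if i = k then c else 0) * A $ k $ j)"
    by (simp add: mat_def matrix_matrix_mult_def)
  also have "\<dots> = (\<Sum>k\<in>UNIV. if k = i then c * A $ i $ j else 0)"
    by (intro sum.cong) auto
  finally show ?thesis
    by simp
qed

lemma mat_mult_right: "(A ** mat c) $ i $ j = c * A $ i $ j"
  for A :: "complex^'q^'q::finite"
proof -
  have "(A ** mat c) $ i $ j = (\<Sum>k\<in>UNIV. A $ i $ k * (if k = j then c else 0))"
    by (simp add: mat_def matrix_matrix_mult_def)
  also have "\<dots> = (\<Sum>k\<in>UNIV. if k = j then c * A $ i $ j else 0)"
    by (intro sum.cong) auto
  finally show ?thesis
    by simp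
qed

lemma mat_mult_commute: "mat c ** A = A ** mat c"
  for A :: "complex^'q^'q::finite"
  by (simp add: vec_eq_iff mat_mult_left mat_mult_right)

text \<open>Each row of \<open>A\<close> is a combination of the rows of \<open>R\<close> with index
  in \<open>K\<close>. The inserted projection expresses, with square matrices only, a factorization
  through a space of dimension \<open>card K\<close>.\<close>

lemma rank_le_if_factor:
  fixes A L R :: "complex^'q::finite^'q"
  assumes "A = L ** coord_proj K ** R"
  shows "rank A \<le> card K"
proof -
  have "row i A \<in> vec.span (($) R ` K)" for i
  proof -
    have "row i A $ j = (\<Sum>k\<in>K. L $ i $ k *s R $ k) $ j" for j
    proof -
      have "row i A $ j = (\<Sum>k\<in>UNIV. (if k \<in> K then L $ i $ k else 0) * R $ k $ j)"
        unfolding assms row_def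
        by (simp add: matrix_mult_nth[of "L ** coord_proj _"] coord_proj_mult_right)
      also have "\<dots> = (\<Sum>k\<in>K. L $ i $ k * R $ k $ j)"
        by (intro sum.mono_neutral_cong_right) auto
      finally show ?thesis
        by simp
    qed
    then have "row i A = (\<Sum>k\<in>K. L $ i $ k *s R $ k)"
      by (simp add: vec_eq_iff)
    moreover have "(\<Sum>k\<in>K. L $ i $ k *s R $ k) \<in> vec.span (($) R ` K)"
      by (intro vec.span_sum vec.span_scale vec.span_base) auto
    ultimately show ?thesis
      by simp
  qed
  then have "rows A \<subseteq> vec.span (($) R ` K)"
    by (auto simp: rows_def)
  then have "rank A \<le> card (($) R ` K)"
    unfolding row_rank_def_gen by (intro vec.dim_le_card) auto
  also have "\<dots> \<le> card K"
    by (intro card_image_le) simp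
  finally show ?thesis .
qed

lemma rank_le_card: "rank A \<le> CARD('q)"
  for A :: "complex^'q::finite^'q"
  unfolding row_rank_def_gen by (rule dim_subset_UNIV_cart_gen)

text \<open>Pick rows of \<open>A\<close> forming a basis of its row space, and replace the other rows so that a basis
  of the whole space results.\<close>

lemma row_basis_completion:
  fixes A :: "complex^'q::finite^'q"
  obtains J A' L where "card J = rank A" "invertible A'" "coord_proj J ** A' = coord_proj J ** A"
    "A = L ** coord_proj J ** A"
proof -
  obtain B where B: "B \<subseteq> rows A" "vec.independent B" "rows A \<subseteq> vec.span B" "card B = rank A"
    unfolding row_rank_def_gen using vec.basis_exists[of "rows A"] by blast
  have rowsA: "rows A = range (($) A)"
    by (auto simp: rows_def row_def vec_eq_iff)
  obtain J where J: "inj_on (($) A) J" "B = ($) A ` J"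
    using B(1) unfolding rowsA by (meson subset_image_inj)
  have cJ: "card J = rank A"
    using B(4) J by (simp add: card_image)
  obtain C where C: "B \<subseteq> C" "vec.independent C" "UNIV \<subseteq> vec.span C"
    using vec.maximal_independent_subset_extend[OF subset_UNIV B(2)] by metis
  have finC: "finite C"
    using C(2) by (rule vec.finiteI_independent)
  have cardC: "card C = CARD('q)"
    using vec.basis_card_eq_dim[OF subset_UNIV C(3,2)] by (simp add: card_cart_basis)
  have "card (- J) = card (C - B)"
    using cardC C(1) finC B(4) cJ by (simp add: card_Diff_subset finite_subset Compl_eq_Diff_UNIV)
  then obtain h where h: "bij_betw h (- J) (C - B)"
    using finC by (metis finite finite_Diff finite_same_card_bij)
  define A' where "A' = (\<chi> i. if i \<in> J then A $ i else h i)"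
  have "range (($) A') = ($) A ` J \<union> h ` (- J)"
    by (auto simp: A'_def image_iff)
  also have "\<dots> = C"
    using h C(1) J(2) by (auto simp: bij_betw_def)
  finally have "rows A' = C"
    by (auto simp: rows_def row_def)
  then have "vec.span (rows A') = UNIV"
    using C(3) by auto
  then have inv: "invertible A'"
    by (metis matrix_left_invertible_span_rows_gen invertible_left_inverse)
  have "\<exists>c. A $ i = (\<Sum>j\<in>J. c j *s A $ j)" for i
  proof -
    have "A $ i \<in> vec.span (($) A ` J)"
      using B(3) unfolding rowsA J(2) by auto
    then obtain u where "A $ i = (\<Sum>b\<in>($) A ` J. u b *s b)"
      by (auto simp: vec.span_finite)
    then show ?thesis
      by (intro exI[of _ "\<lambda>j. u (A $ j)"]) (simp add: sum.reindex[OF J(1)])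
  qed
  then obtain c where c: "\<And>i. A $ i = (\<Sum>j\<in>J. c i j *s A $ j)"
    by metis
  \<comment> \<open>Collects the coefficients of all rows of \<open>A\<close>; its columns outside
    \<open>J\<close> are arbitrary and are erased by \<open>coord_proj J\<close>.\<close>
  define L :: "complex^'q^'q" where "L = (\<chi> i j. c i j)"
  have L_nth: "L $ i $ j = c i j" for i j
    by (simp add: L_def)
  have "A $ i $ k = (L ** coord_proj J ** A) $ i $ k" for i k
  proof -
    have "(L ** coord_proj J ** A) $ i $ k = (\<Sum>j\<in>UNIV. (if j \<in> J then c i j else 0) * A $ j $ k)"
      by (simp add: matrix_mult_nth[of "L ** coord_proj _"] coord_proj_mult_right L_nth cong: if_cong)
    also have "\<dots> = (\<Sum>j\<in>J. c i j * A $ j $ k)"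
      by (intro sum.mono_neutral_cong_right) auto
    also have "\<dots> = A $ i $ k"
      by (subst (2) c) simp
    finally show ?thesis
      by simp
  qed
  then have "A = L ** coord_proj J ** A"
    by (simp add: vec_eq_iff)
  moreover have "coord_proj J ** A' = coord_proj J ** A"
    by (simp add: vec_eq_iff coord_proj_mult_left A'_def)
  ultimately show ?thesis
    using that cJ inv by blast
qed

lemma rank_coord_proj: "rank (coord_proj K) = card K"
  for K :: "'q::finite set"
proof (rule antisym)
  show "rank (coord_proj K) \<le> card K"
    by (rule rank_le_if_factor[of _ "mat 1" _ "mat 1"]) simp
  have "inj_on (($) (coord_proj K)) K"
  proof (rule inj_onI)
    fix i j assume "i \<in> K" "j \<in> K" "coord_proj K $ i = coord_proj K $ j"
    then have "coord_proj K $ i $ i = coord_proj K $ j $ i"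
      by simp
    then show "i = j"
      using \<open>i \<in> K\<close> by (auto simp: coord_proj_def split: if_splits)
  qed
  then have "card K = card (($) (coord_proj K) ` K)"
    by (simp add: card_image)
  also have "\<dots> \<le> vec.dim (rows (coord_proj K))"
  proof (rule vec.independent_card_le_dim)
    show "($) (coord_proj K) ` K \<subseteq> rows (coord_proj K)"
      by (auto simp: rows_def row_def)
    have "coord_proj K $ i = axis i 1" if "i \<in> K" for i
      using that by (auto simp: coord_proj_def axis_def vec_eq_iff)
    then have "($) (coord_proj K) ` K \<subseteq> cart_basis"
      by (auto simp: cart_basis_def)
    then show "vec.independent (($) (coord_proj K) ` K)"
      using independent_cart_basis vec.independent_mono by blast
  qed
  finally show "card K \<le> rank (coord_proj K)"
    by (simp add: row_rank_def_gen)
qed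

text \<open>The row space of a sum lies in the sum of the row spaces, whose dimension is too small
  for an invertible matrix.\<close>

lemma det_add_eq_0_if_rank_lt:
  fixes A F :: "complex^'q::finite^'q"
  assumes "rank A + rank F < CARD('q)"
  shows "det (A + F) = 0"
proof (rule ccontr)
  assume "det (A + F) \<noteq> 0"
  then have "vec.span (rows (A + F)) = UNIV"
    by (metis invertible_det_nz invertible_left_inverse matrix_left_invertible_span_rows_gen)
  obtain B where B: "B \<subseteq> rows A" "vec.independent B" "rows A \<subseteq> vec.span B" "card B = rank A"
    unfolding row_rank_def_gen using vec.basis_exists[of "rows A"] by blast
  obtain C where C: "C \<subseteq> rows F" "vec.independent C" "rows F \<subseteq> vec.span C" "card C = rank F"
    unfolding row_rank_def_gen using vec.basis_exists[of "rows F"] by blast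
  have "row i (A + F) \<in> vec.span (B \<union> C)" for i
  proof -
    have "row i (A + F) = row i A + row i F"
      by (simp add: row_def vec_eq_iff)
    moreover have "row i A \<in> vec.span (B \<union> C)" "row i F \<in> vec.span (B \<union> C)"
      using B(3) C(3) vec.span_mono[of B "B \<union> C"] vec.span_mono[of C "B \<union> C"]
      by (auto simp: rows_def)
    ultimately show ?thesis
      by (simp add: vec.span_add)
  qed
  then have "rows (A + F) \<subseteq> vec.span (B \<union> C)"
    by (auto simp: rows_def)
  then have "UNIV \<subseteq> vec.span (B \<union> C)"
    using \<open>vec.span (rows (A + F)) = UNIV\<close> vec.span_minimal vec.subspace_span by metis
  then have "vec.dim (UNIV :: (complex^'q) set) \<le> card (B \<union> C)"
    using B(2) C(2) vec.finiteI_independent by (intro vec.dim_le_card) auto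
  also have "\<dots> \<le> card B + card C"
    by (rule card_Un_le)
  finally show False
    using assms B(4) C(4) by (simp add: card_cart_basis)
qed

text \<open>Describes bounded rank by polynomial equations in the entries of \<open>A\<close>, with
  constant \<open>F\<close>, in place of the vanishing of minors; this makes the pieces closed. If
  the rank exceeds \<open>r\<close>, completing a row basis changes only
  \<open>CARD('q) - rank A\<close> rows and yields an invertible \<open>A + F\<close>.\<close>

lemma rank_le_iff_det:
  fixes A :: "complex^'q::finite^'q"
  shows "rank A \<le> r \<longleftrightarrow> (\<forall>F :: complex^'q^'q. r + rank F < CARD('q) \<longrightarrow> det (A + F) = 0)"
proof
  assume "rank A \<le> r"
  then show "\<forall>F :: complex^'q^'q. r + rank F < CARD('q) \<longrightarrow> det (A + F) = 0"
    using det_add_eq_0_if_rank_lt[of A] by auto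
next
  assume R: "\<forall>F :: complex^'q^'q. r + rank F < CARD('q) \<longrightarrow> det (A + F) = 0"
  show "rank A \<le> r"
  proof (rule ccontr)
    assume r: "\<not> rank A \<le> r"
    obtain J A' L where J: "card J = rank A" "invertible A'" "coord_proj J ** A' = coord_proj J ** A"
      using row_basis_completion[of A] by metis
    define F where "F = coord_proj (- J) ** (A' - A)"
    have "F = A' - A"
    proof -
      have "A' $ i $ k = A $ i $ k" if "i \<in> J" for i k
        using arg_cong[OF J(3), of "\<lambda>M. M $ i $ k"] that by (simp add: coord_proj_mult_left)
      then show ?thesis
        by (auto simp: F_def vec_eq_iff coord_proj_mult_left)
    qed
    then have "det (A + F) \<noteq> 0"
      using J(2) by (simp add: invertible_det_nz)
    moreover have "rank F \<le> card (- J)"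
      by (rule rank_le_if_factor[of _ "mat 1" _ "A' - A"]) (simp add: F_def)
    moreover have "card (- J) = CARD('q) - rank A"
      using J(1) by (simp add: card_Compl_finite)
    ultimately show False
      using R r rank_le_card[of A] by auto
  qed
qed

text \<open>The columns of \<open>L\<close> with index in \<open>J\<close> lie in the image of
  \<open>A\<close>, so \<open>B\<close> kills them. As \<open>L\<close> is the identity on the block
  \<open>J\<close>, this expresses the columns of \<open>B\<close> in \<open>J\<close> through the
  other columns, and \<open>B\<close> factors through the complement of \<open>J\<close>.\<close>

lemma rank_le_if_mult_eq_0:
  fixes A B :: "complex^'q::finite^'q"
  assumes "B ** A = 0"
  shows "rank B \<le> CARD('q) - rank A"
proof -
  obtain J A' L where J: "card J = rank A" "invertible A'" "coord_proj J ** A' = coord_proj J ** A"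
    "A = L ** coord_proj J ** A"
    using row_basis_completion[of A] by metis
  let ?D = "coord_proj J" and ?E = "coord_proj (- J)"
  obtain V where V: "A' ** V = mat 1"
    using J(2) by (auto simp: invertible_def)
  have AV: "A ** V = L ** ?D"
    using J(3,4) V by (metis matrix_mul_assoc matrix_mul_rid)
  have "?D ** L ** ?D = ?D"
    using AV J(3) V by (metis matrix_mul_assoc matrix_mul_rid)
  then have 1: "B ** ?D ** L ** ?D = B ** ?D"
    by (metis matrix_mul_assoc)
  have "B ** L ** ?D = B ** A ** V"
    using AV by (metis matrix_mul_assoc)
  then have 2: "B ** L ** ?D = 0"
    using assms by simp
  have B: "B = B ** ?D + B ** ?E"
    by (metis coord_proj_simps(4) matrix_add_ldistrib matrix_mul_rid)
  have "B ** L ** ?D = B ** ?D ** L ** ?D + B ** ?E ** L ** ?D"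
    by (subst B) (simp add: matrix_add_rdistrib)
  then have 3: "B ** ?E ** (L ** ?D) = - (B ** ?D)"
    using 1 2 by (simp add: matrix_mul_assoc eq_neg_iff_add_eq_0 add.commute)
  have "B = B ** ?E ** (mat 1 - L ** ?D)"
    by (subst (1) B) (simp only: matrix_diff_ldistrib 3 matrix_mul_rid diff_minus_eq_add add.commute)
  then have "rank B \<le> card (- J)"
    by (rule rank_le_if_factor)
  then show ?thesis
    using J(1) by (simp add: card_Compl_finite)
qed

text \<open>The columns of \<open>P\<close> with index in \<open>K\<close> span a space between the image of \<open>A\<close> and the kernel of \<open>B\<close>.\<close>

lemma adapted_basis:
  fixes A B :: "complex^'q::finite^'q" and K :: "'q set"
  assumes "B ** A = 0" "rank A \<le> card K" "rank B \<le> card (- K)"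
  obtains P V where "P ** V = mat 1" "V ** P = mat 1" "P ** coord_proj K ** V ** A = A"
    "B ** P ** coord_proj K = 0"
proof -
  define N where "N = {x. B *v x = 0}"
  define R where "R = range ((*v) A)"
  have "R \<subseteq> N"
    using assms(1) by (auto simp: R_def N_def matrix_vector_mul_assoc)
  obtain C0 where C0: "C0 \<subseteq> R" "vec.independent C0" "R \<subseteq> vec.span C0"
    using vec.maximal_independent_subset[of R] by blast
  have cardC0: "card C0 \<le> card K"
  proof -
    obtain J A' L where J: "card J = rank A" "A = L ** coord_proj J ** A"
      using row_basis_completion[of A] by metis
    have "A *v x \<in> vec.span ((\<lambda>k. column k L) ` J)" for x
    proof -
      let ?y = "coord_proj J *v (A *v x)"
      have "A *v x = L *v ?y"
        using J(2) by (metis matrix_vector_mul_assoc)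
      also have "\<dots> = (\<Sum>k\<in>UNIV. ?y $ k *s column k L)"
        by (rule matrix_mult_sum)
      also have "\<dots> = (\<Sum>k\<in>J. ?y $ k *s column k L)"
        by (intro sum.mono_neutral_right) (auto simp: coord_proj_mult_vec)
      finally have "A *v x = (\<Sum>k\<in>J. ?y $ k *s column k L)" .
      moreover have "(\<Sum>k\<in>J. ?y $ k *s column k L) \<in> vec.span ((\<lambda>k. column k L) ` J)"
        by (intro vec.span_sum vec.span_scale vec.span_base) auto
      ultimately show ?thesis
        by simp
    qed
    then have "C0 \<subseteq> vec.span ((\<lambda>k. column k L) ` J)"
      using C0(1) by (auto simp: R_def)
    then have "card C0 \<le> card ((\<lambda>k. column k L) ` J)"
      using vec.independent_span_bound[OF _ C0(2)] by auto
    also have "\<dots> \<le> card J"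
      by (intro card_image_le) simp
    finally show ?thesis
      using J(1) assms(2) by simp
  qed
  obtain C1 where C1: "C0 \<subseteq> C1" "C1 \<subseteq> N" "vec.independent C1" "N \<subseteq> vec.span C1"
    using vec.maximal_independent_subset_extend[of C0 N] C0(1,2) \<open>R \<subseteq> N\<close> by blast
  have fin1: "finite C1"
    using C1(3) by (rule vec.finiteI_independent)
  \<comment> \<open>The unit vectors outside \<open>J\<close>, carried over by the inverse
    \<open>G\<close> of the completed matrix, are independent elements of the kernel.\<close>
  have cardC1: "card K \<le> card C1"
  proof -
    obtain J B' L where J: "card J = rank B" "invertible B'" "coord_proj J ** B' = coord_proj J ** B"
      "B = L ** coord_proj J ** B"
      using row_basis_completion[of B] by metis
    obtain G where G: "B' ** G = mat 1" "G ** B' = mat 1"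
      using J(2) by (auto simp: invertible_def)
    have inj: "inj ((*v) G)"
      by (metis (mono_tags, lifting) G(1) injI matrix_vector_mul_assoc matrix_vector_mul_lid)
    let ?S = "(\<lambda>k. axis k (1::complex)) ` (- J)"
    have "G *v axis k 1 \<in> N" if "k \<in> - J" for k
    proof -
      have "B ** G = L ** coord_proj J"
        using J(3,4) G(1) by (metis matrix_mul_assoc matrix_mul_rid)
      then have "B *v (G *v axis k 1) = L *v (coord_proj J *v axis k 1)"
        by (metis matrix_vector_mul_assoc)
      also have "coord_proj J *v axis k 1 = (0 :: complex^'q)"
        using that by (auto simp: vec_eq_iff coord_proj_mult_vec axis_def)
      finally show ?thesis
        by (simp add: N_def)
    qed
    then have sub: "(*v) G ` ?S \<subseteq> vec.span C1"
      using C1(4) by auto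
    have "vec.independent ?S"
      by (rule vec.independent_mono[OF independent_cart_basis]) (auto simp: cart_basis_def)
    then have "vec.independent ((*v) G ` ?S)"
      by (rule vec.linear_independent_injective_image[OF matrix_vector_mul_linear_gen])
        (use inj in \<open>auto intro: inj_on_subset\<close>)
    then have "card ((*v) G ` ?S) \<le> card C1"
      using vec.independent_span_bound[OF fin1 _ sub] by blast
    moreover have "card ((*v) G ` ?S) = card (- J)"
      using inj by (subst card_image; (subst card_image)?) (auto simp: inj_on_def axis_eq_axis)
    moreover have "card K \<le> card (- J)"
      using assms(3) J(1) card_mono[of UNIV K] card_mono[of UNIV J] by (auto simp: card_Compl_finite)
    ultimately show ?thesis
      by simp
  qed
  \<comment> \<open>Both rank bounds may be strict, so neither the basis \<open>C0\<close> of the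
    image nor the basis \<open>C1\<close> of the kernel need have \<open>card K\<close> elements; an
    intermediate set has.\<close>
  obtain C where C: "C0 \<subseteq> C" "C \<subseteq> C1" "card C = card K"
    using exists_subset_between[OF cardC0 cardC1 C1(1) fin1] by blast
  have "vec.independent C"
    using C1(3) C(2) vec.independent_mono by blast
  then obtain C2 where C2: "C \<subseteq> C2" "vec.independent C2" "UNIV \<subseteq> vec.span C2"
    using vec.maximal_independent_subset_extend[OF subset_UNIV] by metis
  have fin2: "finite C2"
    using C2(2) by (rule vec.finiteI_independent)
  then have finC: "finite C"
    using C2(1) finite_subset by blast
  have "card C2 = CARD('q)"
    using vec.basis_card_eq_dim[OF subset_UNIV C2(3,2)] by (simp add: card_cart_basis)
  then have "card (- K) = card (C2 - C)"
    using C(3) C2(1) finC by (simp add: card_Compl_finite card_Diff_subset)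
  then obtain h1 where h1: "bij_betw h1 (- K) (C2 - C)"
    using fin2 by (metis finite finite_Diff finite_same_card_bij)
  obtain h2 where h2: "bij_betw h2 K C"
    using C(3) finC by (metis finite finite_same_card_bij)
  define P where "P = (\<chi> i j. (if j \<in> K then h2 j else h1 j) $ i)"
  have colP: "column j P = (if j \<in> K then h2 j else h1 j)" for j
    by (simp add: P_def column_def vec_eq_iff)
  have "columns P = h2 ` K \<union> h1 ` (- K)"
    by (auto simp: columns_def colP)
  also have "\<dots> = C2"
    using h1 h2 C2(1) by (auto simp: bij_betw_def)
  finally have "vec.span (columns P) = UNIV"
    using C2(3) by auto
  then obtain V where PV: "P ** V = mat 1"
    by (metis matrix_right_invertible_span_columns)
  then have VP: "V ** P = mat 1"
    by (simp add: matrix_left_right_inverse)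
  let ?D = "coord_proj K"
  let ?Q = "P ** ?D ** V"
  have fixC: "?Q *v x = x" if x: "x \<in> C" for x
  proof -
    obtain k where k: "k \<in> K" "x = P *v axis k 1"
      using x h2 colP by (auto simp: bij_betw_def matrix_mult_axis)
    have "V *v x = axis k 1"
      unfolding k(2) by (simp add: matrix_vector_mul_assoc VP)
    moreover have "?D *v axis k 1 = (axis k 1 :: complex^'q)"
      using k(1) by (auto simp: vec_eq_iff coord_proj_mult_vec axis_def)
    ultimately show ?thesis
      by (simp add: matrix_vector_mul_assoc[symmetric] k(2))
  qed
  have "?Q *v x = x" if "x \<in> vec.span C" for x
    using that
  proof (induction rule: vec.span_induct_alt)
    case (step c x y)
    then show ?case
      by (simp add: fixC matrix_vector_right_distrib vector_scalar_commute)
  qed simp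
  moreover have "A *v x \<in> vec.span C" for x
    using C0(3) vec.span_mono[OF C(1)] by (auto simp: R_def)
  ultimately have "(?Q ** A) *v x = A *v x" for x
    by (simp add: matrix_vector_mul_assoc[symmetric])
  then have QA: "P ** ?D ** V ** A = A"
    by (simp add: matrix_eq)
  have "B ** P ** ?D = 0"
  proof -
    have "(B ** P) $ i $ k = 0" if "k \<in> K" for i k
    proof -
      have "column k P \<in> N"
        using that h2 C(2) C1(2) by (auto simp: colP bij_betw_def)
      then have "(B *v column k P) $ i = 0"
        by (simp add: N_def)
      then show ?thesis
        by (simp add: matrix_matrix_mult_def matrix_vector_mult_def column_def)
    qed
    then show ?thesis
      by (auto simp: vec_eq_iff coord_proj_mult_right)
  qed
  with PV VP QA show ?thesis
    using that by blast
qed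

text \<open>Cramer's rule taken as definition: it is polynomial in the entries and makes sense for
  singular \<open>P\<close>. Along a curve of matrices it replaces the inverse, at the cost of the
  factor \<open>det P\<close>.\<close>

definition adjugate :: "complex^'q^'q \<Rightarrow> complex^'q^'q" where
  "adjugate P = (\<chi> k l. det (\<chi> i j. if j = k then (if i = l then 1 else 0) else P $ i $ j))"

lemma adjugate_eq:
  fixes P V :: "complex^'q::finite^'q"
  assumes "P ** V = mat 1"
  shows "adjugate P = mat (det P) ** V"
proof -
  have "adjugate P $ k $ l = det P * V $ k $ l" for k l
  proof -
    have "P *v column l V = axis l 1"
      by (metis assms matrix_mult_axis matrix_vector_mul_assoc matrix_vector_mul_lid)
    then have "adjugate P $ k $ l = det (\<chi> i j. if j = k then (P *v column l V) $ i else P $ i $ j)"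
      unfolding adjugate_def by (auto intro!: arg_cong[where f = det] simp: vec_eq_iff axis_def)
    also have "\<dots> = det P * V $ k $ l"
      unfolding cramer_lemma by (simp add: column_def)
    finally show ?thesis .
  qed
  then show ?thesis
    by (simp add: vec_eq_iff mat_mult_left)
qed

section \<open>The pieces of the Jacobian locus\<close>

lemma cpred_simps:
  assumes "n \<ge> 2" "\<alpha> \<in> {1..n}"
  shows "cpred n \<alpha> \<in> {1..n}" "cpred n \<alpha> \<noteq> \<alpha>"
  using assms by (auto simp: cpred_def)

definition pair_tuple ::
    "nat \<Rightarrow> nat \<Rightarrow> complex^'q^'q \<Rightarrow> complex^'q^'q \<Rightarrow> nat \<Rightarrow> complex^'q^'q" where
  "pair_tuple n \<alpha> A B = (\<lambda>k\<in>{1..n}. if k = cpred n \<alpha> then A else if k = \<alpha> then B else 0)"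

lemma pair_tuple_simps:
  assumes "n \<ge> 2" "\<alpha> \<in> {1..n}"
  shows "pair_tuple n \<alpha> A B \<in> tuples n" "pair_tuple n \<alpha> A B (cpred n \<alpha>) = A"
    "pair_tuple n \<alpha> A B \<alpha> = B"
    "\<And>k. k \<in> {1..n} \<Longrightarrow> k \<noteq> cpred n \<alpha> \<Longrightarrow> k \<noteq> \<alpha> \<Longrightarrow> pair_tuple n \<alpha> A B k = 0"
  using assms cpred_simps[OF assms] by (auto simp: pair_tuple_def tuples_def)

lemma pair_tuple_in_W_piece_iff:
  fixes A B :: "complex^'q::finite^'q"
  assumes "n \<ge> 2" "\<alpha> \<in> {1..n}"
  shows "pair_tuple n \<alpha> A B \<in> W_piece n \<alpha> r \<longleftrightarrow>
    rank A \<le> r \<and> rank B \<le> CARD('q) - r \<and> B ** A = 0"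
  using pair_tuple_simps[OF assms, where A = A and B = B] unfolding W_piece_def by auto

lemma W_piece_pair_tuple:
  assumes "n \<ge> 2" "\<alpha> \<in> {1..n}" "X \<in> W_piece n \<alpha> r"
  shows "X = pair_tuple n \<alpha> (X (cpred n \<alpha>)) (X \<alpha>)"
proof
  fix k
  show "X k = pair_tuple n \<alpha> (X (cpred n \<alpha>)) (X \<alpha>) k"
    using assms by (auto simp: pair_tuple_def W_piece_def tuples_def restrict_def PiE_def extensional_def)
qed

lemma sep_poly_ex_pair_tuple:
  assumes "\<exists>m. sep_poly m (\<lambda>x. A x $ i $ j)" "\<exists>m. sep_poly m (\<lambda>x. B x $ i $ j)" "k \<in> {1..n}"
  shows "\<exists>m. sep_poly m (\<lambda>x. pair_tuple n \<alpha> (A x) (B x) k $ i $ j)"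
  using assms by (cases "k = cpred n \<alpha>"; cases "k = \<alpha>") (auto simp: pair_tuple_def)

lemma poly_funs_det:
  assumes "\<And>i j. (\<lambda>X. M X $ i $ j) \<in> poly_funs n"
  shows "(\<lambda>X. det (M X)) \<in> poly_funs n"
  unfolding det_def
  by (intro poly_funs_sum poly_funs.mult poly_funs.const poly_funs_prod finite_permutations assms) auto

lemma closedin_W_piece:
  assumes "n \<ge> 2" "\<alpha> \<in> {1..n}"
  shows "closedin (zariski n) (W_piece n \<alpha> r :: (nat \<Rightarrow> complex^'q::finite^'q) set)"
proof -
  let ?\<beta> = "cpred n \<alpha>" and ?q = "CARD('q)"
  note \<beta> = cpred_simps[OF assms]
  define F1 where "F1 = (\<lambda>(k, i, j) X. (X k :: complex^'q^'q) $ i $ j) ` (({1..n} - {?\<beta>, \<alpha>}) \<times> UNIV)"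
  define F2 where "F2 = {(\<lambda>X :: nat \<Rightarrow> complex^'q^'q. det (X ?\<beta> + F)) | F. r + rank F < ?q}"
  define F3 where "F3 = {(\<lambda>X :: nat \<Rightarrow> complex^'q^'q. det (X \<alpha> + F)) | F. ?q - r + rank F < ?q}"
  define F4 where "F4 = range (\<lambda>(i, j) X. ((X \<alpha> :: complex^'q^'q) ** X ?\<beta>) $ i $ j)"
  have "F1 \<subseteq> poly_funs n"
    by (auto simp: F1_def intro: poly_funs.entry)
  moreover have det_poly: "(\<lambda>X. det (X k + F)) \<in> poly_funs n" if "k \<in> {1..n}" for k and F :: "complex^'q^'q"
    using that by (intro poly_funs_det) (auto intro!: poly_funs.add poly_funs.entry poly_funs.const)
  then have "F2 \<subseteq> poly_funs n" "F3 \<subseteq> poly_funs n"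
    using \<beta> assms(2) by (auto simp: F2_def F3_def)
  moreover have "F4 \<subseteq> poly_funs n"
    unfolding F4_def matrix_mult_nth using \<beta> assms(2)
    by (auto intro!: poly_funs_sum poly_funs.mult poly_funs.entry)
  moreover have "W_piece n \<alpha> r = zero_locus n (F1 \<union> F2 \<union> F3 \<union> F4)"
  proof -
    have "(\<forall>f\<in>F1. f X = 0) \<longleftrightarrow> (\<forall>k \<in> {1..n} - {?\<beta>, \<alpha>}. X k = 0)" for X
      unfolding F1_def vec_eq_iff by auto
    moreover have "(\<forall>f\<in>F2. f X = 0) \<longleftrightarrow> rank (X ?\<beta>) \<le> r" for X
      unfolding F2_def rank_le_iff_det by auto
    moreover have "(\<forall>f\<in>F3. f X = 0) \<longleftrightarrow> rank (X \<alpha>) \<le> ?q - r" for X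
      unfolding F3_def rank_le_iff_det by auto
    moreover have "(\<forall>f\<in>F4. f X = 0) \<longleftrightarrow> X \<alpha> ** X ?\<beta> = 0" for X
      unfolding F4_def vec_eq_iff by auto
    ultimately show ?thesis
      unfolding W_piece_def zero_locus_def ball_Un by simp
  qed
  ultimately show ?thesis
    unfolding closedin_zariski by (intro exI[of _ "F1 \<union> F2 \<union> F3 \<union> F4"]) simp
qed

subsection \<open>A polynomial chart\<close>

text \<open>With respect to the decomposition of the coordinates into \<open>K\<close> and its complement, the chart
  maps \<open>(M, Q, R)\<close> to the pair of block matrices \<open>A = (Q; M Q)\<close> and \<open>B = (- R M, R)\<close>. The parameter
  \<open>x (False, i, j)\<close> is an entry of \<open>Q\<close> or of \<open>M\<close>, and \<open>x (True, i, j)\<close> is one of \<open>R\<close>.\<close>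

definition chart_fst :: "'q set \<Rightarrow> (bool \<times> 'q \<times> 'q \<Rightarrow> complex) \<Rightarrow> complex^'q^'q" where
  "chart_fst K x = (\<chi> i j. if i \<in> K then x (False, i, j)
     else \<Sum>k\<in>K. x (False, i, k) * x (False, k, j))"

definition chart_snd :: "'q set \<Rightarrow> (bool \<times> 'q \<times> 'q \<Rightarrow> complex) \<Rightarrow> complex^'q^'q" where
  "chart_snd K x = (\<chi> i j. if j \<in> K then - (\<Sum>k\<in>- K. x (True, i, k) * x (False, k, j))
     else x (True, i, j))"

definition chart ::
    "nat \<Rightarrow> nat \<Rightarrow> 'q set \<Rightarrow> (bool \<times> 'q \<times> 'q \<Rightarrow> complex) \<Rightarrow> nat \<Rightarrow> complex^'q^'q" where
  "chart n \<alpha> K x = pair_tuple n \<alpha> (chart_fst K x) (chart_snd K x)"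

text \<open>The entries \<open>(False, i, j)\<close> with \<open>i\<close> in \<open>K\<close> make
  up the block Q, those with \<open>i\<close> outside and \<open>j\<close> inside make up M; a pair
  with both outside names no entry of either.\<close>

definition chart_index :: "'q set \<Rightarrow> (bool \<times> 'q \<times> 'q) set" where
  "chart_index K = {False} \<times> (UNIV - (- K) \<times> (- K)) \<union> {True} \<times> UNIV \<times> (- K)"

lemma card_chart_index:
  fixes K :: "'q::finite set"
  shows "card (chart_index K) = CARD('q)\<^sup>2 + card K * CARD('q) - (card K)\<^sup>2"
proof -
  have le: "card K \<le> CARD('q)"
    by (simp add: card_mono)
  have "card (chart_index K) = card ({False} \<times> ((UNIV :: ('q \<times> 'q) set) - (- K) \<times> (- K)))
      + card ({True} \<times> (UNIV :: 'q set) \<times> (- K))"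
    unfolding chart_index_def by (intro card_Un_disjoint) auto
  also have "card ({False} \<times> ((UNIV :: ('q \<times> 'q) set) - (- K) \<times> (- K))) =
      CARD('q) * CARD('q) - (CARD('q) - card K) * (CARD('q) - card K)"
    by (simp only: card_cartesian_product)
       (simp add: card_Diff_subset card_cartesian_product card_Compl_finite)
  also have "card ({True} \<times> (UNIV :: 'q set) \<times> (- K)) = CARD('q) * (CARD('q) - card K)"
    by (simp add: card_cartesian_product card_Compl_finite)
  also have "CARD('q) * CARD('q) - (CARD('q) - card K) * (CARD('q) - card K)
      + CARD('q) * (CARD('q) - card K) = CARD('q)\<^sup>2 + card K * CARD('q) - (card K)\<^sup>2"
  proof -
    obtain s where s: "CARD('q) = card K + s"
      using le le_Suc_ex by blast
    show ?thesis
      unfolding s by (simp add: power2_eq_square algebra_simps)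
  qed
  finally show ?thesis .
qed

lemma poly_param_chart:
  fixes K :: "'q::finite set"
  assumes "n \<ge> 2" "\<alpha> \<in> {1..n}"
  shows "poly_param n (chart_index K) (chart n \<alpha> K)"
  unfolding poly_param_def
proof (intro conjI allI ballI impI)
  show "finite (chart_index K)"
    by simp
  show "chart n \<alpha> K x \<in> tuples n" for x
    unfolding chart_def by (rule pair_tuple_simps(1)[OF assms])
next
  fix k i j
  have prod: "sep_poly 2 (\<lambda>x. x v * x w)" for v w :: "bool \<times> 'q \<times> 'q"
    using sep_poly_mult[OF sep_poly_var[of 0 v] sep_poly_var[of 0 w]] by (simp add: numeral_2_eq_2)
  have var: "sep_poly 2 (\<lambda>x. x v)" for v :: "bool \<times> 'q \<times> 'q"
    using sep_poly_var[of 1 v] by (simp add: numeral_2_eq_2)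
  have "sep_poly 2 (\<lambda>x. chart_fst K x $ i $ j)"
    unfolding chart_fst_def by (cases "i \<in> K") (auto intro!: sep_poly_sum prod var)
  moreover have "sep_poly 2 (\<lambda>x. chart_snd K x $ i $ j)"
  proof (cases "j \<in> K")
    case True
    have "sep_poly (0 + 2) (\<lambda>x. - 1 * (\<Sum>k\<in>- K. x (True, i, k) * x (False, k, j)))"
      by (intro sep_poly_mult sep_poly_sum prod) auto
    then show ?thesis
      using True by (simp add: chart_snd_def numeral_2_eq_2)
  qed (simp add: chart_snd_def var)
  ultimately show "\<exists>m. sep_poly m (\<lambda>x. chart n \<alpha> K x k $ i $ j)" if "k \<in> {1..n}"
    using that unfolding chart_def by (intro sep_poly_ex_pair_tuple) auto
next
  fix x y :: "bool \<times> 'q \<times> 'q \<Rightarrow> complex"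
  assume xy: "\<forall>v\<in>chart_index K. x v = y v"
  have "chart_fst K x = chart_fst K y" "chart_snd K x = chart_snd K y"
    using xy by (auto simp: chart_fst_def chart_snd_def chart_index_def vec_eq_iff intro!: sum.cong)
  then show "chart n \<alpha> K x = chart n \<alpha> K y"
    by (simp add: chart_def)
qed

text \<open>The rows of \<open>A\<close> in \<open>K\<close> determine \<open>A\<close> by the
  factor (1; M), and the columns of \<open>B\<close> outside \<open>K\<close> determine
  \<open>B\<close> by the factor (-M, 1), which bounds the ranks. The two block contributions to the
  product are -RMQ and RMQ in the parameter blocks.\<close>

lemma chart_in_W_piece:
  fixes K :: "'q::finite set"
  assumes "n \<ge> 2" "\<alpha> \<in> {1..n}"
  shows "chart n \<alpha> K x \<in> W_piece n \<alpha> (card K)"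
  unfolding chart_def pair_tuple_in_W_piece_iff[OF assms]
proof (intro conjI)
  define L :: "complex^'q^'q" where
    "L = (\<chi> i j. if i \<in> K then if i = j then 1 else 0 else x (False, i, j))"
  define R :: "complex^'q^'q" where
    "R = (\<chi> i j. if j \<in> K then - x (False, i, j) else if i = j then 1 else 0)"
  let ?A = "chart_fst K x" and ?B = "chart_snd K x"
  have "?A $ i $ j = (L ** coord_proj K ** ?A) $ i $ j" for i j
  proof -
    have "(L ** coord_proj K ** ?A) $ i $ j = (\<Sum>k\<in>UNIV. (if k \<in> K then L $ i $ k else 0) * ?A $ k $ j)"
      by (simp add: matrix_mult_nth[of "L ** coord_proj K"] coord_proj_mult_right)
    also have "\<dots> = (\<Sum>k\<in>K. L $ i $ k * x (False, k, j))"
      by (intro sum.mono_neutral_cong_right) (auto simp: chart_fst_def)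
    also have "\<dots> = ?A $ i $ j"
    proof (cases "i \<in> K")
      case True
      then have "(\<Sum>k\<in>K. L $ i $ k * x (False, k, j)) = (\<Sum>k\<in>K. if k = i then x (False, i, j) else 0)"
        by (intro sum.cong) (auto simp: L_def)
      then show ?thesis
        using True by (simp add: chart_fst_def)
    qed (simp add: L_def chart_fst_def)
    finally show ?thesis
      by simp
  qed
  then have "?A = L ** coord_proj K ** ?A"
    by (simp add: vec_eq_iff)
  then show "rank ?A \<le> card K"
    by (rule rank_le_if_factor)
  have "?B $ i $ j = (?B ** coord_proj (- K) ** R) $ i $ j" for i j
  proof -
    have "(?B ** coord_proj (- K) ** R) $ i $ j = (\<Sum>k\<in>UNIV. (if k \<in> - K then ?B $ i $ k else 0) * R $ k $ j)"
      by (simp add: matrix_mult_nth[of "?B ** coord_proj (- K)"] coord_proj_mult_right)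
    also have "\<dots> = (\<Sum>k\<in>- K. x (True, i, k) * R $ k $ j)"
      by (intro sum.mono_neutral_cong_right) (auto simp: chart_snd_def)
    also have "\<dots> = ?B $ i $ j"
    proof (cases "j \<in> K")
      case True
      then show ?thesis
        by (simp add: R_def chart_snd_def sum_negf)
    next
      case False
      then have "(\<Sum>k\<in>- K. x (True, i, k) * R $ k $ j) = (\<Sum>k\<in>- K. if k = j then x (True, i, j) else 0)"
        by (intro sum.cong) (auto simp: R_def)
      then show ?thesis
        using False by (simp add: chart_snd_def)
    qed
    finally show ?thesis
      by simp
  qed
  then have "?B = ?B ** coord_proj (- K) ** R"
    by (simp add: vec_eq_iff)
  then have "rank ?B \<le> card (- K)"
    by (rule rank_le_if_factor)
  then show "rank ?B \<le> CARD('q) - card K"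
    by (simp add: card_Compl_finite)
  have "(?B ** ?A) $ i $ l = 0" for i l
  proof -
    have "(?B ** ?A) $ i $ l = (\<Sum>j\<in>K. ?B $ i $ j * ?A $ j $ l) + (\<Sum>j\<in>- K. ?B $ i $ j * ?A $ j $ l)"
      unfolding matrix_mult_nth by (subst sum.union_disjoint[symmetric]) auto
    also have "(\<Sum>j\<in>K. ?B $ i $ j * ?A $ j $ l) =
        (\<Sum>j\<in>K. \<Sum>k\<in>- K. - (x (True, i, k) * x (False, k, j) * x (False, j, l)))"
      by (intro sum.cong) (auto simp: chart_fst_def chart_snd_def sum_distrib_right sum_negf)
    also have "\<dots> = (\<Sum>k\<in>- K. \<Sum>j\<in>K. - (x (True, i, k) * x (False, k, j) * x (False, j, l)))"
      by (rule sum.swap)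
    also have "(\<Sum>j\<in>- K. ?B $ i $ j * ?A $ j $ l) =
        (\<Sum>k\<in>- K. \<Sum>j\<in>K. x (True, i, k) * x (False, k, j) * x (False, j, l))"
      by (intro sum.cong) (auto simp: chart_fst_def chart_snd_def sum_distrib_left mult.assoc)
    finally show ?thesis
      by (simp add: sum_negf)
  qed
  then show "?B ** ?A = 0"
    by (simp add: vec_eq_iff)
qed

text \<open>In blocks, with \<open>M\<close> standing for its lower left block, the hypotheses say
  that the lower part of \<open>A\<close> is \<open>M\<close> times the upper part and that the left
  part of \<open>B\<close> is minus the right part times \<open>M\<close>. These are the equations
  of the chart.\<close>

lemma pair_tuple_in_chart:
  fixes A B M :: "complex^'q::finite^'q"
  assumes A: "coord_proj (- K) ** A = coord_proj (- K) ** M ** coord_proj K ** A"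
    and B: "B ** coord_proj K = - (B ** coord_proj (- K) ** M ** coord_proj K)"
  shows "pair_tuple n \<alpha> A B \<in> range (chart n \<alpha> K)"
proof
  define x where "x = (\<lambda>(b, i, j). if b then B $ i $ j else if i \<in> K then A $ i $ j else M $ i $ j)"
  have "A $ i $ j = (\<Sum>k\<in>K. M $ i $ k * A $ k $ j)" if "i \<notin> K" for i j
  proof -
    have "A $ i $ j = (coord_proj (- K) ** (M ** coord_proj K ** A)) $ i $ j"
      using arg_cong[OF A, of "\<lambda>Y. Y $ i $ j"] that
      by (simp add: coord_proj_mult_left matrix_mul_assoc)
    also have "\<dots> = (\<Sum>k\<in>UNIV. (if k \<in> K then M $ i $ k else 0) * A $ k $ j)"
      using that by (simp add: coord_proj_mult_left matrix_mult_nth[of "M ** coord_proj K"] coord_proj_mult_right)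
    also have "\<dots> = (\<Sum>k\<in>K. M $ i $ k * A $ k $ j)"
      by (intro sum.mono_neutral_cong_right) auto
    finally show ?thesis .
  qed
  then have "A = chart_fst K x"
    by (simp add: vec_eq_iff chart_fst_def x_def)
  moreover have "B $ i $ j = - (\<Sum>k\<in>- K. B $ i $ k * M $ k $ j)" if "j \<in> K" for i j
  proof -
    have "B $ i $ j = - ((B ** coord_proj (- K) ** M) $ i $ j)"
      using arg_cong[OF B, of "\<lambda>Y. Y $ i $ j"] that
      by (simp add: coord_proj_mult_right)
    also have "(B ** coord_proj (- K) ** M) $ i $ j = (\<Sum>k\<in>UNIV. (if k \<in> - K then B $ i $ k else 0) * M $ k $ j)"
      by (simp add: matrix_mult_nth[of "B ** coord_proj (- K)"] coord_proj_mult_right)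
    also have "\<dots> = (\<Sum>k\<in>- K. B $ i $ k * M $ k $ j)"
      by (intro sum.mono_neutral_cong_right) auto
    finally show ?thesis .
  qed
  then have "B = chart_snd K x"
    by (auto simp: vec_eq_iff chart_snd_def x_def)
  ultimately show "pair_tuple n \<alpha> A B = chart n \<alpha> K x"
    by (simp add: chart_def)
qed auto

text \<open>If also the block of \<open>P\<close> on \<open>K\<close> is invertible, then the span of the columns of \<open>P\<close> in \<open>K\<close> is
  the graph of \<open>M = P\<^sub>2\<^sub>1 P\<^sub>1\<^sub>1\<^sup>-\<^sup>1\<close>.\<close>

lemma pair_tuple_in_chart_if_invertible:
  fixes P Q R :: "complex^'q::finite^'q"
  assumes "det P \<noteq> 0" "det (coord_proj K ** P ** coord_proj K + coord_proj (- K)) \<noteq> 0"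
  shows "pair_tuple n \<alpha> (P ** coord_proj K ** Q) (R ** coord_proj (- K) ** adjugate P)
    \<in> range (chart n \<alpha> K)"
proof -
  let ?D = "coord_proj K" and ?E = "coord_proj (- K)"
  \<comment> \<open>The block of \<open>P\<close> on \<open>K\<close>, completed by the identity on
    the complement; the inverse \<open>G\<close> of this matrix therefore inverts that
    block.\<close>
  let ?N = "?D ** P ** ?D + ?E"
  obtain V where V: "P ** V = mat 1" "V ** P = mat 1"
    using assms(1) by (metis invertible_det_nz invertible_def)
  obtain G where G: "?N ** G = mat 1" "G ** ?N = mat 1"
    using assms(2) by (metis invertible_det_nz invertible_def)
  note DE = coord_proj_simps(1)[of K] coord_proj_simps(1)[of "- K"] coord_proj_simps(2,3)[of K]
  have absorb: "X ** ?D ** ?D = X ** ?D" "X ** ?E ** ?E = X ** ?E" "X ** ?D ** ?E = 0"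
    "X ** ?E ** ?D = 0" for X :: "complex^'q^'q"
    using DE by (metis matrix_mul_assoc matrix_mult_zero_right)+
  have "?N ** ?E = ?E"
    by (simp add: matrix_add_rdistrib absorb DE)
  then have GE: "G ** ?E = ?E"
    using G(2) by (metis matrix_mul_assoc matrix_mul_lid)
  have "?E ** ?N = ?E"
    by (simp add: matrix_add_ldistrib matrix_mul_assoc DE)
  then have EG: "?E ** G = ?E"
    using G(1) by (metis matrix_mul_assoc matrix_mul_rid)
  have "G ** ?D ** P ** ?D + ?E = ?D + ?E"
    using G(2) GE coord_proj_simps(4)[of K] by (simp add: matrix_add_ldistrib matrix_mul_assoc)
  then have GD: "G ** ?D ** P ** ?D = ?D"
    by simp
  have "?D ** P ** ?D ** G + ?E = ?D + ?E"
    using G(1) EG coord_proj_simps(4)[of K] by (simp add: matrix_add_rdistrib)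
  then have DG: "?D ** P ** ?D ** G = ?D"
    by simp
  \<comment> \<open>The columns of \<open>M\<close> in \<open>K\<close> span the same space as those
    of \<open>P\<close>, normalized so that their upper block is the identity.\<close>
  define M where "M = P ** ?D ** G"
  define A where "A = P ** ?D ** Q"
  define B where "B = R ** ?E ** adjugate P"
  have "?D ** A = ?D ** P ** ?D ** Q"
    by (simp add: A_def matrix_mul_assoc)
  then have "G ** (?D ** A) = ?D ** Q"
    using GD by (simp add: matrix_mul_assoc)
  then have "M ** (?D ** A) = P ** ?D ** (?D ** Q)"
    unfolding M_def by (metis matrix_mul_assoc)
  then have "M ** ?D ** A = A"
    by (simp add: A_def matrix_mul_assoc absorb)
  then have 1: "?E ** A = ?E ** M ** ?D ** A"
    by (metis matrix_mul_assoc)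
  have "adjugate P ** P = mat (det P)"
    using adjugate_eq[OF V(1)] V(2) by (metis matrix_mul_assoc matrix_mul_rid)
  then have "B ** P = R ** ?E ** mat (det P)"
    unfolding B_def by (metis matrix_mul_assoc)
  also have "\<dots> = mat (det P) ** R ** ?E"
    by (metis mat_mult_commute matrix_mul_assoc)
  \<comment> \<open>Thanks to the adjugate, \<open>B ** P\<close> is a multiple of
    \<open>R ** ?E\<close>, so \<open>B\<close> kills the columns of \<open>P\<close> in
    \<open>K\<close>.\<close>
  finally have "B ** P ** ?D = 0"
    by (simp add: absorb)
  then have "B ** M = 0"
    by (simp add: M_def matrix_mul_assoc)
  moreover have "M = ?D + ?E ** M"
  proof -
    have "M = (?D + ?E) ** M"
      by (simp add: coord_proj_simps(4))
    also have "\<dots> = ?D ** M + ?E ** M"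
      by (simp add: matrix_add_rdistrib)
    also have "?D ** M = ?D"
      using DG by (simp add: M_def matrix_mul_assoc)
    finally show ?thesis .
  qed
  ultimately have "B ** ?D + B ** (?E ** M) = 0"
    by (metis matrix_add_ldistrib)
  then have "(B ** ?D + B ** (?E ** M)) ** ?D = 0"
    by simp
  then have "B ** ?D + B ** ?E ** M ** ?D = 0"
    by (simp add: matrix_add_rdistrib matrix_mul_assoc absorb)
  then have 2: "B ** ?D = - (B ** ?E ** M ** ?D)"
    by (simp add: eq_neg_iff_add_eq_0)
  show ?thesis
    using pair_tuple_in_chart[OF 1 2] by (simp add: A_def B_def)
qed

section \<open>Closure of separately polynomial functions under matrix operations, and density of
  the chart\<close>

lemma sep_poly_ex_add:
  "\<exists>m. sep_poly m f \<Longrightarrow> \<exists>m. sep_poly m g \<Longrightarrow> \<exists>m. sep_poly m (\<lambda>x. f x + g x)"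
  by (metis max.cobounded1 max.cobounded2 sep_poly_add sep_poly_mono)

lemma sep_poly_ex_mult:
  "\<exists>m. sep_poly m f \<Longrightarrow> \<exists>m. sep_poly m g \<Longrightarrow> \<exists>m. sep_poly m (\<lambda>x. f x * g x)"
  using sep_poly_mult by blast

lemma sep_poly_ex_const: "\<exists>m. sep_poly m (\<lambda>x. c)"
  by blast

lemma sep_poly_ex_var: "\<exists>m. sep_poly m (\<lambda>x. x v)"
  by blast

lemma sep_poly_ex_sum:
  "finite A \<Longrightarrow> (\<And>a. a \<in> A \<Longrightarrow> \<exists>m. sep_poly m (f a)) \<Longrightarrow> \<exists>m. sep_poly m (\<lambda>x. \<Sum>a\<in>A. f a x)"
  by (induction A rule: finite_induct) (simp_all add: sep_poly_ex_add sep_poly_ex_const)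

lemma sep_poly_ex_prod:
  "finite A \<Longrightarrow> (\<And>a. a \<in> A \<Longrightarrow> \<exists>m. sep_poly m (f a)) \<Longrightarrow> \<exists>m. sep_poly m (\<lambda>x. \<Prod>a\<in>A. f a x)"
  by (induction A rule: finite_induct) (simp_all add: sep_poly_ex_mult sep_poly_ex_const)

lemma sep_poly_ex_matrix_mult:
  fixes M N :: "('v \<Rightarrow> complex) \<Rightarrow> complex^'q::finite^'q"
  assumes "\<And>i j. \<exists>m. sep_poly m (\<lambda>x. M x $ i $ j)" "\<And>i j. \<exists>m. sep_poly m (\<lambda>x. N x $ i $ j)"
  shows "\<exists>m. sep_poly m (\<lambda>x. (M x ** N x) $ i $ j)"
  unfolding matrix_mult_nth by (intro sep_poly_ex_sum sep_poly_ex_mult assms) simp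

lemma sep_poly_ex_det:
  fixes M :: "('v \<Rightarrow> complex) \<Rightarrow> complex^'q::finite^'q"
  assumes "\<And>i j. \<exists>m. sep_poly m (\<lambda>x. M x $ i $ j)"
  shows "\<exists>m. sep_poly m (\<lambda>x. det (M x))"
  unfolding det_def
  by (intro sep_poly_ex_sum sep_poly_ex_mult sep_poly_ex_const sep_poly_ex_prod assms finite_permutations) simp_all

text \<open>The line from \<open>P\<close> to the identity matrix meets the locus where the previous lemma applies, so
  generic points of the corresponding polynomial curve through a given point lie in the chart.\<close>

lemma W_piece_subset_closure_chart:
  fixes K :: "'q::finite set"
  assumes "n \<ge> 2" "\<alpha> \<in> {1..n}"
  shows "W_piece n \<alpha> (card K) \<subseteq> zariski_closure n (range (chart n \<alpha> K))"
proof
  fix X :: "nat \<Rightarrow> complex^'q^'q" assume X: "X \<in> W_piece n \<alpha> (card K)"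
  define A where "A = X (cpred n \<alpha>)"
  define B where "B = X \<alpha>"
  have XAB: "X = pair_tuple n \<alpha> A B"
    using W_piece_pair_tuple[OF assms X] by (simp add: A_def B_def)
  have AB: "B ** A = 0" "rank A \<le> card K" "rank B \<le> card (- K)"
    using X by (auto simp: W_piece_def A_def B_def card_Compl_finite)
  let ?D = "coord_proj K" and ?E = "coord_proj (- K)"
  obtain P V where P: "P ** V = mat 1" "V ** P = mat 1" "P ** ?D ** V ** A = A" "B ** P ** ?D = 0"
    using adapted_basis[OF AB] by metis
  have detP: "det P \<noteq> 0"
    using P(1,2) by (metis invertible_def invertible_det_nz)
  \<comment> \<open>The line from \<open>P\<close>, at parameter 0, to the identity, at parameter 1.
    It is spelled with \<open>- 1 *\<close> to fit the closure rules for sums and products.\<close>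
  define Pt :: "(unit \<Rightarrow> complex) \<Rightarrow> complex^'q^'q" where
    "Pt x = (\<chi> i j. (1 + - 1 * x ()) * P $ i $ j + x () * mat 1 $ i $ j)" for x
  define Q where "Q = V ** A"
  \<comment> \<open>The factor \<open>1 / det P\<close> compensates the one in the adjugate, so that
    the curve yields \<open>B\<close> at parameter 0.\<close>
  define R where "R = mat (1 / det P) ** B ** P"
  define \<gamma> where "\<gamma> x = pair_tuple n \<alpha> (Pt x ** ?D ** Q) (R ** ?E ** adjugate (Pt x))" for x
  \<comment> \<open>Where \<open>d\<close> does not vanish, the curve lies in the chart; this is so
    at parameter 1.\<close>
  define d where "d x = det (Pt x) * det (?D ** Pt x ** ?D + ?E)" for x
  have Pt_poly: "\<exists>m. sep_poly m (\<lambda>x. Pt x $ i $ j)" for i j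
    unfolding Pt_def vec_lambda_beta
    by (intro sep_poly_ex_add sep_poly_ex_mult sep_poly_ex_const sep_poly_ex_var)
  have adj_poly: "\<exists>m. sep_poly m (\<lambda>x. adjugate (Pt x) $ i $ j)" for i j
    unfolding adjugate_def vec_lambda_beta
  proof (rule sep_poly_ex_det)
    fix a b
    show "\<exists>m. sep_poly m (\<lambda>x. (\<chi> k l. if l = i then if k = j then 1 else 0 else Pt x $ k $ l) $ a $ b)"
      using Pt_poly[of a b] by (cases "b = i") (simp_all add: sep_poly_ex_const)
  qed
  have "poly_param n {()} \<gamma>"
    unfolding poly_param_def
  proof (intro conjI allI ballI impI)
    show "\<gamma> x \<in> tuples n" for x
      unfolding \<gamma>_def by (rule pair_tuple_simps(1)[OF assms])
    show "\<gamma> x = \<gamma> y" if "\<forall>v\<in>{()}. x v = y v" for x y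
      using that by (simp add: \<gamma>_def Pt_def)
    fix k i j assume k: "k \<in> {1..n}"
    have "\<exists>m. sep_poly m (\<lambda>x. (Pt x ** ?D ** Q) $ i $ j)"
      by (intro sep_poly_ex_matrix_mult sep_poly_ex_const Pt_poly)
    moreover have "\<exists>m. sep_poly m (\<lambda>x. (R ** ?E ** adjugate (Pt x)) $ i $ j)"
      by (intro sep_poly_ex_matrix_mult sep_poly_ex_const adj_poly)
    ultimately show "\<exists>m. sep_poly m (\<lambda>x. \<gamma> x k $ i $ j)"
      unfolding \<gamma>_def by (rule sep_poly_ex_pair_tuple[OF _ _ k])
  qed simp
  have d_poly: "\<exists>m. sep_poly m d"
    unfolding d_def
    by (intro sep_poly_ex_mult sep_poly_ex_det sep_poly_ex_matrix_mult Pt_poly)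
       (simp, intro sep_poly_ex_add sep_poly_ex_matrix_mult sep_poly_ex_const Pt_poly)
  have "Pt (\<lambda>_. 1) = mat 1"
    by (simp add: Pt_def vec_eq_iff)
  then have d1: "d (\<lambda>_. 1) \<noteq> 0"
    by (simp add: d_def coord_proj_simps)
  have "Pt (\<lambda>_. 0) = P"
    by (simp add: Pt_def vec_eq_iff)
  have "P ** ?D ** Q = A"
    using P(3) by (simp add: Q_def matrix_mul_assoc)
  moreover have "R ** ?E ** adjugate P = B"
  proof -
    have "B ** P = B ** P ** ?D + B ** P ** ?E"
      by (metis coord_proj_simps(4) matrix_add_ldistrib matrix_mul_rid)
    then have "B ** P ** ?E = B ** P"
      using P(4) by simp
    then have "R ** ?E = R"
      unfolding R_def by (metis matrix_mul_assoc)
    then have "R ** ?E ** adjugate P = mat (1 / det P) ** (B ** P ** (mat (det P) ** V))"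
      by (simp add: adjugate_eq[OF P(1)] R_def matrix_mul_assoc)
    also have "B ** P ** (mat (det P) ** V) = mat (det P) ** B"
      using P(1) by (metis mat_mult_commute matrix_mul_assoc matrix_mul_rid)
    also have "mat (1 / det P) ** (mat (det P) ** B) = B"
      using detP by (simp add: vec_eq_iff mat_mult_left)
    finally show ?thesis .
  qed
  ultimately have \<gamma>0: "\<gamma> (\<lambda>_. 0) = X"
    using \<open>Pt (\<lambda>_. 0) = P\<close> by (simp add: \<gamma>_def XAB)
  have "f X = 0" if f: "f \<in> poly_funs n" "\<forall>Y\<in>range (chart n \<alpha> K). f Y = 0" for f
  proof (rule ccontr)
    assume "f X \<noteq> 0"
    obtain m m' where "sep_poly m (\<lambda>x. f (\<gamma> x))" "sep_poly m' d"
      using poly_param_comp[OF \<open>poly_param n {()} \<gamma>\<close> f(1)] d_poly by blast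
    \<comment> \<open>\<open>f\<close> along the curve is nonzero at parameter 0 and
      \<open>d\<close> at parameter 1, so some parameter avoids the zeros of both.\<close>
    then obtain z where z: "f (\<gamma> z) \<noteq> 0" "d z \<noteq> 0"
      using sep_poly_common_nonzero[of m "\<lambda>x. f (\<gamma> x)" m' d "\<lambda>_. 0" "\<lambda>_. 1"] \<open>f X \<noteq> 0\<close> d1
      by (auto simp: \<gamma>0)
    then have "\<gamma> z \<in> range (chart n \<alpha> K)"
      unfolding \<gamma>_def by (intro pair_tuple_in_chart_if_invertible) (auto simp: d_def)
    then show False
      using f(2) z(1) by blast
  qed
  moreover have "X \<in> tuples n"
    using X by (simp add: W_piece_def)
  ultimately show "X \<in> zariski_closure n (range (chart n \<alpha> K))"
    by (auto simp: zariski_closure_def zero_locus_def)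
qed

text \<open>Provides the order of the parameters for the flag, in which the entries of the block M
  precede all others.\<close>

lemma enumeration_initial_segment:
  assumes "finite M" "finite N" "M \<inter> N = {}"
  obtains v :: "nat \<Rightarrow> 'a" where "bij_betw v {..<card (M \<union> N)} (M \<union> N)"
    "\<And>k. k < card (M \<union> N) \<Longrightarrow> v k \<in> M \<Longrightarrow> v ` {..k} \<subseteq> M"
proof -
  obtain h1 where h1: "bij_betw h1 {..<card M} M"
    using assms(1) by (metis bij_betw_from_nat_into_finite bij_betw_def)
  obtain h2 where h2: "bij_betw h2 {card M..<card M + card N} N"
    using assms(2) by (metis add_diff_cancel_left' card_atLeastLessThan finite_atLeastLessThan finite_same_card_bij)
  let ?v = "\<lambda>k. if k < card M then h1 k else h2 k"
  have card: "card (M \<union> N) = card M + card N"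
    using assms by (rule card_Un_disjoint)
  have "bij_betw ?v {..<card M} M" "bij_betw ?v {card M..<card M + card N} N"
    using h1 h2 by (simp_all add: bij_betw_def inj_on_def)
  then have "bij_betw ?v ({..<card M} \<union> {card M..<card M + card N}) (M \<union> N)"
    using assms(3) by (rule bij_betw_combine)
  moreover have "{..<card M} \<union> {card M..<card M + card N} = {..<card (M \<union> N)}"
    unfolding card by auto
  ultimately have "bij_betw ?v {..<card (M \<union> N)} (M \<union> N)"
    by simp
  moreover have "?v ` {..k} \<subseteq> M" if "k < card (M \<union> N)" "?v k \<in> M" for k
  proof -
    have "k < card M"
    proof (rule ccontr)
      assume "\<not> k < card M"
      then have "?v k \<in> N"
        using that(1) h2 unfolding card by (auto simp: bij_betw_def)
      then show False
        using that(2) assms(3) by blast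
    qed
    then show ?thesis
      using h1 by (auto simp: bij_betw_def)
  qed
  ultimately show ?thesis
    using that by blast
qed

lemma irreducible_and_zdim_W_piece:
  assumes "n \<ge> 2" "\<alpha> \<in> {1..n}" "r \<le> CARD('q::finite)"
  shows "irreducible_in (zariski n) (W_piece n \<alpha> r :: (nat \<Rightarrow> complex^'q^'q) set)"
    "zdim n (W_piece n \<alpha> r :: (nat \<Rightarrow> complex^'q^'q) set) = enat (CARD('q)\<^sup>2 + r * CARD('q) - r\<^sup>2)"
proof -
  obtain K :: "'q set" where K: "card K = r"
    using assms(3) by (metis obtain_subset_with_card_n)
  \<comment> \<open>The entries of the block M, to be freed first: an entry of the lower part of A
    is a sum of products of entries of M and Q, and equals an entry of M as long as Q has its base
    value.\<close>
  define I1 where "I1 = {False} \<times> (- K) \<times> K"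
  define I2 where "I2 = {False} \<times> K \<times> UNIV \<union> {True} \<times> UNIV \<times> (- K)"
  have I: "chart_index K = I1 \<union> I2"
    by (auto simp: chart_index_def I1_def I2_def)
  obtain v where v: "bij_betw v {..<card (chart_index K)} (chart_index K)"
    "\<And>k. k < card (chart_index K) \<Longrightarrow> v k \<in> I1 \<Longrightarrow> v ` {..k} \<subseteq> I1"
    unfolding I by (rule enumeration_initial_segment[of I1 I2]) (auto simp: I1_def I2_def)
  \<comment> \<open>At the base point Q is the identity on the block \<open>K\<close> and zero
    beside it, while M and R are zero.\<close>
  define x0 :: "bool \<times> 'q \<times> 'q \<Rightarrow> complex" where
    "x0 = (\<lambda>(b, i, j). if \<not> b \<and> i \<in> K \<and> i = j then 1 else 0)"
  define g :: "bool \<times> 'q \<times> 'q \<Rightarrow> (nat \<Rightarrow> complex^'q^'q) \<Rightarrow> complex" where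
    "g = (\<lambda>(b, i, j) X. X (if b then \<alpha> else cpred n \<alpha>) $ i $ j)"
  have range: "range (chart n \<alpha> K) \<subseteq> W_piece n \<alpha> (card K)"
    using chart_in_W_piece[OF assms(1,2)] by blast
  have g_poly: "g w \<in> poly_funs n" for w
    using assms(2) cpred_simps[OF assms(1,2)]
    by (cases w) (auto simp: g_def intro!: poly_funs.entry)
  have gv: "g (v k) (chart n \<alpha> K x) = x (v k)"
    if k: "k < card (chart_index K)" and x: "\<And>w. w \<notin> v ` {..k} \<Longrightarrow> x w = x0 w" for k x
  proof -
    obtain b i j where vk: "v k = (b, i, j)"
      by (cases "v k")
    have "v k \<in> I1 \<union> I2"
      using v(1) k unfolding I by (auto simp: bij_betw_def)
    then consider "b" "j \<notin> K" | "\<not> b" "i \<in> K" | "\<not> b" "i \<notin> K" "j \<in> K"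
      unfolding vk by (auto simp: I1_def I2_def)
    then show ?thesis
    proof cases
      case 3
      then have "v ` {..k} \<subseteq> I1"
        using v(2)[OF k] by (auto simp: vk I1_def)
      then have "x (False, l, j) = x0 (False, l, j)" if "l \<in> K" for l
        using that by (intro x) (auto simp: I1_def)
      then have "(\<Sum>l\<in>K. x (False, i, l) * x (False, l, j)) = (\<Sum>l\<in>K. if l = j then x (False, i, j) else 0)"
        by (intro sum.cong) (auto simp: x0_def)
      then show ?thesis
        using 3 by (simp add: g_def vk chart_def pair_tuple_simps[OF assms(1,2)] chart_fst_def)
    qed (auto simp: g_def vk chart_def pair_tuple_simps[OF assms(1,2)] chart_fst_def chart_snd_def)
  qed
  note param = poly_param_chart[OF assms(1,2), of K] closedin_W_piece[OF assms(1,2)] range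
    W_piece_subset_closure_chart[OF assms(1,2)] v(1) g_poly gv
  show "irreducible_in (zariski n) (W_piece n \<alpha> r :: (nat \<Rightarrow> complex^'q^'q) set)"
    using irreducible_and_zdim_param(1)[OF param] by (simp add: K)
  show "zdim n (W_piece n \<alpha> r :: (nat \<Rightarrow> complex^'q^'q) set) = enat (CARD('q)\<^sup>2 + r * CARD('q) - r\<^sup>2)"
    using irreducible_and_zdim_param(2)[OF param] by (simp add: K card_chart_index)
qed

section \<open>The Jacobian locus of iterated matrix multiplication\<close>

definition elem_matrix :: "'q \<Rightarrow> 'q \<Rightarrow> complex^'q^'q" where
  "elem_matrix i j = (\<chi> a b. if a = i \<and> b = j then 1 else 0)"

lemma matrix_mult_zero_left: "0 ** A = 0"
  for A :: "complex^'q::finite^'q"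
  by (simp add: vec_eq_iff matrix_mult_nth)

lemma trace_mult: "trace (C ** A) = (\<Sum>i\<in>UNIV. \<Sum>j\<in>UNIV. A $ i $ j * C $ j $ i)"
  for A C :: "complex^'q::finite^'q"
  unfolding trace_mul_sym[of C] by (simp add: trace_def matrix_mult_nth)

lemma trace_mult_elem: "trace (C ** elem_matrix i j) = C $ j $ i"
  for C :: "complex^'q::finite^'q"
proof -
  have "trace (C ** elem_matrix i j) = (\<Sum>a\<in>UNIV. \<Sum>b\<in>UNIV. if b = j then if a = i then C $ j $ i else 0 else 0)"
    unfolding trace_mult elem_matrix_def by (intro sum.cong) auto
  then show ?thesis
    by simp
qed

lemma eq_0_if_traces_0:
  fixes C :: "complex^'q::finite^'q"
  assumes "\<And>Z. trace (C ** Z) = 0"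
  shows "C = 0"
  using assms trace_mult_elem[of C] by (metis (no_types, lifting) vec_eq_iff zero_index)

text \<open>An elementary matrix as \<open>Z\<close> isolates the product of one entry of
  \<open>B\<close> with one entry of \<open>A\<close>.\<close>

lemma eq_0_if_sandwich_0:
  fixes A B :: "complex^'q::finite^'q"
  assumes "\<And>Z. B ** Z ** A = 0"
  shows "A = 0 \<or> B = 0"
proof (rule ccontr)
  assume "\<not> (A = 0 \<or> B = 0)"
  then obtain i j k l where ij: "B $ i $ j \<noteq> 0" and kl: "A $ k $ l \<noteq> 0"
    by (auto simp: vec_eq_iff)
  have "(B ** elem_matrix j k) $ i $ m = (if m = k then B $ i $ j else 0)" for m
  proof -
    have "(B ** elem_matrix j k) $ i $ m = (\<Sum>a\<in>UNIV. if a = j then if m = k then B $ i $ j else 0 else 0)"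
      unfolding matrix_mult_nth elem_matrix_def by (intro sum.cong) auto
    then show ?thesis
      by simp
  qed
  then have "(B ** elem_matrix j k ** A) $ i $ l = (\<Sum>m\<in>UNIV. (if m = k then B $ i $ j else 0) * A $ m $ l)"
    by (simp add: matrix_mult_nth[of "B ** elem_matrix j k"])
  also have "\<dots> = (\<Sum>m\<in>UNIV. if m = k then B $ i $ j * A $ k $ l else 0)"
    by (intro sum.cong) auto
  finally have "(B ** elem_matrix j k ** A) $ i $ l = B $ i $ j * A $ k $ l"
    by simp
  then show False
    using assms[of "elem_matrix j k"] ij kl by simp
qed

lemma matprod_cong: "(\<And>k. k \<in> {1..n} \<Longrightarrow> X k = Y k) \<Longrightarrow> matprod X n = matprod Y n"
  by (induction n) auto

lemma matprod_update:
  fixes Y :: "nat \<Rightarrow> complex^'q::finite^'q"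
  assumes "k \<in> {1..n}"
  shows "\<exists>L R. \<forall>A. matprod (Y(k := A)) n = L ** A ** R"
  using assms
proof (induction n)
  case (Suc n)
  show ?case
  proof (cases "k = Suc n")
    case True
    have "matprod (Y(k := A)) n = matprod Y n" for A
      using True by (intro matprod_cong) auto
    then have "matprod (Y(k := A)) (Suc n) = mat 1 ** A ** matprod Y n" for A
      using True by simp
    then show ?thesis
      by blast
  next
    case False
    then have "k \<in> {1..n}"
      using Suc.prems by auto
    then obtain L R where "\<forall>A. matprod (Y(k := A)) n = L ** A ** R"
      using Suc.IH by blast
    then have "matprod (Y(k := A)) (Suc n) = (Y (Suc n) ** L) ** A ** R" for A
      using False by (simp add: matrix_mul_assoc)
    then show ?thesis
      by blast
  qed
qed simp

lemma IMM_cong: "(\<And>k. k \<in> {1..n} \<Longrightarrow> X k = Y k) \<Longrightarrow> IMM n X = IMM n Y"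
  unfolding IMM_def using matprod_cong[of n X Y] by simp

lemma IMM_expand:
  fixes Y :: "nat \<Rightarrow> complex^'q::finite^'q"
  assumes "k \<in> {1..n}"
  shows "IMM n (Y(k := A)) = (\<Sum>i\<in>UNIV. \<Sum>j\<in>UNIV. A $ i $ j * IMM n (Y(k := elem_matrix i j)))"
proof -
  obtain L R where LR: "\<And>A. matprod (Y(k := A)) n = L ** A ** R"
    using matprod_update[OF assms] by blast
  have "IMM n (Y(k := A)) = trace (R ** L ** A)" for A
    unfolding IMM_def LR using trace_mul_sym[of "L ** A" R] by (simp add: matrix_mul_assoc)
  then show ?thesis
    by (simp add: trace_mult_elem) (simp add: trace_mult)
qed

lemma IMM_eq_0_if_zero:
  fixes Y :: "nat \<Rightarrow> complex^'q::finite^'q"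
  assumes "k \<in> {1..n}" "Y k = 0"
  shows "IMM n Y = 0"
  using IMM_expand[OF assms(1), of Y 0] fun_upd_triv[of Y k] assms(2) by simp

text \<open>By \<open>IMM_expand\<close>, \<open>IMM\<close> is affine in a single entry; the slope
  is the value at the elementary matrix, and the constant term comes from setting the entry to
  0.\<close>

lemma deriv_IMM_entry:
  fixes Y :: "nat \<Rightarrow> complex^'q::finite^'q"
  assumes "k \<in> {1..n}"
  shows "deriv (\<lambda>t. IMM n (Y(k := set_entry i j t A))) s = IMM n (Y(k := elem_matrix i j))"
proof -
  let ?I = "\<lambda>a b. IMM n (Y(k := elem_matrix a b))"
  have "IMM n (Y(k := set_entry i j t A)) = IMM n (Y(k := set_entry i j 0 A)) + t * ?I i j" for t
  proof -
    have "IMM n (Y(k := set_entry i j t A)) =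
        (\<Sum>a\<in>UNIV. \<Sum>b\<in>UNIV. set_entry i j 0 A $ a $ b * ?I a b +
          (if b = j then if a = i then t * ?I i j else 0 else 0))"
      unfolding IMM_expand[OF assms, of Y "set_entry i j t A"]
      by (intro sum.cong refl) (auto simp: set_entry_def)
    also have "\<dots> = IMM n (Y(k := set_entry i j 0 A)) + t * ?I i j"
      unfolding IMM_expand[OF assms, of Y "set_entry i j 0 A"] by (simp add: sum.distrib)
    finally show ?thesis .
  qed
  then have eq: "(\<lambda>t. IMM n (Y(k := set_entry i j t A))) =
      (\<lambda>t. IMM n (Y(k := set_entry i j 0 A)) + t * ?I i j)"
    by (rule ext)
  have "((\<lambda>t. c + t * d) has_field_derivative d) (at s)" for c d
    by (auto intro!: derivative_eq_intros)
  then show ?thesis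
    unfolding eq by (rule DERIV_imp_deriv)
qed

definition subst_elems ::
    "(nat \<times> 'q \<times> 'q) list \<Rightarrow> (nat \<Rightarrow> complex^'q^'q) \<Rightarrow> nat \<Rightarrow> complex^'q^'q" where
  "subst_elems vs X = (\<lambda>k. case map_of vs k of None \<Rightarrow> X k | Some (i, j) \<Rightarrow> elem_matrix i j)"

lemma subst_elems_notin: "k \<notin> fst ` set vs \<Longrightarrow> subst_elems vs X k = X k"
  by (simp add: subst_elems_def map_of_eq_None_iff[THEN iffD2])

text \<open>Each derivative replaces one matrix by an elementary one. Then the matrix at this
  position no longer matters, so a second derivative there is 0, even with respect to another
  entry.\<close>

lemma iterated_partial_deriv_IMM:
  fixes vs :: "(nat \<times> 'q::finite \<times> 'q) list"
  assumes "set vs \<subseteq> {1..n} \<times> UNIV"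
  shows "foldr partial_deriv vs (IMM n) =
    (\<lambda>X. if distinct (map fst vs) then IMM n (subst_elems vs X) else 0)"
  using assms
proof (induction vs)
  case Nil
  then show ?case
    by (simp add: subst_elems_def fun_eq_iff)
next
  case (Cons w vs)
  obtain k i j where w: "w = (k, i, j)"
    by (cases w)
  have k: "k \<in> {1..n}"
    using Cons.prems w by auto
  have IH: "foldr partial_deriv vs (IMM n) =
      (\<lambda>X. if distinct (map fst vs) then IMM n (subst_elems vs X) else 0)"
    using Cons by auto
  show ?case
  proof
    fix X
    have *: "foldr partial_deriv (w # vs) (IMM n) X = deriv (\<lambda>t. if distinct (map fst vs)
        then IMM n (subst_elems vs (X(k := set_entry i j t (X k)))) else 0) (X k $ i $ j)"
      by (simp add: w IH)
    show "foldr partial_deriv (w # vs) (IMM n) X =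
        (if distinct (map fst (w # vs)) then IMM n (subst_elems (w # vs) X) else 0)"
    proof (cases "distinct (map fst vs) \<and> k \<notin> fst ` set vs")
      case True
      then have "map_of vs k = None"
        by (simp add: map_of_eq_None_iff)
      then have "subst_elems vs (X(k := A)) = (subst_elems vs X)(k := A)" for A
        by (auto simp: subst_elems_def fun_eq_iff split: option.split)
      moreover have "(subst_elems vs X)(k := elem_matrix i j) = subst_elems (w # vs) X"
        by (auto simp: subst_elems_def fun_eq_iff w)
      ultimately show ?thesis
        unfolding * using True
          deriv_IMM_entry[OF k, of "subst_elems vs X" i j "X k" "X k $ i $ j"] by (simp add: w)
    next
      case False
      have "subst_elems vs (X(k := A)) = subst_elems vs X" if "k \<in> fst ` set vs" for A
      proof
        fix l
        have "map_of vs k \<noteq> None"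
          using that by (simp add: map_of_eq_None_iff)
        then show "subst_elems vs (X(k := A)) l = subst_elems vs X l"
          by (cases "l = k") (auto simp: subst_elems_def split: option.split)
      qed
      then have "(\<lambda>t. if distinct (map fst vs)
          then IMM n (subst_elems vs (X(k := set_entry i j t (X k)))) else 0) =
          (\<lambda>t. if distinct (map fst vs) then IMM n (subst_elems vs X) else 0)"
        using False by (cases "distinct (map fst vs)") simp_all
      moreover have "\<not> distinct (map fst (w # vs))"
        using False by (auto simp: w)
      ultimately show ?thesis
        unfolding * by (simp only: if_False deriv_const)
    qed
  qed
qed

lemma W_locus_iff:
  "X \<in> W_locus n \<longleftrightarrow> X \<in> tuples n \<and> (\<forall>vs. length vs = n - 2 \<and> set vs \<subseteq> {1..n} \<times> UNIV \<and>
     distinct (map fst vs) \<longrightarrow> IMM n (subst_elems vs X) = 0)"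
  for X :: "nat \<Rightarrow> complex^'q::finite^'q"
  unfolding W_locus_def jacobian_locus_def using iterated_partial_deriv_IMM[where 'q = 'q] by auto

text \<open>By multilinearity, the matrices at the positions of the derivatives may be arbitrary.\<close>

lemma W_locus_IMM_eq_0:
  fixes X Y :: "nat \<Rightarrow> complex^'q::finite^'q"
  assumes X: "X \<in> W_locus n" and ab: "a \<in> {1..n}" "b \<in> {1..n}" "a \<noteq> b"
    and Y: "Y a = X a" "Y b = X b"
  shows "IMM n Y = 0"
proof -
  define S where "S = {1..n} - {a, b}"
  \<comment> \<open>\<open>T\<close> collects the positions where \<open>Y\<close> need not be
    elementary. With \<open>T\<close> empty this is a derivative of order n - 2; each further
    position is freed by linearity.\<close>
  have "IMM n Y = 0" if "finite T" "T \<subseteq> S" "Y a = X a" "Y b = X b"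
    "\<forall>k\<in>S - T. \<exists>i j. Y k = elem_matrix i j" for T Y
    using that
  proof (induction T arbitrary: Y rule: finite_induct)
    case empty
    then have "\<forall>k\<in>S. \<exists>w. Y k = (case w of (i, j) \<Rightarrow> elem_matrix i j)"
      by auto
    then obtain w where w: "\<forall>k\<in>S. Y k = (case w k of (i, j) \<Rightarrow> elem_matrix i j)"
      by metis
    define vs where "vs = map (\<lambda>k. (k, w k)) (sorted_list_of_set S)"
    have S: "finite S" "card S = n - 2"
      using ab by (auto simp: S_def card_Diff_subset)
    have "length vs = n - 2" "set vs \<subseteq> {1..n} \<times> UNIV" "distinct (map fst vs)"
      using S by (auto simp: vs_def S_def comp_def)
    then have "IMM n (subst_elems vs X) = 0"
      using X unfolding W_locus_iff by blast
    moreover have "map_of vs = (Some \<circ> w) |` S"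
      using S(1) by (simp add: vs_def map_of_map_restrict)
    then have "subst_elems vs X k = Y k" if "k \<in> {1..n}" for k
      using that w empty by (cases "k \<in> S") (auto simp: subst_elems_def S_def restrict_map_def)
    then have "IMM n (subst_elems vs X) = IMM n Y"
      by (intro IMM_cong)
    ultimately show ?case
      by simp
  next
    case (insert k T)
    have k: "k \<in> {1..n}" "k \<noteq> a" "k \<noteq> b"
      using insert.prems(1) by (auto simp: S_def)
    have "IMM n (Y(k := elem_matrix i j)) = 0" for i j
      using insert.prems k by (intro insert.IH) auto
    then show ?case
      using IMM_expand[OF k(1), of Y "Y k"] by simp
  qed
  from this[of S Y] Y show ?thesis
    by (simp add: S_def)
qed

section \<open>Test tuples with the identity matrix at all but a few positions\<close>

lemma matprod_skip:
  fixes Y :: "nat \<Rightarrow> complex^'q::finite^'q"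
  assumes "m \<le> n" "\<And>k. m < k \<Longrightarrow> k \<le> n \<Longrightarrow> Y k = mat 1"
  shows "matprod Y n = matprod Y m"
  using assms by (induction n rule: dec_induct) auto

lemma matprod_step:
  fixes Y :: "nat \<Rightarrow> complex^'q::finite^'q"
  assumes "1 \<le> p" "p \<le> n" "\<And>k. p < k \<Longrightarrow> k \<le> n \<Longrightarrow> Y k = mat 1"
  shows "matprod Y n = Y p ** matprod Y (p - 1)"
  using matprod_skip[OF assms(2,3)] assms(1) by (cases p) auto

lemma matprod_eq_one:
  fixes Y :: "nat \<Rightarrow> complex^'q::finite^'q"
  assumes "\<And>k. 1 \<le> k \<Longrightarrow> k \<le> n \<Longrightarrow> Y k = mat 1"
  shows "matprod Y n = mat 1"
  using matprod_skip[of 0 n Y] assms by simp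

lemma IMM_sparse2:
  fixes A B :: "complex^'q::finite^'q"
  assumes "1 \<le> a" "a < b" "b \<le> n"
  shows "IMM n ((\<lambda>_. mat 1)(a := A, b := B)) = trace (B ** A)"
proof -
  define Y where "Y = (\<lambda>_. mat 1)(a := A, b := B)"
  have "matprod Y n = B ** matprod Y (b - 1)"
    using assms by (subst matprod_step[of b]) (auto simp: Y_def)
  also have "matprod Y (b - 1) = A ** matprod Y (a - 1)"
    using assms by (subst matprod_step[of a]) (auto simp: Y_def)
  also have "matprod Y (a - 1) = mat 1"
    using assms by (intro matprod_eq_one) (auto simp: Y_def)
  finally show ?thesis
    by (simp add: IMM_def Y_def[symmetric])
qed

lemma IMM_sparse3:
  fixes A B C :: "complex^'q::finite^'q"
  assumes "1 \<le> a" "a < b" "b < c" "c \<le> n"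
  shows "IMM n ((\<lambda>_. mat 1)(a := A, b := B, c := C)) = trace (C ** B ** A)"
proof -
  define Y where "Y = (\<lambda>_. mat 1)(a := A, b := B, c := C)"
  have "matprod Y n = C ** matprod Y (c - 1)"
    using assms by (subst matprod_step[of c]) (auto simp: Y_def)
  also have "matprod Y (c - 1) = B ** matprod Y (b - 1)"
    using assms by (subst matprod_step[of b]) (auto simp: Y_def)
  also have "matprod Y (b - 1) = A ** matprod Y (a - 1)"
    using assms by (subst matprod_step[of a]) (auto simp: Y_def)
  also have "matprod Y (a - 1) = mat 1"
    using assms by (intro matprod_eq_one) (auto simp: Y_def)
  finally show ?thesis
    by (simp add: IMM_def Y_def[symmetric] matrix_mul_assoc)
qed

lemma IMM_sparse4:
  fixes A B C D :: "complex^'q::finite^'q"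
  assumes "1 \<le> a" "a < b" "b < c" "c < d" "d \<le> n"
  shows "IMM n ((\<lambda>_. mat 1)(a := A, b := B, c := C, d := D)) = trace (D ** C ** B ** A)"
proof -
  define Y where "Y = (\<lambda>_. mat 1)(a := A, b := B, c := C, d := D)"
  have "matprod Y n = D ** matprod Y (d - 1)"
    using assms by (subst matprod_step[of d]) (auto simp: Y_def)
  also have "matprod Y (d - 1) = C ** matprod Y (c - 1)"
    using assms by (subst matprod_step[of c]) (auto simp: Y_def)
  also have "matprod Y (c - 1) = B ** matprod Y (b - 1)"
    using assms by (subst matprod_step[of b]) (auto simp: Y_def)
  also have "matprod Y (b - 1) = A ** matprod Y (a - 1)"
    using assms by (subst matprod_step[of a]) (auto simp: Y_def)
  also have "matprod Y (a - 1) = mat 1"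
    using assms by (intro matprod_eq_one) (auto simp: Y_def)
  finally show ?thesis
    by (simp add: IMM_def Y_def[symmetric] matrix_mul_assoc)
qed

lemma trace_eq_0_card_1:
  fixes C :: "complex^'q::finite^'q"
  assumes "CARD('q) = 1" "trace C = 0"
  shows "C = 0"
proof -
  obtain z :: 'q where z: "UNIV = {z}"
    using assms(1) card_1_singletonE by blast
  then have "i = z" for i
    by (metis UNIV_I singletonD)
  moreover have "C $ z $ z = 0"
    using assms(2) by (simp add: trace_def z)
  ultimately have "C $ i $ j = 0" for i j
    by metis
  then show ?thesis
    by (simp add: vec_eq_iff)
qed

text \<open>Filling the other positions with 1 leaves the product of two scalars, whatever the
  distance between their positions.\<close>

lemma W_locus_pair_card_1:
  fixes X :: "nat \<Rightarrow> complex^'q::finite^'q"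
  assumes "X \<in> W_locus n" "CARD('q) = 1" "a \<in> {1..n}" "b \<in> {1..n}" "a < b"
  shows "X a = 0 \<or> X b = 0"
proof -
  have "trace (X b ** X a) = 0"
    using W_locus_IMM_eq_0[OF assms(1,3,4), of "(\<lambda>_. mat 1)(a := X a, b := X b)"]
      IMM_sparse2[of a b n "X a" "X b"] assms by auto
  then have "X b ** X a = 0"
    by (rule trace_eq_0_card_1[OF assms(2)])
  obtain z :: 'q where z: "UNIV = {z}"
    using assms(2) card_1_singletonE by blast
  have "trace (X b) * trace (X a) = (X b ** X a) $ z $ z"
    by (simp add: trace_def matrix_mult_nth z)
  then have "trace (X b) = 0 \<or> trace (X a) = 0"
    using \<open>X b ** X a = 0\<close> by simp
  then show ?thesis
    using trace_eq_0_card_1[OF assms(2)] by blast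
qed

text \<open>Both arcs of the cycle between the two positions contain a free position. Arbitrary
  matrices inserted there turn the vanishing of the trace into \<open>X b ** Z ** X a = 0\<close>
  for all \<open>Z\<close>.\<close>

lemma W_locus_nonadjacent:
  fixes X :: "nat \<Rightarrow> complex^'q::finite^'q"
  assumes "X \<in> W_locus n" "1 \<le> a" "a + 1 < b" "b \<le> n" "\<not> (a = 1 \<and> b = n)"
  shows "X a = 0 \<or> X b = 0"
proof (rule eq_0_if_sandwich_0, rule eq_0_if_traces_0)
  fix Z Z' :: "complex^'q^'q"
  note W = W_locus_IMM_eq_0[OF assms(1), of a b]
  have "trace (Z' ** X b ** Z ** X a) = 0"
  \<comment> \<open>The outer arc contains position \<open>n\<close> unless \<open>b = n\<close>,
    and then it contains position 1.\<close>
  proof (cases "b = n")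
    case True
    then have "trace (X b ** Z ** X a ** Z') = 0"
      using W[of "(\<lambda>_. mat 1)(1 := Z', a := X a, a + 1 := Z, b := X b)"]
        IMM_sparse4[of 1 a "a + 1" b n Z' "X a" Z "X b"] assms by auto
    then show ?thesis
      using trace_mul_sym[of "X b ** Z ** X a" Z'] by (simp add: matrix_mul_assoc)
  next
    case False
    then show ?thesis
      using W[of "(\<lambda>_. mat 1)(a := X a, a + 1 := Z, b := X b, n := Z')"]
        IMM_sparse4[of a "a + 1" b n n "X a" Z "X b" Z'] assms by auto
  qed
  then show "trace (X b ** Z ** X a ** Z') = 0"
    using trace_mul_sym[of "X b ** Z ** X a" Z'] by (simp add: matrix_mul_assoc)
qed

text \<open>Since n \<ge> 3, a third position can hold an arbitrary matrix, and the trace pairing is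
  nondegenerate. The cases differ in where that position lies and hence in the rotation of the
  trace.\<close>

lemma W_locus_adjacent:
  fixes X :: "nat \<Rightarrow> complex^'q::finite^'q"
  assumes "X \<in> W_locus n" "n \<ge> 3" "\<alpha> \<in> {1..n}"
  shows "X \<alpha> ** X (cpred n \<alpha>) = 0"
proof (rule eq_0_if_traces_0)
  fix Z :: "complex^'q^'q"
  let ?\<beta> = "cpred n \<alpha>"
  have \<beta>: "?\<beta> \<in> {1..n}" "?\<beta> \<noteq> \<alpha>"
    using cpred_simps[of n \<alpha>] assms by auto
  note W = W_locus_IMM_eq_0[OF assms(1) \<beta>(1) assms(3) \<beta>(2)]
  consider "\<alpha> = 1" | "\<alpha> = n" "\<alpha> \<noteq> 1" | "\<alpha> \<noteq> 1" "\<alpha> < n"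
    using assms(3) by fastforce
  then show "trace (X \<alpha> ** X ?\<beta> ** Z) = 0"
  proof cases
    case 1
    then have "trace (X n ** Z ** X 1) = 0"
      using W[of "(\<lambda>_. mat 1)(1 := X 1, 2 := Z, n := X n)"] IMM_sparse3[of 1 2 n n "X 1" Z "X n"] assms
      by (auto simp: cpred_def)
    then show ?thesis
      using 1 trace_mul_sym[of "X n ** Z" "X 1"] by (simp add: cpred_def matrix_mul_assoc)
  next
    case 2
    then show ?thesis
      using W[of "(\<lambda>_. mat 1)(1 := Z, n - 1 := X (n - 1), n := X n)"]
        IMM_sparse3[of 1 "n - 1" n n Z "X (n - 1)" "X n"] assms
      by (auto simp: cpred_def)
  next
    case 3
    then obtain m where m: "\<alpha> = Suc m" "m \<ge> 1"
      using assms(3) by (cases \<alpha>) auto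
    then have "trace (Z ** X \<alpha> ** X (\<alpha> - 1)) = 0"
      using W[of "(\<lambda>_. mat 1)(m := X m, \<alpha> := X \<alpha>, n := Z)"]
        IMM_sparse3[of m \<alpha> n n "X m" "X \<alpha>" Z] 3
      by (auto simp: cpred_def)
    then show ?thesis
      using 3 trace_mul_sym[of Z "X \<alpha> ** X (\<alpha> - 1)"] by (simp add: cpred_def matrix_mul_assoc)
  qed
qed

lemma matprod_eq_0:
  fixes Y :: "nat \<Rightarrow> complex^'q::finite^'q"
  assumes "m \<le> n" "matprod Y m = 0"
  shows "matprod Y n = 0"
  using assms(1) by (induction n rule: dec_induct) (auto simp: assms(2) matrix_mult_zero_right)

text \<open>The matrices at positions \<open>n\<close> and 1 stand at opposite ends of the product
  and meet only after a cyclic rotation of the trace; for any other adjacent pair the product itself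
  is 0.\<close>

lemma IMM_eq_0_if_adjacent:
  fixes Y :: "nat \<Rightarrow> complex^'q::finite^'q"
  assumes "n \<ge> 2" "\<alpha> \<in> {1..n}" "Y \<alpha> ** Y (cpred n \<alpha>) = 0"
  shows "IMM n Y = 0"
proof (cases "\<alpha> = 1")
  case True
  have "\<exists>M. matprod Y (Suc m) = M ** Y 1" for m
  proof (induction m)
    case 0
    show ?case
      by (intro exI[of _ "mat 1"]) simp
  next
    case (Suc m)
    then obtain M where "matprod Y (Suc m) = M ** Y 1"
      by blast
    then have "matprod Y (Suc (Suc m)) = (Y (Suc (Suc m)) ** M) ** Y 1"
      by (simp add: matrix_mul_assoc)
    then show ?case
      by blast
  qed
  moreover obtain m where m: "n = Suc (Suc m)"
    using assms(1) by (metis Suc_le_D numeral_2_eq_2 Suc_le_mono)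
  ultimately obtain M where M: "matprod Y (Suc m) = M ** Y 1"
    by blast
  have "matprod Y n = Y n ** matprod Y (Suc m)"
    by (simp add: m)
  then have "matprod Y n = Y n ** M ** Y 1"
    by (simp only: M matrix_mul_assoc)
  then have "IMM n Y = trace (Y n ** M ** Y 1)"
    by (simp only: IMM_def)
  also have "\<dots> = trace (Y 1 ** Y n ** M)"
    using trace_mul_sym[of "Y n ** M" "Y 1"] by (simp add: matrix_mul_assoc)
  also have "Y 1 ** Y n = 0"
    using assms(3) True by (simp add: cpred_def)
  finally show ?thesis
    by (simp add: matrix_mult_zero_left trace_def)
next
  case False
  then obtain m where m: "\<alpha> = Suc (Suc m)"
    using assms(2) by (cases \<alpha>; cases "\<alpha> - 1") auto
  have "Y (Suc (Suc m)) ** Y (Suc m) = 0"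
    using assms(3) m by (simp add: cpred_def)
  then have "matprod Y (Suc (Suc m)) = 0"
    by (simp add: matrix_mul_assoc matrix_mult_zero_left)
  then have "matprod Y n = 0"
    using matprod_eq_0[of "Suc (Suc m)" n Y] assms(2) m by simp
  then show ?thesis
    by (simp add: IMM_def trace_def)
qed

text \<open>Substituting n - 2 positions leaves two untouched. Either one of these carries the zero
  matrix, or they are exactly the two positions of the piece, whose product vanishes.\<close>

lemma W_piece_subset_W_locus:
  assumes "n \<ge> 2" "\<alpha> \<in> {1..n}"
  shows "(W_piece n \<alpha> r :: (nat \<Rightarrow> complex^'q::finite^'q) set) \<subseteq> W_locus n"
proof
  fix X :: "nat \<Rightarrow> complex^'q^'q" assume X: "X \<in> W_piece n \<alpha> r"
  let ?\<beta> = "cpred n \<alpha>"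
  have \<beta>: "?\<beta> \<in> {1..n}" "?\<beta> \<noteq> \<alpha>"
    using cpred_simps[OF assms] by auto
  have "IMM n (subst_elems vs X) = 0"
    if vs: "length vs = n - 2" "set vs \<subseteq> {1..n} \<times> UNIV" "distinct (map fst vs)"
    for vs :: "(nat \<times> 'q \<times> 'q) list"
  proof (cases "\<exists>k\<in>{1..n} - fst ` set vs. k \<noteq> ?\<beta> \<and> k \<noteq> \<alpha>")
    case True
    then obtain k where k: "k \<in> {1..n}" "k \<notin> fst ` set vs" "k \<noteq> ?\<beta>" "k \<noteq> \<alpha>"
      by blast
    then have "subst_elems vs X k = 0"
      using X by (simp add: subst_elems_notin W_piece_def)
    then show ?thesis
      by (rule IMM_eq_0_if_zero[OF k(1)])
  next
    case False
    have "card (fst ` set vs) = n - 2"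
      using vs(1,3) distinct_card[OF vs(3)] by simp
    moreover have "fst ` set vs \<subseteq> {1..n}"
      using vs(2) by auto
    ultimately have "card ({1..n} - fst ` set vs) = 2"
      using assms(1) by (simp add: card_Diff_subset)
    moreover have "{1..n} - fst ` set vs \<subseteq> {?\<beta>, \<alpha>}"
      using False by blast
    ultimately have "{1..n} - fst ` set vs = {?\<beta>, \<alpha>}"
      using \<beta>(2) by (intro card_subset_eq) auto
    then have "?\<beta> \<notin> fst ` set vs" "\<alpha> \<notin> fst ` set vs"
      by blast+
    then show ?thesis
      using X by (intro IMM_eq_0_if_adjacent[OF assms]) (simp add: subst_elems_notin W_piece_def)
  qed
  then show "X \<in> W_locus n"
    using X by (auto simp: W_locus_iff W_piece_def)
qed

lemma rank_eq_0_iff: "rank A = 0 \<longleftrightarrow> A = 0"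
  for A :: "complex^'q::finite^'q"
proof
  assume "rank A = 0"
  moreover obtain J L where "card J = rank A" "A = L ** coord_proj J ** A"
    using row_basis_completion[of A] by metis
  ultimately have "A = L ** coord_proj {} ** A"
    by simp
  also have "coord_proj {} = (0 :: complex^'q^'q)"
    by (simp add: coord_proj_def vec_eq_iff)
  finally show "A = 0"
    by (simp add: matrix_mult_zero_left matrix_mult_zero_right)
next
  assume "A = 0"
  then have "A = 0 ** coord_proj {} ** 0"
    by (simp add: matrix_mult_zero_right)
  then show "rank A = 0"
    using rank_le_if_factor[of A 0 "{}" 0] by simp
qed

text \<open>With r = q the second matrix is 0 and the first arbitrary, which is the case r = 0 one
  position earlier. Thus q values of r suffice for each index, whence the count n q.\<close>

lemma W_piece_card_subset:
  assumes "n \<ge> 2" "\<alpha> \<in> {1..n}"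
  shows "(W_piece n \<alpha> CARD('q) :: (nat \<Rightarrow> complex^'q::finite^'q) set) \<subseteq> W_piece n (cpred n \<alpha>) 0"
proof
  fix X :: "nat \<Rightarrow> complex^'q^'q" assume X: "X \<in> W_piece n \<alpha> CARD('q)"
  let ?\<beta> = "cpred n \<alpha>"
  have \<beta>: "?\<beta> \<in> {1..n}" "cpred n ?\<beta> \<in> {1..n}" "cpred n ?\<beta> \<noteq> ?\<beta>"
    using cpred_simps[OF assms] cpred_simps[of n ?\<beta>] assms(1) by auto
  have "X \<alpha> = 0"
    using X by (simp add: W_piece_def rank_eq_0_iff)
  then have X0: "X k = 0" if "k \<in> {1..n}" "k \<noteq> ?\<beta>" for k
    using X that by (cases "k = \<alpha>") (auto simp: W_piece_def)
  then show "X \<in> W_piece n ?\<beta> 0"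
    using X \<beta> rank_le_card by (auto simp: W_piece_def rank_eq_0_iff matrix_mult_zero_right)
qed

text \<open>Nonzero matrices sit at pairwise adjacent positions, and a cycle of length at least 4
  has no three pairwise adjacent vertices. For q = 1 at most one matrix is nonzero.\<close>

lemma W_locus_support:
  fixes X :: "nat \<Rightarrow> complex^'q::finite^'q"
  assumes "n \<ge> 2" "n \<ge> 4 \<or> CARD('q) = 1" "X \<in> W_locus n"
  shows "\<exists>\<alpha>\<in>{1..n}. (\<forall>k\<in>{1..n} - {cpred n \<alpha>, \<alpha>}. X k = 0) \<and> X \<alpha> ** X (cpred n \<alpha>) = 0"
proof (cases "CARD('q) = 1")
  case True
  have pair: "X a = 0 \<or> X b = 0" if "a \<in> {1..n}" "b \<in> {1..n}" "a \<noteq> b" for a b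
    using W_locus_pair_card_1[OF assms(3) True that(1,2)] W_locus_pair_card_1[OF assms(3) True that(2,1)]
      that(3) by linarith
  have "\<exists>\<alpha>\<in>{1..n}. \<forall>k\<in>{1..n} - {\<alpha>}. X k = 0"
  proof (cases "\<exists>a\<in>{1..n}. X a \<noteq> 0")
    case False
    then show ?thesis
      using assms(1) by (intro bexI[of _ 1]) auto
  qed (use pair in blast)
  then obtain \<alpha> where \<alpha>: "\<alpha> \<in> {1..n}" "\<forall>k\<in>{1..n} - {\<alpha>}. X k = 0"
    by blast
  moreover have "X (cpred n \<alpha>) = 0"
    using \<alpha> cpred_simps[OF assms(1) \<alpha>(1)] by blast
  ultimately show ?thesis
    by (intro bexI[of _ \<alpha>]) (auto simp: matrix_mult_zero_right)
next
  case False
  then have n: "n \<ge> 4"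
    using assms(2) by blast
  have adj: "b = a + 1 \<or> (a = 1 \<and> b = n)"
    if "a \<in> {1..n}" "b \<in> {1..n}" "a < b" "X a \<noteq> 0" "X b \<noteq> 0" for a b
    using W_locus_nonadjacent[OF assms(3), of a b] that by force
  have "\<exists>\<alpha>\<in>{1..n}. \<forall>k\<in>{1..n}. X k \<noteq> 0 \<longrightarrow> k = cpred n \<alpha> \<or> k = \<alpha>"
  proof (cases "\<exists>a\<in>{1..n}. \<exists>b\<in>{1..n}. a < b \<and> X a \<noteq> 0 \<and> X b \<noteq> 0")
    case True
    then obtain a b where ab: "a \<in> {1..n}" "b \<in> {1..n}" "a < b" "X a \<noteq> 0" "X b \<noteq> 0"
      by blast
    have k: "k = a \<or> k = b" if "k \<in> {1..n}" "X k \<noteq> 0" for k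
      using adj[OF ab] adj[of a k] adj[of k a] adj[of b k] adj[of k b] that ab n
      by (cases k a rule: linorder_cases; cases k b rule: linorder_cases) auto
    show ?thesis
      using adj[OF ab]
    proof
      assume "b = a + 1"
      then have "cpred n b = a"
        using ab(1) by (simp add: cpred_def)
      then show ?thesis
        using ab(2) k by blast
    next
      assume "a = 1 \<and> b = n"
      then have "cpred n a = b"
        by (simp add: cpred_def)
      then show ?thesis
        using ab(1) k by blast
    qed
  next
    case False
    then have one: "a = b" if "a \<in> {1..n}" "b \<in> {1..n}" "X a \<noteq> 0" "X b \<noteq> 0" for a b
      using that by (metis linorder_neqE_nat)
    show ?thesis
    proof (cases "\<exists>a\<in>{1..n}. X a \<noteq> 0")
      case True
      then show ?thesis
        using one by blast
    next
      case False
      then show ?thesis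
        using assms(1) by (intro bexI[of _ 1]) auto
    qed
  qed
  then obtain \<alpha> where "\<alpha> \<in> {1..n}" "\<forall>k\<in>{1..n}. X k \<noteq> 0 \<longrightarrow> k = cpred n \<alpha> \<or> k = \<alpha>"
    by blast
  then show ?thesis
    using W_locus_adjacent[OF assms(3), of \<alpha>] n by (intro bexI[of _ \<alpha>]) auto
qed

lemma W_locus_eq_Union:
  assumes "n \<ge> 2" "n \<ge> 4 \<or> CARD('q::finite) = 1"
  shows "(W_locus n :: (nat \<Rightarrow> complex^'q^'q) set) =
    (\<Union>(\<alpha>, r)\<in>{1..n} \<times> {..<CARD('q)}. W_piece n \<alpha> r)"
proof (intro equalityI subsetI)
  fix X :: "nat \<Rightarrow> complex^'q^'q"
  assume X: "X \<in> W_locus n"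
  then obtain \<alpha> where \<alpha>: "\<alpha> \<in> {1..n}" "\<forall>k\<in>{1..n} - {cpred n \<alpha>, \<alpha>}. X k = 0"
    "X \<alpha> ** X (cpred n \<alpha>) = 0"
    using W_locus_support[OF assms X] by blast
  let ?r = "rank (X (cpred n \<alpha>))"
  have piece: "X \<in> W_piece n \<alpha> ?r"
    using X \<alpha> rank_le_if_mult_eq_0[OF \<alpha>(3)] by (auto simp: W_piece_def W_locus_iff)
  show "X \<in> (\<Union>(\<alpha>, r)\<in>{1..n} \<times> {..<CARD('q)}. W_piece n \<alpha> r)"
  proof (cases "?r = CARD('q)")
    case True
    then have "X \<in> W_piece n (cpred n \<alpha>) 0"
      using piece W_piece_card_subset[OF assms(1) \<alpha>(1)] by auto
    moreover have "(0::nat) < CARD('q)"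
      by simp
    ultimately show ?thesis
      using cpred_simps(1)[OF assms(1) \<alpha>(1)] by blast
  next
    case False
    then have "?r < CARD('q)"
      using rank_le_card[of "X (cpred n \<alpha>)"] by simp
    then show ?thesis
      using \<alpha>(1) piece by blast
  qed
next
  fix X :: "nat \<Rightarrow> complex^'q^'q"
  assume "X \<in> (\<Union>(\<alpha>, r)\<in>{1..n} \<times> {..<CARD('q)}. W_piece n \<alpha> r)"
  then show "X \<in> W_locus n"
    using W_piece_subset_W_locus[OF assms(1)] by blast
qed

section \<open>Components and dimension of the Jacobian locus\<close>

text \<open>A pair of complementary coordinate projections attains both rank bounds, so inclusion in
  a piece with the same index forces r = s. With different indices, either r = 0 and the rank q
  exceeds s, or both supports are the same two positions in opposite order, which needs a cycle of
  length 2.\<close>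

lemma W_piece_incomparable:
  assumes "n \<ge> 2" "n \<ge> 4 \<or> CARD('q::finite) = 1"
    and \<alpha>: "\<alpha> \<in> {1..n}" "r < CARD('q)" and \<beta>: "\<beta> \<in> {1..n}" "s < CARD('q)"
    and sub: "(W_piece n \<alpha> r :: (nat \<Rightarrow> complex^'q^'q) set) \<subseteq> W_piece n \<beta> s"
  shows "\<alpha> = \<beta> \<and> r = s"
proof -
  obtain K :: "'q set" where K: "card K = r"
    using \<alpha>(2) by (metis less_imp_le obtain_subset_with_card_n)
  define X where "X = pair_tuple n \<alpha> (coord_proj K) (coord_proj (- K))"
  have "X \<in> W_piece n \<alpha> r"
    unfolding X_def pair_tuple_in_W_piece_iff[OF assms(1) \<alpha>(1)]
    by (simp add: rank_coord_proj K card_Compl_finite coord_proj_simps)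
  then have X: "\<And>k. k \<in> {1..n} \<Longrightarrow> k \<noteq> cpred n \<beta> \<Longrightarrow> k \<noteq> \<beta> \<Longrightarrow> X k = 0"
    "rank (X (cpred n \<beta>)) \<le> s" "rank (X \<beta>) \<le> CARD('q) - s"
    using sub by (auto simp: W_piece_def)
  have rank_\<alpha>: "rank (X \<alpha>) = CARD('q) - r"
    by (simp add: X_def pair_tuple_simps[OF assms(1) \<alpha>(1)] rank_coord_proj card_Compl_finite K)
  have rank_pred: "rank (X (cpred n \<alpha>)) = r"
    by (simp add: X_def pair_tuple_simps[OF assms(1) \<alpha>(1)] rank_coord_proj K)
  have "X \<alpha> \<noteq> 0"
    using rank_\<alpha> \<alpha>(2) rank_eq_0_iff[of "X \<alpha>"] by auto
  then have "\<alpha> = cpred n \<beta> \<or> \<alpha> = \<beta>"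
    using X(1)[OF \<alpha>(1)] by blast
  then show ?thesis
  proof
    assume eq: "\<alpha> = \<beta>"
    then show ?thesis
      using X(2,3) rank_\<alpha> rank_pred \<alpha>(2) \<beta>(2) by auto
  next
    assume eq: "\<alpha> = cpred n \<beta>"
    then have r: "CARD('q) - r \<le> s"
      using X(2) rank_\<alpha> by simp
    then have "r \<noteq> 0"
      using \<beta>(2) by auto
    then have n: "n \<ge> 4"
      using assms(2) \<alpha>(2) by auto
    have "X (cpred n \<alpha>) \<noteq> 0"
      using rank_pred \<open>r \<noteq> 0\<close> rank_eq_0_iff[of "X (cpred n \<alpha>)"] by auto
    then have "cpred n \<alpha> = \<beta>"
      using X(1)[of "cpred n \<alpha>"] cpred_simps[OF assms(1) \<alpha>(1)] eq by auto
    then have False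
      using eq n \<beta>(1) by (auto simp: cpred_def split: if_splits)
    then show ?thesis ..
  qed
qed

text \<open>With h = q div 2, the values of x (q - x) at h and s differ by (h - s) (q - h - s); both
  factors are nonnegative if s \<le> h and nonpositive otherwise.\<close>

lemma piece_dim_le:
  fixes q s :: nat
  assumes "s \<le> q"
  shows "q\<^sup>2 + s * q - s\<^sup>2 \<le> q\<^sup>2 + (q div 2) * q - (q div 2)\<^sup>2"
proof -
  define h where "h = q div 2"
  have "0 \<le> (int h - int s) * (int q - int h - int s)"
  proof (cases "s \<le> h")
    case True
    then show ?thesis
      by (intro mult_nonneg_nonneg) (auto simp: h_def)
  next
    case False
    then show ?thesis
      by (intro mult_nonpos_nonpos) (auto simp: h_def)
  qed
  then have "int (s * q) - int (s\<^sup>2) \<le> int (h * q) - int (h\<^sup>2)"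
    by (simp add: algebra_simps power2_eq_square)
  then show ?thesis
    unfolding h_def[symmetric] by linarith
qed

lemma piece_dim_half:
  fixes q :: nat
  shows "real (q\<^sup>2 + (q div 2) * q - (q div 2)\<^sup>2) =
    (if even q then 5 / 4 * (real q)\<^sup>2 else 5 / 4 * (real q)\<^sup>2 - 1 / 4)"
proof (cases "even q")
  case True
  then obtain h where h: "q = 2 * h"
    by blast
  have "q\<^sup>2 + (q div 2) * q - (q div 2)\<^sup>2 = 5 * h\<^sup>2"
    unfolding h by (simp add: power2_eq_square)
  then show ?thesis
    using True by (simp add: h power2_eq_square)
next
  case False
  then obtain h where h: "q = 2 * h + 1"
    using oddE by blast
  have "q\<^sup>2 + (q div 2) * q - (q div 2)\<^sup>2 = 5 * h\<^sup>2 + 5 * h + 1"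
    unfolding h by (simp add: power2_eq_square)
  then show ?thesis
    using False by (simp add: h power2_eq_square field_simps)
qed

text \<open>Floor and ceiling of q / 2 add up to q, and r q - r^2 is unchanged when r is replaced by
  q - r.\<close>

lemma half_cases:
  fixes q r :: nat
  assumes "r \<in> {nat \<lfloor>real q / 2\<rfloor>, nat \<lceil>real q / 2\<rceil>}"
  shows "r \<le> q" "q\<^sup>2 + r * q - r\<^sup>2 = q\<^sup>2 + (q div 2) * q - (q div 2)\<^sup>2"
proof -
  have "\<lfloor>real q / 2\<rfloor> = int (q div 2)"
    using floor_divide_of_nat_eq[of q 2] by simp
  moreover have "\<lceil>real q / 2\<rceil> = int (q - q div 2)"
    by (rule ceiling_unique) (cases "even q"; auto elim!: evenE oddE)+
  ultimately have r: "r = q div 2 \<or> r = q - q div 2"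
    using assms by auto
  then show "r \<le> q"
    by auto
  obtain h where "q = 2 * h \<or> q = 2 * h + 1"
    by (metis evenE oddE)
  then show "q\<^sup>2 + r * q - r\<^sup>2 = q\<^sup>2 + (q div 2) * q - (q div 2)\<^sup>2"
    using r by (auto simp: power2_eq_square)
qed

theorem theorem5p1:
  fixes n :: nat
  assumes "n \<ge> 2"
  shows
    "(\<forall>\<alpha>\<in>{1..n}. \<forall>r\<in>{0..CARD('q)}.
        closedin (zariski n) (W_piece n \<alpha> r :: (nat \<Rightarrow> complex^'q::finite^'q) set) \<and>
        irreducible_in (zariski n) (W_piece n \<alpha> r :: (nat \<Rightarrow> complex^'q^'q) set) \<and>
        zdim n (W_piece n \<alpha> r :: (nat \<Rightarrow> complex^'q^'q) set)
          = enat (CARD('q)\<^sup>2 + r * CARD('q) - r\<^sup>2)) \<and>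
     (\<forall>\<alpha>\<in>{1..n}. \<forall>r\<in>{nat \<lfloor>real CARD('q) / 2\<rfloor>, nat \<lceil>real CARD('q) / 2\<rceil>}.
        zdim n (W_piece n \<alpha> r :: (nat \<Rightarrow> complex^'q^'q) set)
          = Max {zdim n (W_piece n \<beta> s :: (nat \<Rightarrow> complex^'q^'q) set) | \<beta> s.
                   \<beta> \<in> {1..n} \<and> s \<in> {0..CARD('q)}}) \<and>
     (n \<ge> 4 \<or> CARD('q) = 1 \<longrightarrow>
        card (irreducible_components
          (subtopology (zariski n) (W_locus n :: (nat \<Rightarrow> complex^'q^'q) set))) = n * CARD('q) \<and>
        zdim n (W_locus n :: (nat \<Rightarrow> complex^'q^'q) set)
          = Max {zdim n (W_piece n \<beta> s :: (nat \<Rightarrow> complex^'q^'q) set) | \<beta> s.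
                   \<beta> \<in> {1..n} \<and> s \<in> {0..CARD('q)}} \<and>
        ereal_of_enat (zdim n (W_locus n :: (nat \<Rightarrow> complex^'q^'q) set))
          = ereal (if even CARD('q) then 5 / 4 * (real CARD('q))\<^sup>2
                   else 5 / 4 * (real CARD('q))\<^sup>2 - 1 / 4))"
proof -
  let ?q = "CARD('q)"
  let ?W = "\<lambda>\<alpha> r. W_piece n \<alpha> r :: (nat \<Rightarrow> complex^'q^'q) set"
  let ?dims = "{zdim n (?W \<beta> s) | \<beta> s. \<beta> \<in> {1..n} \<and> s \<in> {0..?q}}"
  define d where "d = ?q\<^sup>2 + (?q div 2) * ?q - (?q div 2)\<^sup>2"
  have zdim: "zdim n (?W \<alpha> r) = enat (?q\<^sup>2 + r * ?q - r\<^sup>2)" if "\<alpha> \<in> {1..n}" "r \<le> ?q" for \<alpha> r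
    using irreducible_and_zdim_W_piece(2)[OF assms that] .
  have le_d: "zdim n (?W \<alpha> r) \<le> enat d" if "\<alpha> \<in> {1..n}" "r \<le> ?q" for \<alpha> r
    using zdim[OF that] piece_dim_le[OF that(2)] by (simp add: d_def)
  have one: "1 \<in> {1..n}" and half: "?q div 2 < ?q"
    using assms by auto
  have zdim_half: "zdim n (?W 1 (?q div 2)) = enat d"
    using zdim[OF one, of "?q div 2"] by (simp add: d_def)
  have "?dims \<subseteq> (\<lambda>(\<beta>, s). zdim n (?W \<beta> s)) ` ({1..n} \<times> {0..?q})"
    by auto
  then have "finite ?dims"
    by (rule finite_subset) simp
  moreover have "enat d \<in> ?dims"
    using one half zdim_half by (metis (mono_tags, lifting) atLeastAtMost_iff less_imp_le mem_Collect_eq zero_le)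
  ultimately have Max_dims: "Max ?dims = enat d"
    using le_d by (intro Max_eqI) auto
  have part1: "closedin (zariski n) (?W \<alpha> r) \<and> irreducible_in (zariski n) (?W \<alpha> r) \<and>
      zdim n (?W \<alpha> r) = enat (?q\<^sup>2 + r * ?q - r\<^sup>2)" if "\<alpha> \<in> {1..n}" "r \<in> {0..?q}" for \<alpha> r
    using closedin_W_piece[OF assms that(1)] irreducible_and_zdim_W_piece[OF assms that(1)] that(2) by auto
  have part2: "zdim n (?W \<alpha> r) = Max ?dims"
    if "\<alpha> \<in> {1..n}" "r \<in> {nat \<lfloor>real ?q / 2\<rfloor>, nat \<lceil>real ?q / 2\<rceil>}" for \<alpha> r
    unfolding Max_dims using zdim[OF that(1) half_cases(1)[OF that(2)]] half_cases(2)[OF that(2)]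
    by (simp add: d_def)
  have part3: "card (irreducible_components (subtopology (zariski n)
        (W_locus n :: (nat \<Rightarrow> complex^'q^'q) set))) = n * ?q \<and>
      zdim n (W_locus n :: (nat \<Rightarrow> complex^'q^'q) set) = enat d" if nq: "n \<ge> 4 \<or> ?q = 1"
  proof -
    \<comment> \<open>r = q is left out, as those pieces recur with r = 0; the remaining ones are
      pairwise distinct and can be counted by their indices.\<close>
    define I where "I = {1..n} \<times> {..<?q}"
    define F where "F = (\<lambda>(\<alpha>, r). ?W \<alpha> r) ` I"
    have UF: "W_locus n = \<Union>F"
      using W_locus_eq_Union[OF assms nq] by (simp add: F_def I_def)
    have finF: "finite F"
      by (simp add: F_def I_def)
    have closed_irr: "closedin (zariski n) C \<and> irreducible_in (zariski n) C" if C: "C \<in> F" for C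
    proof -
      obtain \<alpha> r where \<alpha>r: "\<alpha> \<in> {1..n}" "r < ?q" "C = ?W \<alpha> r"
        using C by (auto simp: F_def I_def)
      then have "r \<in> {0..?q}"
        by simp
      then show ?thesis
        using part1[OF \<alpha>r(1)] \<alpha>r(3) by blast
    qed
    then have closed: "closedin (zariski n) C" and irr: "irreducible_in (zariski n) C" if "C \<in> F" for C
      using that by blast+
    have inc: "\<alpha> = \<beta> \<and> r = s"
      if "\<alpha> \<in> {1..n}" "r < ?q" "\<beta> \<in> {1..n}" "s < ?q" "?W \<alpha> r \<subseteq> ?W \<beta> s" for \<alpha> r \<beta> s
      using W_piece_incomparable[OF assms nq that] .
    have "irreducible_components (subtopology (zariski n) (\<Union>F)) = F"
    proof (rule irreducible_components_Union[OF finF closed irr])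
      fix C D assume CD: "C \<in> F" "D \<in> F" "C \<subseteq> D"
      obtain \<alpha> r where C: "\<alpha> \<in> {1..n}" "r < ?q" "C = ?W \<alpha> r"
        using CD(1) by (auto simp: F_def I_def)
      obtain \<beta> s where D: "\<beta> \<in> {1..n}" "s < ?q" "D = ?W \<beta> s"
        using CD(2) by (auto simp: F_def I_def)
      show "C = D"
        using inc[OF C(1,2) D(1,2)] CD(3) C(3) D(3) by simp
    qed
    moreover have "inj_on (\<lambda>(\<alpha>, r). ?W \<alpha> r) I"
    proof (rule inj_onI)
      fix p p' assume pp: "p \<in> I" "p' \<in> I" "(case p of (\<alpha>, r) \<Rightarrow> ?W \<alpha> r) = (case p' of (\<alpha>, r) \<Rightarrow> ?W \<alpha> r)"
      obtain \<alpha> r \<beta> s where p: "p = (\<alpha>, r)" "p' = (\<beta>, s)"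
        by (cases p; cases p')
      have "\<alpha> \<in> {1..n}" "r < ?q" "\<beta> \<in> {1..n}" "s < ?q" "?W \<alpha> r \<subseteq> ?W \<beta> s"
        using pp by (simp_all add: p I_def)
      then show "p = p'"
        using inc unfolding p by blast
    qed
    then have "card F = n * ?q"
      by (simp add: F_def card_image) (simp add: I_def)
    moreover have "zdim n (\<Union>F) = enat d"
    proof -
      have W1: "?W 1 (?q div 2) \<in> F"
        unfolding F_def I_def using one half by (intro image_eqI[of _ _ "(1, ?q div 2)"]) auto
      then have "zdim n (\<Union>F) = Max (zdim n ` F)"
        unfolding zdim_def by (intro krull_dim_Union[OF finF _ closed]) auto
      also have "\<dots> = enat d"
      proof (rule Max_eqI)
        show "enat d \<in> zdim n ` F"
          using W1 zdim_half by (metis imageI)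
        show "e \<le> enat d" if e: "e \<in> zdim n ` F" for e
        proof -
          obtain \<alpha> r where \<alpha>r: "\<alpha> \<in> {1..n}" "r < ?q" "e = zdim n (?W \<alpha> r)"
            using e by (auto simp: F_def I_def)
          then show ?thesis
            using le_d[OF \<alpha>r(1), of r] by simp
        qed
      qed (use finF in simp)
      finally show ?thesis .
    qed
    ultimately show ?thesis
      unfolding UF by simp
  qed
  have "ereal_of_enat (enat d) = ereal (if even ?q then 5 / 4 * (real ?q)\<^sup>2 else 5 / 4 * (real ?q)\<^sup>2 - 1 / 4)"
    using piece_dim_half[of ?q] by (simp add: d_def)
  then show ?thesis
    using part1 part2 part3 Max_dims by simp
qed

end
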